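(* Let $\widehat f\in L^1(\mathbb{R}^d)$, and let the source regularity assumption (A) and the integrability assumption (B) described in the context hold, for a fixed observation direction $n\in\mathbb{S}^{d-1}$. Then for every $x=Rn$ with $R>0$ the limit $$u(x):=\lim_{\varepsilon\to0^+}u_\varepsilon(x)$$ exists and is given by $$u(x)=\frac{\pi i}{(2\pi)^d}\sum_{j=1}^{J}\int_{\mathcal P_j}\frac{e^{iRs_+(\gamma)}\,\widehat f\bigl(\gamma t+s_+(\gamma)n\bigr)}{\sqrt{D(\gamma)}}\,d\gamma+\frac1{(2\pi)^d}\int_{\mathcal S}\frac{e^{ix\cdot\xi}\,\widehat f(\xi)}{\xi\cdot A\xi-\lambda}\,d\xi .$$
   Context: Setting. Let $d\ge2$, let $\lambda>0$ be fixed, let $A$ be a real-valued, positive definite $d\times d$ matrix, and let $f$ be a source on $\mathbb{R}^d$ with Fourier transform $\widehat f\in L^1(\mathbb{R}^d)$. For $\varepsilon>0$ put $$u_\varepsilon(x)=\frac1{(2\pi)^d}\int_{\mathbb{R}^d}\frac{e^{ix\cdot\xi}\widehat f(\xi)}{\xi\cdot A\xi-\lambda-i\varepsilon}\,d\xi ,$$ the solution of the damped problem $-\nabla\cdot A\nabla u_\varepsilon-(\lambda+i\varepsilon)u_\varepsilon=f$ in $\mathbb{R}^d$. The Fermi surface is $\mathbf F=\{\xi\in\mathbb{R}^d:\xi\cdot A\xi=\lambda\}$. Coordinates and characteristic roots. Fix $n\in\mathbb{S}^{d-1}$ and an orthonormal basis $t_1,\dots,t_{d-1}$ of $n^\perp$.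 For $\gamma=(\gamma_1,\dots,\gamma_{d-1})\in\mathbb{R}^{d-1}$ write $\gamma t:=\gamma_1t_1+\dots+\gamma_{d-1}t_{d-1}$ and decompose $\xi=\gamma t+sn$, $s\in\mathbb{R}$. Put $a=n\cdot An>0$, $b(\gamma)=\gamma t\cdot An$, $c(\gamma)=\gamma t\cdot A\gamma t-\lambda$, $D(\gamma)=b(\gamma)^2-a\,c(\gamma)$, so that $(\gamma t+sn)\cdot A(\gamma t+sn)-\lambda=as^2+2b(\gamma)s+c(\gamma)$. For $\varepsilon>0$ let $$s_\pm(\gamma,\varepsilon)=-\frac{b(\gamma)}a\pm\frac{\sqrt{D(\gamma)+ia\varepsilon}}a$$ with the principal branch of the square root (cut $(-\infty,0]$), so that $\operatorname{Im}s_+(\gamma,\varepsilon)>0>\operatorname{Im}s_-(\gamma,\varepsilon)$. Let $s_\pm(\gamma):=\lim_{\varepsilon\to0^+}s_\pm(\gamma,\varepsilon)=-b(\gamma)/a\pm\sqrt{D(\gamma)}/a$, where $\sqrt{D(\gamma)}$ is understood as $\lim_{\varepsilon\to0^+}\sqrt{D(\gamma)+ia\varepsilon}$. Neighbourhood of the Fermi surface. Fix $\delta>0$ and $\eta$ with $0<\eta<\delta/(2a)$. Let $\mathcal T_\delta=\{\gamma:|D(\gamma)|\le\delta\}$, $\mathcal N_\delta=\{\gamma:D(\gamma)>\delta\}$, and $$\widetilde{\mathcal U}_\eta(\mathbf F)=\{\xi=\gamma t+sn:\ |\xi\cdot A\xi-\lambda|<\eta,\ D(\gamma)>-\delta/2\}.$$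 For $\gamma\in\mathcal T_\delta\cup\mathcal N_\delta$, the line $L(\gamma)=\{\gamma t+sn:s\in\mathbb{R}\}$ meets $\widetilde{\mathcal U}_\eta(\mathbf F)$ in two disjoint segments, in one segment, or not at all. In the first case the corresponding sets of parameters $s$ are disjoint open intervals $I^-(\gamma),I^+(\gamma)$ with $\sup I^-(\gamma)\le\inf I^+(\gamma)$, and $\operatorname{ind}(\gamma):=\{-,+\}$. In the second case the set of parameters is a nonempty open interval $I^0(\gamma)$ and $\operatorname{ind}(\gamma):=\{0\}$. In the third case $I^0(\gamma):=\emptyset$ and $\operatorname{ind}(\gamma):=\{0\}$. For a simply connected bounded open set $\mathcal P\subset\mathbb{R}^{d-1}$ and an index $i\in\bigcap_{\gamma\in\mathcal P}\operatorname{ind}(\gamma)$ put $\mathcal U_{\mathcal P,i}:=\{\gamma t+sn:\gamma\in\mathcal P,\ s\in I^i(\gamma)\}$. Assumption (A) (source regularity). There exist finitely many bounded open sets $\mathcal P_j\subset\mathcal N_\delta\cup\mathcal T_\delta$, $j=1,\dots,J$, such that $\operatorname{ind}(\gamma)$ is constant on each $\mathcal P_j$. With $i_j$ denoting the index associated with $\mathcal P_j$ (an element of this common $\operatorname{ind}(\gamma)$; where a line meets the neighbourhood in two segments, its $\gamma$ belongs to two different sets $\mathcal P_j$, which are allowed to overlap), the sets $\mathcal U_j:=\mathcal U_{\mathcal P_j,i_j}$ are pairwise disjoint and satisfy $$\overline{\widetilde{\mathcal U}_\eta(\mathbf F)}=\bigcup_{j=1}^J\overline{\mathcal U_j}.$$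 For each $j$ there exists $\rho_j>0$ such that, for every $\gamma\in\mathcal P_j$, the function $s\mapsto\widehat f(\gamma t+sn)$ admits a holomorphic continuation (denoted by the same symbol) to a neighbourhood of the rectangle $$\mathcal Q_j(\gamma)=I^{i_j}(\gamma)+i[0,\rho_j]=\{z\in\mathbb{C}:\operatorname{Re}z\in I^{i_j}(\gamma),\ 0\le\operatorname{Im}z\le\rho_j\}.$$ No uniform bound in $\gamma$ is assumed, and no global holomorphic extension of $\widehat f$ to $\mathbb{C}^d$ is required. Deformed contours. For $\gamma\in\mathcal P_j$ the interval $I^{i_j}(\gamma)$ is deformed into the upper half-plane and replaced by the other three sides of the rectangle, $\mathcal C_j(\gamma):=\partial\mathcal Q_j(\gamma)\setminus I^{i_j}(\gamma)$, oriented clockwise (up, to the right, down). In the paper the following is asserted as a consequence of this construction and of the continuity of the roots in $\varepsilon$, and is not a separate hypothesis: for small $\varepsilon>0$ the root $s_+(\gamma,\varepsilon)$ lies inside $\mathcal Q_j(\gamma)$, the root $s_-(\gamma,\varepsilon)$ stays below the deformed contour, and for suitable $\varepsilon_j,c_j>0$ one has $\operatorname{dist}(s_\pm(\gamma,\varepsilon),\mathcal C_j(\gamma))\ge c_j$ for all $\gamma\in\mathcal P_j$, $0<\varepsilon<\varepsilon_j$. Assumption (B) (integrability). For each $j=1,\dots,J$ there exist $\varepsilon_j>0$ and $g_j\in L^1(\mathcal P_j)$ such that $$\left|\frac{\widehat f\bigl(\gamma t+s_+(\gamma,\varepsilon)n\bigr)}{\sqrt{D(\gamma)+ia\varepsilon}}\right|\le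 g_j(\gamma)\qquad\text{for }0<\varepsilon<\varepsilon_j,\ \gamma\in\mathcal P_j.$$ Moreover $\widehat f\in L^1(\mathcal S)$, where $\mathcal S$ is the deformed integration domain $$\mathcal S:=\bigl(\mathbb{R}^d\setminus\widetilde{\mathcal U}_\eta(\mathbf F)\bigr)\cup\bigcup_{j=1}^J\{\gamma t+sn:\gamma\in\mathcal P_j,\ s\in\mathcal C_j(\gamma)\}.$$ An integral over $\mathcal S$ means the integral over $\mathbb{R}^d\setminus\widetilde{\mathcal U}_\eta(\mathbf F)$ with respect to $d\xi$ plus $\sum_{j=1}^J\int_{\mathcal P_j}\int_{\mathcal C_j(\gamma)}(\cdot)\,ds\,d\gamma$, where on the contours $\xi=\gamma t+sn$ with complex $s$, $e^{ix\cdot\xi}=e^{iRs}$, $\xi\cdot A\xi-\lambda=as^2+2b(\gamma)s+c(\gamma)$, and $\widehat f$ is the holomorphic continuation from (A).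
   Formalization: The continued source is taken as 0 off the closed rectangle over I^{i_j}, so a residue counts only where that rectangle contains s_+ (the literal sum counts it twice); (A) also requires that the neighbourhood minus the union of the U_j be a null set. *)

theory Defs
  imports "HOL-Complex_Analysis.Complex_Analysis"
begin

text \<open>
  The space \<open>\<real>\<^sup>d\<close> is \<open>real ^ 'd\<close>, the parameter space \<open>\<real>\<^sup>d\<^sup>-\<^sup>1\<close> is \<open>real ^ 'm\<close>, and
  \<open>t :: 'm \<Rightarrow> real ^ 'd\<close> lists an orthonormal basis of the hyperplane orthogonal to \<open>n\<close>.
\<close>

text \<open>Symmetry is part of positive definiteness: it is what makes
  \<open>(\<gamma>t + s n) \<bullet> A (\<gamma>t + s n) - lam = a s\<^sup>2 + 2 b(\<gamma>) s + c(\<gamma>)\<close> hold.\<close>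

definition positive_definite :: "real ^ 'd ^ 'd \<Rightarrow> bool" where
  "positive_definite A \<longleftrightarrow> transpose A = A \<and> (\<forall>x. x \<noteq> 0 \<longrightarrow> x \<bullet> (A *v x) > 0)"

definition orthonormal_basis_perp :: "real ^ 'd \<Rightarrow> ('m::finite \<Rightarrow> real ^ 'd) \<Rightarrow> bool" where
  "orthonormal_basis_perp n t \<longleftrightarrow>
     (\<forall>k l. t k \<bullet> t l = (if k = l then 1 else 0)) \<and> span (range t) = {v. v \<bullet> n = 0}"

text \<open>The source enters only through \<open>fhat\<close>, its integrable Fourier transform.\<close>

definition u_damped ::
  "real ^ 'd ^ 'd \<Rightarrow> real \<Rightarrow> (real ^ 'd \<Rightarrow> complex) \<Rightarrow> real \<Rightarrow> real ^ 'd \<Rightarrow> complex" where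
  "u_damped A lam fhat \<epsilon> x =
     1 / (2 * pi) ^ CARD('d) *
     (LINT \<xi>|lebesgue. exp (\<i> * of_real (x \<bullet> \<xi>)) * fhat \<xi> /
        (of_real (\<xi> \<bullet> (A *v \<xi>)) - of_real lam - \<i> * of_real \<epsilon>))"


section \<open>Coordinates and characteristic roots\<close>

definition tangential :: "('m::finite \<Rightarrow> real ^ 'd) \<Rightarrow> real ^ 'm \<Rightarrow> real ^ 'd" where
  "tangential t \<gamma> = (\<Sum>k\<in>UNIV. (\<gamma> $ k) *\<^sub>R t k)"

definition coef_a :: "real ^ 'd ^ 'd \<Rightarrow> real ^ 'd \<Rightarrow> real" where
  "coef_a A n = n \<bullet> (A *v n)"

definition coef_b ::
  "real ^ 'd ^ 'd \<Rightarrow> real ^ 'd \<Rightarrow> ('m::finite \<Rightarrow> real ^ 'd) \<Rightarrow> real ^ 'm \<Rightarrow> real" where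
  "coef_b A n t \<gamma> = tangential t \<gamma> \<bullet> (A *v n)"

definition coef_c ::
  "real ^ 'd ^ 'd \<Rightarrow> real \<Rightarrow> ('m::finite \<Rightarrow> real ^ 'd) \<Rightarrow> real ^ 'm \<Rightarrow> real" where
  "coef_c A lam t \<gamma> = tangential t \<gamma> \<bullet> (A *v tangential t \<gamma>) - lam"

definition discr ::
  "real ^ 'd ^ 'd \<Rightarrow> real \<Rightarrow> real ^ 'd \<Rightarrow> ('m::finite \<Rightarrow> real ^ 'd) \<Rightarrow> real ^ 'm \<Rightarrow> real" where
  "discr A lam n t \<gamma> = (coef_b A n t \<gamma>)\<^sup>2 - coef_a A n * coef_c A lam t \<gamma>"

text \<open>\<open>\<xi> \<bullet> A \<xi> - lam\<close> at \<open>\<xi> = \<gamma>t + z n\<close>, for complex \<open>z\<close>.\<close>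

definition symbol ::
  "real ^ 'd ^ 'd \<Rightarrow> real \<Rightarrow> real ^ 'd \<Rightarrow> ('m::finite \<Rightarrow> real ^ 'd) \<Rightarrow> real ^ 'm \<Rightarrow> complex \<Rightarrow> complex"
  where
  "symbol A lam n t \<gamma> z =
     of_real (coef_a A n) * z\<^sup>2 + 2 * of_real (coef_b A n t \<gamma>) * z + of_real (coef_c A lam t \<gamma>)"

definition sqrt_discr_eps ::
  "real ^ 'd ^ 'd \<Rightarrow> real \<Rightarrow> real ^ 'd \<Rightarrow> ('m::finite \<Rightarrow> real ^ 'd) \<Rightarrow> real ^ 'm \<Rightarrow> real \<Rightarrow> complex"
  where
  "sqrt_discr_eps A lam n t \<gamma> \<epsilon> =
     csqrt (of_real (discr A lam n t \<gamma>) + \<i> * of_real (coef_a A n * \<epsilon>))"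

definition s_plus_eps ::
  "real ^ 'd ^ 'd \<Rightarrow> real \<Rightarrow> real ^ 'd \<Rightarrow> ('m::finite \<Rightarrow> real ^ 'd) \<Rightarrow> real ^ 'm \<Rightarrow> real \<Rightarrow> complex"
  where
  "s_plus_eps A lam n t \<gamma> \<epsilon> =
     - of_real (coef_b A n t \<gamma>) / of_real (coef_a A n)
     + sqrt_discr_eps A lam n t \<gamma> \<epsilon> / of_real (coef_a A n)"

definition sqrt_discr ::
  "real ^ 'd ^ 'd \<Rightarrow> real \<Rightarrow> real ^ 'd \<Rightarrow> ('m::finite \<Rightarrow> real ^ 'd) \<Rightarrow> real ^ 'm \<Rightarrow> complex" where
  "sqrt_discr A lam n t \<gamma> = Lim (at_right 0) (sqrt_discr_eps A lam n t \<gamma>)"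

definition s_plus ::
  "real ^ 'd ^ 'd \<Rightarrow> real \<Rightarrow> real ^ 'd \<Rightarrow> ('m::finite \<Rightarrow> real ^ 'd) \<Rightarrow> real ^ 'm \<Rightarrow> complex" where
  "s_plus A lam n t \<gamma> = Lim (at_right 0) (s_plus_eps A lam n t \<gamma>)"


section \<open>Neighbourhood of the Fermi surface\<close>

definition T_region ::
  "real ^ 'd ^ 'd \<Rightarrow> real \<Rightarrow> real ^ 'd \<Rightarrow> ('m::finite \<Rightarrow> real ^ 'd) \<Rightarrow> real \<Rightarrow> (real ^ 'm) set" where
  "T_region A lam n t \<delta> = {\<gamma>. \<bar>discr A lam n t \<gamma>\<bar> \<le> \<delta>}"

definition N_region ::
  "real ^ 'd ^ 'd \<Rightarrow> real \<Rightarrow> real ^ 'd \<Rightarrow> ('m::finite \<Rightarrow> real ^ 'd) \<Rightarrow> real \<Rightarrow> (real ^ 'm) set" where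
  "N_region A lam n t \<delta> = {\<gamma>. discr A lam n t \<gamma> > \<delta>}"

definition fermi_nbhd ::
  "real ^ 'd ^ 'd \<Rightarrow> real \<Rightarrow> real ^ 'd \<Rightarrow> ('m::finite \<Rightarrow> real ^ 'd) \<Rightarrow> real \<Rightarrow> real \<Rightarrow> (real ^ 'd) set"
  where
  "fermi_nbhd A lam n t \<delta> \<eta> =
     {\<xi>. \<exists>\<gamma> s. \<xi> = tangential t \<gamma> + s *\<^sub>R n \<and>
          \<bar>\<xi> \<bullet> (A *v \<xi>) - lam\<bar> < \<eta> \<and> discr A lam n t \<gamma> > - \<delta> / 2}"

definition line_params ::
  "real ^ 'd ^ 'd \<Rightarrow> real \<Rightarrow> real ^ 'd \<Rightarrow> ('m::finite \<Rightarrow> real ^ 'd) \<Rightarrow> real \<Rightarrow> real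
     \<Rightarrow> real ^ 'm \<Rightarrow> real set" where
  "line_params A lam n t \<delta> \<eta> \<gamma> =
     {s. tangential t \<gamma> + s *\<^sub>R n \<in> fermi_nbhd A lam n t \<delta> \<eta>}"

datatype seg_index = Seg_Minus | Seg_Zero | Seg_Plus

text \<open>The segments are the connected components of the parameter set; two components that share
  an endpoint count as two segments.\<close>

definition ind ::
  "real ^ 'd ^ 'd \<Rightarrow> real \<Rightarrow> real ^ 'd \<Rightarrow> ('m::finite \<Rightarrow> real ^ 'd) \<Rightarrow> real \<Rightarrow> real
     \<Rightarrow> real ^ 'm \<Rightarrow> seg_index set" where
  "ind A lam n t \<delta> \<eta> \<gamma> =
     (if card (components (line_params A lam n t \<delta> \<eta> \<gamma>)) = 2
      then {Seg_Minus, Seg_Plus} else {Seg_Zero})"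

text \<open>Only the values with \<open>i \<in> ind \<gamma>\<close> are meaningful.\<close>

definition segment ::
  "real ^ 'd ^ 'd \<Rightarrow> real \<Rightarrow> real ^ 'd \<Rightarrow> ('m::finite \<Rightarrow> real ^ 'd) \<Rightarrow> real \<Rightarrow> real
     \<Rightarrow> seg_index \<Rightarrow> real ^ 'm \<Rightarrow> real set" where
  "segment A lam n t \<delta> \<eta> i \<gamma> =
     (let S = line_params A lam n t \<delta> \<eta> \<gamma> in
      case i of
        Seg_Zero \<Rightarrow> S
      | Seg_Minus \<Rightarrow>
          (THE C. C \<in> components S \<and> (\<forall>C'\<in>components S - {C}. Sup C \<le> Inf C'))
      | Seg_Plus \<Rightarrow>
          (THE C. C \<in> components S \<and> (\<forall>C'\<in>components S - {C}. Sup C' \<le> Inf C)))"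

definition U_piece ::
  "real ^ 'd ^ 'd \<Rightarrow> real \<Rightarrow> real ^ 'd \<Rightarrow> ('m::finite \<Rightarrow> real ^ 'd) \<Rightarrow> real \<Rightarrow> real
     \<Rightarrow> (real ^ 'm) set \<Rightarrow> seg_index \<Rightarrow> (real ^ 'd) set" where
  "U_piece A lam n t \<delta> \<eta> P i =
     {\<xi>. \<exists>\<gamma>\<in>P. \<exists>s\<in>segment A lam n t \<delta> \<eta> i \<gamma>. \<xi> = tangential t \<gamma> + s *\<^sub>R n}"


section \<open>Rectangles, contours and the continued Fourier transform\<close>

definition rectangle :: "real set \<Rightarrow> real \<Rightarrow> complex set" where
  "rectangle I \<rho> = {z. Re z \<in> I \<and> 0 \<le> Im z \<and> Im z \<le> \<rho>}"

definition deformed_contour :: "real set \<Rightarrow> real \<Rightarrow> real \<Rightarrow> complex" where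
  "deformed_contour I \<rho> =
     linepath (Complex (Inf I) 0) (Complex (Inf I) \<rho>) +++
     linepath (Complex (Inf I) \<rho>) (Complex (Sup I) \<rho>) +++
     linepath (Complex (Sup I) \<rho>) (Complex (Sup I) 0)"

text \<open>
  \<open>fc \<gamma>\<close> is a holomorphic continuation of \<open>s \<mapsto> fhat (\<gamma>t + s n)\<close> from \<open>I \<gamma>\<close> to a neighbourhood of
  the rectangle over \<open>I \<gamma>\<close>. That is the only place where a complex argument of the Fourier
  transform has a meaning, so \<open>cont_on_rect\<close>, the continued Fourier transform as it enters the
  assumptions and the representation formula, is set to \<open>0\<close> off the closed rectangle.

  Consequences of this totalisation: lines with empty \<open>I \<gamma>\<close> contribute nothing, and a residue at
  \<open>s\<^sub>+(\<gamma>)\<close> is collected exactly from those rectangles which contain \<open>s\<^sub>+(\<gamma>)\<close>. For index \<open>+\<close> this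
  is always so; for index \<open>0\<close> it fails if \<open>I \<gamma>\<close> is empty or the rectangle is too low; for
  index \<open>-\<close> it never holds, since \<open>s\<^sub>+(\<gamma>)\<close> lies over the other segment of the line, so that
  the residue is not counted twice.
\<close>

definition cont_on_rect :: "real set \<Rightarrow> real \<Rightarrow> (complex \<Rightarrow> complex) \<Rightarrow> complex \<Rightarrow> complex" where
  "cont_on_rect I \<rho> F z = (if z \<in> closure (rectangle I \<rho>) then F z else 0)"

text \<open>
  \<open>U\<^sub>j = U_piece (P j) (idx j)\<close>. The last condition on the \<open>U\<^sub>j\<close> says that the closed pieces cover
  the neighbourhood without hiding mass in the boundaries: the closure identity alone allows
  open sets \<open>P j\<close> whose boundaries have positive measure, and the lines over these boundaries
  would be missing from the representation formula.

  The continuation lives on a neighbourhood of the \<^emph>\<open>closed\<close> rectangle because the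
  deformed contour contains its vertical sides.
\<close>

definition assumption_A ::
  "real ^ 'd ^ 'd \<Rightarrow> real \<Rightarrow> real ^ 'd \<Rightarrow> ('m::finite \<Rightarrow> real ^ 'd) \<Rightarrow> real \<Rightarrow> real
     \<Rightarrow> (real ^ 'd \<Rightarrow> complex) \<Rightarrow> nat \<Rightarrow> (nat \<Rightarrow> (real ^ 'm) set) \<Rightarrow> (nat \<Rightarrow> seg_index)
     \<Rightarrow> (nat \<Rightarrow> real) \<Rightarrow> (nat \<Rightarrow> real ^ 'm \<Rightarrow> complex \<Rightarrow> complex) \<Rightarrow> bool" where
  "assumption_A A lam n t \<delta> \<eta> fhat J P idx \<rho> fc \<longleftrightarrow>
     (\<forall>j\<in>{1..J}. open (P j) \<and> bounded (P j) \<and>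
        P j \<subseteq> N_region A lam n t \<delta> \<union> T_region A lam n t \<delta> \<and>
        (\<forall>\<gamma>\<in>P j. \<forall>\<gamma>'\<in>P j. ind A lam n t \<delta> \<eta> \<gamma> = ind A lam n t \<delta> \<eta> \<gamma>') \<and>
        (\<forall>\<gamma>\<in>P j. idx j \<in> ind A lam n t \<delta> \<eta> \<gamma>)) \<and>
     (\<forall>j\<in>{1..J}. \<forall>k\<in>{1..J}. j \<noteq> k \<longrightarrow>
        U_piece A lam n t \<delta> \<eta> (P j) (idx j) \<inter> U_piece A lam n t \<delta> \<eta> (P k) (idx k) = {}) \<and>
     closure (fermi_nbhd A lam n t \<delta> \<eta>) =
       (\<Union>j\<in>{1..J}. closure (U_piece A lam n t \<delta> \<eta> (P j) (idx j))) \<and>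
     negligible (fermi_nbhd A lam n t \<delta> \<eta> - (\<Union>j\<in>{1..J}. U_piece A lam n t \<delta> \<eta> (P j) (idx j))) \<and>
     (\<forall>j\<in>{1..J}. \<rho> j > 0 \<and>
        (\<forall>\<gamma>\<in>P j. \<exists>V. open V \<and>
           closure (rectangle (segment A lam n t \<delta> \<eta> (idx j) \<gamma>) (\<rho> j)) \<subseteq> V \<and>
           fc j \<gamma> holomorphic_on V \<and>
           (\<forall>s\<in>segment A lam n t \<delta> \<eta> (idx j) \<gamma>.
              fc j \<gamma> (of_real s) = fhat (tangential t \<gamma> + s *\<^sub>R n))))"

definition fhat_cont ::
  "real ^ 'd ^ 'd \<Rightarrow> real \<Rightarrow> real ^ 'd \<Rightarrow> ('m::finite \<Rightarrow> real ^ 'd) \<Rightarrow> real \<Rightarrow> real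
     \<Rightarrow> (nat \<Rightarrow> seg_index) \<Rightarrow> (nat \<Rightarrow> real) \<Rightarrow> (nat \<Rightarrow> real ^ 'm \<Rightarrow> complex \<Rightarrow> complex)
     \<Rightarrow> nat \<Rightarrow> real ^ 'm \<Rightarrow> complex \<Rightarrow> complex" where
  "fhat_cont A lam n t \<delta> \<eta> idx \<rho> fc j \<gamma> =
     cont_on_rect (segment A lam n t \<delta> \<eta> (idx j) \<gamma>) (\<rho> j) (fc j \<gamma>)"

definition contour ::
  "real ^ 'd ^ 'd \<Rightarrow> real \<Rightarrow> real ^ 'd \<Rightarrow> ('m::finite \<Rightarrow> real ^ 'd) \<Rightarrow> real \<Rightarrow> real
     \<Rightarrow> (nat \<Rightarrow> seg_index) \<Rightarrow> (nat \<Rightarrow> real) \<Rightarrow> nat \<Rightarrow> real ^ 'm \<Rightarrow> real \<Rightarrow> complex" where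
  "contour A lam n t \<delta> \<eta> idx \<rho> j \<gamma> =
     deformed_contour (segment A lam n t \<delta> \<eta> (idx j) \<gamma>) (\<rho> j)"


section \<open>Integration over the deformed domain\<close>

text \<open>
  A function on the deformed domain is a pair of a function \<open>g\<close> on the complement of the
  neighbourhood and a family \<open>h j \<gamma>\<close> on the contours. In \<open>L1_deformed\<close> the contours carry
  arc length, written out on the left, upper and right side of the rectangle.
\<close>

definition L1_deformed ::
  "real ^ 'd ^ 'd \<Rightarrow> real \<Rightarrow> real ^ 'd \<Rightarrow> ('m::finite \<Rightarrow> real ^ 'd) \<Rightarrow> real \<Rightarrow> real
     \<Rightarrow> nat \<Rightarrow> (nat \<Rightarrow> (real ^ 'm) set) \<Rightarrow> (nat \<Rightarrow> seg_index) \<Rightarrow> (nat \<Rightarrow> real)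
     \<Rightarrow> (real ^ 'd \<Rightarrow> complex) \<Rightarrow> (nat \<Rightarrow> real ^ 'm \<Rightarrow> complex \<Rightarrow> complex) \<Rightarrow> bool" where
  "L1_deformed A lam n t \<delta> \<eta> J P idx \<rho> g h \<longleftrightarrow>
     set_integrable lebesgue (- fermi_nbhd A lam n t \<delta> \<eta>) g \<and>
     (\<forall>j\<in>{1..J}.
        set_integrable lebesgue (P j \<times> {0..\<rho> j})
          (\<lambda>(\<gamma>, \<tau>). h j \<gamma> (Complex (Inf (segment A lam n t \<delta> \<eta> (idx j) \<gamma>)) \<tau>)) \<and>
        set_integrable lebesgue {(\<gamma>, s). \<gamma> \<in> P j \<and> s \<in> segment A lam n t \<delta> \<eta> (idx j) \<gamma>}
          (\<lambda>(\<gamma>, s). h j \<gamma> (Complex s (\<rho> j))) \<and>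
        set_integrable lebesgue (P j \<times> {0..\<rho> j})
          (\<lambda>(\<gamma>, \<tau>). h j \<gamma> (Complex (Sup (segment A lam n t \<delta> \<eta> (idx j) \<gamma>)) \<tau>)))"

text \<open>The integral over the contours is an iterated one, and so is its existence.\<close>

definition integrable_deformed ::
  "real ^ 'd ^ 'd \<Rightarrow> real \<Rightarrow> real ^ 'd \<Rightarrow> ('m::finite \<Rightarrow> real ^ 'd) \<Rightarrow> real \<Rightarrow> real
     \<Rightarrow> nat \<Rightarrow> (nat \<Rightarrow> (real ^ 'm) set) \<Rightarrow> (nat \<Rightarrow> seg_index) \<Rightarrow> (nat \<Rightarrow> real)
     \<Rightarrow> (real ^ 'd \<Rightarrow> complex) \<Rightarrow> (nat \<Rightarrow> real ^ 'm \<Rightarrow> complex \<Rightarrow> complex) \<Rightarrow> bool" where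
  "integrable_deformed A lam n t \<delta> \<eta> J P idx \<rho> g h \<longleftrightarrow>
     set_integrable lebesgue (- fermi_nbhd A lam n t \<delta> \<eta>) g \<and>
     (\<forall>j\<in>{1..J}.
        (AE \<gamma> in lebesgue. \<gamma> \<in> P j \<longrightarrow>
           h j \<gamma> contour_integrable_on contour A lam n t \<delta> \<eta> idx \<rho> j \<gamma>) \<and>
        set_integrable lebesgue (P j)
          (\<lambda>\<gamma>. contour_integral (contour A lam n t \<delta> \<eta> idx \<rho> j \<gamma>) (h j \<gamma>)))"

definition integral_deformed ::
  "real ^ 'd ^ 'd \<Rightarrow> real \<Rightarrow> real ^ 'd \<Rightarrow> ('m::finite \<Rightarrow> real ^ 'd) \<Rightarrow> real \<Rightarrow> real
     \<Rightarrow> nat \<Rightarrow> (nat \<Rightarrow> (real ^ 'm) set) \<Rightarrow> (nat \<Rightarrow> seg_index) \<Rightarrow> (nat \<Rightarrow> real)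
     \<Rightarrow> (real ^ 'd \<Rightarrow> complex) \<Rightarrow> (nat \<Rightarrow> real ^ 'm \<Rightarrow> complex \<Rightarrow> complex) \<Rightarrow> complex" where
  "integral_deformed A lam n t \<delta> \<eta> J P idx \<rho> g h =
     (LINT \<xi>:- fermi_nbhd A lam n t \<delta> \<eta>|lebesgue. g \<xi>) +
     (\<Sum>j=1..J. LINT \<gamma>:P j|lebesgue.
        contour_integral (contour A lam n t \<delta> \<eta> idx \<rho> j \<gamma>) (h j \<gamma>))"

definition assumption_B ::
  "real ^ 'd ^ 'd \<Rightarrow> real \<Rightarrow> real ^ 'd \<Rightarrow> ('m::finite \<Rightarrow> real ^ 'd) \<Rightarrow> real \<Rightarrow> real
     \<Rightarrow> (real ^ 'd \<Rightarrow> complex) \<Rightarrow> nat \<Rightarrow> (nat \<Rightarrow> (real ^ 'm) set) \<Rightarrow> (nat \<Rightarrow> seg_index)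
     \<Rightarrow> (nat \<Rightarrow> real) \<Rightarrow> (nat \<Rightarrow> real ^ 'm \<Rightarrow> complex \<Rightarrow> complex) \<Rightarrow> bool" where
  "assumption_B A lam n t \<delta> \<eta> fhat J P idx \<rho> fc \<longleftrightarrow>
     (\<forall>j\<in>{1..J}. \<exists>\<epsilon>\<^sub>0>0. \<exists>g :: real ^ 'm \<Rightarrow> real. set_integrable lebesgue (P j) g \<and>
        (\<forall>\<epsilon> \<gamma>. 0 < \<epsilon> \<and> \<epsilon> < \<epsilon>\<^sub>0 \<and> \<gamma> \<in> P j \<longrightarrow>
           norm (fhat_cont A lam n t \<delta> \<eta> idx \<rho> fc j \<gamma> (s_plus_eps A lam n t \<gamma> \<epsilon>) /
                 sqrt_discr_eps A lam n t \<gamma> \<epsilon>) \<le> g \<gamma>)) \<and>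
     L1_deformed A lam n t \<delta> \<eta> J P idx \<rho> fhat (fhat_cont A lam n t \<delta> \<eta> idx \<rho> fc)"

text \<open>The integrands of the representation formula at \<open>x = R n\<close>; note \<open>x \<bullet> (\<gamma>t + s n) = R s\<close>.\<close>

definition residue_integrand ::
  "real ^ 'd ^ 'd \<Rightarrow> real \<Rightarrow> real ^ 'd \<Rightarrow> ('m::finite \<Rightarrow> real ^ 'd) \<Rightarrow> real \<Rightarrow> real
     \<Rightarrow> (nat \<Rightarrow> seg_index) \<Rightarrow> (nat \<Rightarrow> real) \<Rightarrow> (nat \<Rightarrow> real ^ 'm \<Rightarrow> complex \<Rightarrow> complex)
     \<Rightarrow> real \<Rightarrow> nat \<Rightarrow> real ^ 'm \<Rightarrow> complex" where
  "residue_integrand A lam n t \<delta> \<eta> idx \<rho> fc R j \<gamma> =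
     exp (\<i> * of_real R * s_plus A lam n t \<gamma>) *
     fhat_cont A lam n t \<delta> \<eta> idx \<rho> fc j \<gamma> (s_plus A lam n t \<gamma>) / sqrt_discr A lam n t \<gamma>"

definition volume_integrand ::
  "real ^ 'd ^ 'd \<Rightarrow> real \<Rightarrow> (real ^ 'd \<Rightarrow> complex) \<Rightarrow> real ^ 'd \<Rightarrow> real ^ 'd \<Rightarrow> complex" where
  "volume_integrand A lam fhat x \<xi> =
     exp (\<i> * of_real (x \<bullet> \<xi>)) * fhat \<xi> / of_real (\<xi> \<bullet> (A *v \<xi>) - lam)"

definition contour_integrand ::
  "real ^ 'd ^ 'd \<Rightarrow> real \<Rightarrow> real ^ 'd \<Rightarrow> ('m::finite \<Rightarrow> real ^ 'd) \<Rightarrow> real \<Rightarrow> real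
     \<Rightarrow> (nat \<Rightarrow> seg_index) \<Rightarrow> (nat \<Rightarrow> real) \<Rightarrow> (nat \<Rightarrow> real ^ 'm \<Rightarrow> complex \<Rightarrow> complex)
     \<Rightarrow> real \<Rightarrow> nat \<Rightarrow> real ^ 'm \<Rightarrow> complex \<Rightarrow> complex" where
  "contour_integrand A lam n t \<delta> \<eta> idx \<rho> fc R j \<gamma> z =
     exp (\<i> * of_real R * z) * fhat_cont A lam n t \<delta> \<eta> idx \<rho> fc j \<gamma> z / symbol A lam n t \<gamma> z"

end

theory Submission
  imports Defs
begin

text \<open>
  The singularity of the damped integrand lies on the Fermi surface, which is surrounded by the
  neighbourhood \<open>U\<close>. Outside \<open>U\<close> the symbol is at least \<open>\<eta>\<close> in absolute value and the limit \<open>\<epsilon> \<rightarrow> 0\<close> is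
  dominated convergence (\<open>exterior_limit\<close>). Inside \<open>U\<close>, Fubini in the coordinates
  \<open>\<xi> = \<gamma>t + s n\<close> reduces the integral to integrals over real segments, one for each line
  (\<open>piece_integral\<close>, \<open>integral_over_U\<close>). The coordinates are an isometry between Euclidean spaces
  and preserve Lebesgue measure (\<open>lborel_distr_isometry\<close>).

  On a line the symbol is \<open>a (z - s\<^sub>+) (z - s\<^sub>-)\<close> with \<open>s\<^sub>-\<close> in the lower half-plane. Shifting the
  segment to the other three sides of the rectangle costs the residue at \<open>s\<^sub>+\<close> if that root lies inside
  the rectangle (\<open>line_integral_eq_contour_plus_residue\<close>). Neither the contour integral nor the
  residue degenerates as \<open>\<epsilon> \<rightarrow> 0\<close>, provided that \<open>D \<noteq> 0\<close> and that the limit root is not on the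
  contour (\<open>line_integral_limit\<close>). For a rectangle of height \<open>\<rho>\<close> the latter fails only for
  \<open>D = - (a \<rho>)\<^sup>2\<close> (\<open>symbol_nonzero_on_contour\<close>), and level sets of \<open>D\<close> below its maximal value are null
  sets because \<open>a lam - D\<close> is a quadratic form (\<open>negligible_discr_level\<close>). So the limit exists for almost
  every line.

  To integrate this over the lines, a majorant uniform in \<open>\<epsilon>\<close> is needed
  (\<open>line_integral_dominated\<close>). The distance of the roots from the contour is not bounded below
  uniformly on all lines: for the index \<open>0\<close> and a low rectangle the root crosses the upper side as \<open>D\<close> decreases
  to \<open>- a \<eta>\<close>. But that happens only for \<open>D \<le> - \<kappa>\<close> with some \<open>\<kappa> > 0\<close>, where the line has a positive
  distance from the Fermi surface and the original integral over the segment is bounded by the mass of the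
  source on the line. For \<open>D \<ge> - \<kappa>\<close> the symbol is bounded below on the contour
  (\<open>symbol_lower_bound_on_contour\<close>), and the line integral is bounded by the mass of the source on the contour
  plus the residue, which the integrability assumption controls.
\<close>

section \<open>Lebesgue measure on products and under isometries\<close>

lemma isometry_image_ball:
  fixes f :: "'a::metric_space \<Rightarrow> 'b::metric_space"
  assumes "\<And>x y. dist (f x) (f y) = dist x y" and "surj f"
  shows "f ` ball x r = ball (f x) r"
proof -
  have "y \<in> f ` ball x r" if "dist (f x) y < r" for y
  proof -
    obtain z where "y = f z" using \<open>surj f\<close> by (metis surjD)
    then show ?thesis using that assms(1) by auto
  qed
  then show ?thesis using assms(1) by auto
qed

text \<open>By Vitali's theorem an open set is a countable disjoint union of balls, up to a null set, and the
  volume of a ball depends only on its radius and the dimension. An isometry maps the balls to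
  disjoint balls of the same radius.\<close>

lemma emeasure_open_le_isometry_image:
  fixes f :: "'a::euclidean_space \<Rightarrow> 'b::euclidean_space"
  assumes iso: "\<And>x y. dist (f x) (f y) = dist x y" and sur: "surj f"
    and dim: "DIM('a) = DIM('b)" and U: "open U"
  shows "emeasure lborel U \<le> emeasure lborel (f ` U)"
proof -
  define K where "K = {(x::'a, r::real). x \<in> U \<and> 0 < r \<and> ball x r \<subseteq> U}"
  have "\<exists>i. i \<in> K \<and> x \<in> ball (fst i) (snd i) \<and> snd i < d" if x: "x \<in> U" "0 < d" for x d
  proof -
    obtain e where e: "e > 0" "ball x e \<subseteq> U" using U x(1) open_contains_ball by blast
    define r where "r = min e (d / 2)"
    have "ball x r \<subseteq> ball x e" by (auto simp: r_def)
    then have "(x, r) \<in> K" "r < d" "r > 0" using e x by (auto simp: K_def r_def)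
    then show ?thesis by (intro exI[of _ "(x, r)"]) auto
  qed
  then obtain C where C: "countable C" "C \<subseteq> K"
     "pairwise (\<lambda>i j. disjnt (ball (fst i) (snd i)) (ball (fst j) (snd j))) C"
     and neg: "negligible (U - (\<Union>i\<in>C. ball (fst i) (snd i)))"
    by (rule Vitali_covering_theorem_balls)
  have inj: "inj f" by (rule injI) (metis iso dist_eq_0_iff)
  have disj: "disjoint_family_on (\<lambda>i. ball (fst i) (snd i)) C"
    using C(3) by (auto simp: disjoint_family_on_def pairwise_def disjnt_def)
  have disj': "disjoint_family_on (\<lambda>i. f ` ball (fst i) (snd i)) C"
    using disj by (simp add: disjoint_family_on_def image_Int[OF inj, symmetric])
  define N where "N = U - (\<Union>i\<in>C. ball (fst i) (snd i))"
  have Nb: "N \<in> sets borel" unfolding N_def using U C by (intro sets.Diff borel_open open_UN) auto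
  have N0: "N \<in> null_sets lborel"
    using neg Nb unfolding N_def[symmetric]
    by (simp add: negligible_iff_null_sets null_sets_completion_iff)
  have "emeasure lborel U \<le> emeasure lborel ((\<Union>i\<in>C. ball (fst i) (snd i)) \<union> N)"
  proof (rule emeasure_mono)
    have "(\<Union>i\<in>C. ball (fst i) (snd i)) \<in> sets borel" by (intro borel_open open_UN) auto
    then show "(\<Union>i\<in>C. ball (fst i) (snd i)) \<union> N \<in> sets lborel" using Nb by simp
  qed (auto simp: N_def)
  also have "\<dots> = emeasure lborel (\<Union>i\<in>C. ball (fst i) (snd i))"
    using N0 by (intro emeasure_Un_null_set) (auto intro!: borel_open open_UN)
  also have "\<dots> = (\<integral>\<^sup>+i. emeasure lborel (ball (fst i) (snd i)) \<partial>count_space C)"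
    using C disj by (intro emeasure_UN_countable) auto
  also have "\<dots> = (\<integral>\<^sup>+i. emeasure lborel (f ` ball (fst i) (snd i)) \<partial>count_space C)"
  proof (intro nn_integral_cong)
    fix i assume "i \<in> space (count_space C)"
    then have "i \<in> K" using C(2) by auto
    then have "snd i > 0" by (auto simp: K_def)
    then show "emeasure lborel (ball (fst i) (snd i)) = emeasure lborel (f ` ball (fst i) (snd i))"
      by (simp add: isometry_image_ball[OF iso sur] emeasure_ball dim)
  qed
  also have "\<dots> = emeasure lborel (\<Union>i\<in>C. f ` ball (fst i) (snd i))"
    using C disj' by (intro emeasure_UN_countable[symmetric]) (auto simp: isometry_image_ball[OF iso sur])
  also have "\<dots> \<le> emeasure lborel (f ` U)"
  proof (rule emeasure_mono)
    show "(\<Union>i\<in>C. f ` ball (fst i) (snd i)) \<subseteq> f ` U"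
      using C(2) by (fastforce simp: K_def)
    have "open (f ` U)" unfolding open_contains_ball
    proof
      fix y assume "y \<in> f ` U"
      then obtain x where x: "x \<in> U" "y = f x" by auto
      obtain e where "e > 0" "ball x e \<subseteq> U" using U x(1) open_contains_ball by blast
      then show "\<exists>e>0. ball y e \<subseteq> f ` U"
        by (intro exI[of _ e])
          (simp add: x(2) isometry_image_ball[OF iso sur, symmetric] image_mono)
    qed
    then show "f ` U \<in> sets lborel" by simp
  qed
  finally show ?thesis .
qed

text \<open>The change of variables from \<open>(\<gamma>, s)\<close> to \<open>\<xi>\<close> is an isometry between two different Euclidean
  spaces, and not an orthogonal map of one of them. The preceding
  inequality for the isometry and for its inverse gives equality on boxes.\<close>

lemma lborel_distr_isometry:
  fixes f :: "'a::euclidean_space \<Rightarrow> 'b::euclidean_space"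
  assumes iso: "\<And>x y. dist (f x) (f y) = dist x y" and sur: "surj f"
    and dim: "DIM('a) = DIM('b)"
  shows "distr lborel borel f = lborel"
proof (rule lborel_eqI[symmetric])
  have cont: "continuous_on UNIV f"
    by (rule continuous_onI) (auto simp: iso)
  have meas: "f \<in> borel_measurable borel"
    using cont by (simp add: borel_measurable_continuous_onI)
  have inj: "inj f" by (rule injI) (metis iso dist_eq_0_iff)
  define g where "g = inv f"
  have fg: "f (g y) = y" for y using sur by (simp add: g_def surj_f_inv_f)
  have gf: "g (f x) = x" for x using inj by (simp add: g_def)
  have isog: "dist (g x) (g y) = dist x y" for x y by (metis iso fg)
  have surg: "surj g" by (metis gf surjI)
  fix l u :: 'b assume lu: "\<And>b. b \<in> Basis \<Longrightarrow> l \<bullet> b \<le> u \<bullet> b"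
  have op: "open (f -` box l u)" using open_vimage[OF open_box cont] .
  have "f ` (f -` box l u) = box l u" using sur by (simp add: surj_image_vimage_eq)
  then have "emeasure lborel (f -` box l u) \<le> emeasure lborel (box l u)"
    using emeasure_open_le_isometry_image[OF iso sur dim op] by simp
  moreover have "g ` box l u = f -` box l u"
    using fg gf by (auto simp: image_iff) (metis gf)
  then have "emeasure lborel (box l u) \<le> emeasure lborel (f -` box l u)"
    using emeasure_open_le_isometry_image[OF isog surg dim[symmetric] open_box, of l u] by simp
  ultimately show "emeasure (distr lborel borel f) (box l u) = (\<Prod>b\<in>Basis. (u - l) \<bullet> b)"
    using meas lu by (simp add: emeasure_distr)
qed simp

lemma lebesgue_measurable_AE_borel:
  fixes f :: "'a::euclidean_space \<Rightarrow> complex"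
  assumes "f \<in> borel_measurable lebesgue"
  obtains g where "g \<in> borel_measurable borel" "AE x in lborel. f x = g x"
proof -
  have "(\<lambda>x. Re (f x)) \<in> borel_measurable lebesgue" "(\<lambda>x. Im (f x)) \<in> borel_measurable lebesgue"
    using assms by measurable
  then obtain u v where uv: "u \<in> borel_measurable lborel" "v \<in> borel_measurable lborel"
    "AE x in lborel. Re (f x) = u x" "AE x in lborel. Im (f x) = v x"
    using completion_ex_borel_measurable_real by metis
  show thesis
  proof
    show "(\<lambda>x. Complex (u x) (v x)) \<in> borel_measurable borel"
      using uv(1,2) by (simp add: borel_measurable_complex_iff)
    show "AE x in lborel. f x = Complex (u x) (v x)"
      using uv(3,4) by eventually_elim (simp add: complex_eq_iff)
  qed
qed

lemma integrable_lebesgue_cong_AE: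
  fixes f g :: "'a::euclidean_space \<Rightarrow> complex"
  assumes "AE x in lborel. f x = g x" and g: "g \<in> borel_measurable borel"
  shows "f \<in> borel_measurable lebesgue"
    and "integrable lebesgue f \<longleftrightarrow> integrable lborel g"
    and "integral\<^sup>L lebesgue f = integral\<^sup>L lborel g"
proof -
  have ae: "AE x in lebesgue. f x = g x" using assms(1) by (rule AE_completion)
  have gm: "g \<in> borel_measurable lebesgue" using g by (simp add: measurable_completion)
  then show fm: "f \<in> borel_measurable lebesgue"
    by (rule borel_measurable_AE) (use ae in \<open>eventually_elim, simp\<close>)
  have "integrable lebesgue f \<longleftrightarrow> integrable lebesgue g"
    using fm gm ae by (rule integrable_cong_AE)
  then show "integrable lebesgue f \<longleftrightarrow> integrable lborel g"
    using g by (simp add: integrable_completion)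
  have "integral\<^sup>L lebesgue f = integral\<^sup>L lebesgue g"
    using fm gm ae by (rule integral_cong_AE)
  then show "integral\<^sup>L lebesgue f = integral\<^sup>L lborel g"
    using g by (simp add: integral_completion)
qed

text \<open>The product of two completed measures is not complete, so every statement about sections of
  a Lebesgue measurable function goes through a Borel modification and holds for almost every
  section only.\<close>

lemma AE_lebesgue_prod_sections:
  fixes P :: "'a::euclidean_space \<times> 'b::euclidean_space \<Rightarrow> bool"
  assumes "AE z in lborel. P z"
  shows "AE x in lborel. AE y in lborel. P (x, y)"
proof (rule lborel_pair.AE_pair)
  show "AE z in lborel \<Otimes>\<^sub>M lborel. P z" unfolding lborel_prod by (rule assms)
qed

lemma lebesgue_integral_sections_measurable:
  fixes f :: "'a::euclidean_space \<times> 'b::euclidean_space \<Rightarrow> complex"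
  assumes "f \<in> borel_measurable lebesgue"
  shows "(\<lambda>x. LINT y|lebesgue. f (x, y)) \<in> borel_measurable lebesgue"
proof -
  obtain g where g: "g \<in> borel_measurable borel" "AE x in lborel. f x = g x"
    using lebesgue_measurable_AE_borel[OF assms] .
  have [measurable]: "g \<in> borel_measurable (lborel \<Otimes>\<^sub>M lborel)"
    using g(1) by (simp add: lborel_prod)
  have "(\<lambda>x. LINT y|lborel. g (x, y)) \<in> borel_measurable lborel" by measurable
  then have G: "(\<lambda>x. LINT y|lborel. g (x, y)) \<in> borel_measurable lebesgue"
    by (rule measurable_completion)
  have "AE x in lborel. (LINT y|lborel. g (x, y)) = (LINT y|lebesgue. f (x, y))"
    using AE_lebesgue_prod_sections[OF g(2)]
  proof eventually_elim
    case (elim x)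
    have "(\<lambda>y. g (x, y)) \<in> borel_measurable borel"
      using g(1) by (intro measurable_compose[OF _ g(1)]) measurable
    with elim show ?case by (simp add: integrable_lebesgue_cong_AE(3))
  qed
  then show ?thesis by (intro borel_measurable_AE[OF G] AE_completion)
qed

lemma lebesgue_Fubini:
  fixes f :: "'a::euclidean_space \<times> 'b::euclidean_space \<Rightarrow> complex"
  assumes "integrable lebesgue f"
  shows "AE x in lebesgue. integrable lebesgue (\<lambda>y. f (x, y))"
    and "integrable lebesgue (\<lambda>x. LINT y|lebesgue. f (x, y))"
    and "(LINT x|lebesgue. LINT y|lebesgue. f (x, y)) = integral\<^sup>L lebesgue f"
proof -
  obtain g where g: "g \<in> borel_measurable borel" "AE x in lborel. f x = g x"
    using lebesgue_measurable_AE_borel[OF borel_measurable_integrable[OF assms]] .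
  have gs: "(\<lambda>y. g (x, y)) \<in> borel_measurable borel" for x
    by (intro measurable_compose[OF _ g(1)]) measurable
  have gi: "integrable (lborel \<Otimes>\<^sub>M lborel) g"
    using assms integrable_lebesgue_cong_AE(2)[OF g(2,1)] by (simp add: lborel_prod)
  have sec: "AE x in lborel. AE y in lborel. f (x, y) = g (x, y)"
    by (rule AE_lebesgue_prod_sections[OF g(2)])
  have "AE x in lborel. integrable lborel (\<lambda>y. g (x, y))"
    using lborel_pair.AE_integrable_fst'[OF gi] .
  with sec have "AE x in lborel. integrable lebesgue (\<lambda>y. f (x, y))"
    by eventually_elim (use gs in \<open>simp add: integrable_lebesgue_cong_AE(2)\<close>)
  then show "AE x in lebesgue. integrable lebesgue (\<lambda>y. f (x, y))" by (rule AE_completion)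
  have eq: "AE x in lborel. (LINT y|lebesgue. f (x, y)) = (LINT y|lborel. g (x, y))"
    using sec by eventually_elim (use gs in \<open>simp add: integrable_lebesgue_cong_AE(3)\<close>)
  have gI: "integrable lborel (\<lambda>x. LINT y|lborel. g (x, y))"
    using lborel_pair.integrable_fst'[OF gi] .
  then have gM: "(\<lambda>x. LINT y|lborel. g (x, y)) \<in> borel_measurable borel" by auto
  show "integrable lebesgue (\<lambda>x. LINT y|lebesgue. f (x, y))"
    using integrable_lebesgue_cong_AE(2)[OF eq gM] gI by blast
  have "(LINT x|lebesgue. LINT y|lebesgue. f (x, y)) = (LINT x|lborel. LINT y|lborel. g (x, y))"
    by (rule integrable_lebesgue_cong_AE(3)[OF eq gM])
  also have "\<dots> = integral\<^sup>L lborel g"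
    using lborel_pair.integral_fst'[OF gi] by (simp add: lborel_prod)
  also have "\<dots> = integral\<^sup>L lebesgue f"
    using integrable_lebesgue_cong_AE(3)[OF g(2,1)] by simp
  finally show "(LINT x|lebesgue. LINT y|lebesgue. f (x, y)) = integral\<^sup>L lebesgue f" .
qed

lemma lebesgue_Fubini_norm:
  fixes f :: "'a::euclidean_space \<times> 'b::euclidean_space \<Rightarrow> complex"
  assumes "integrable lebesgue f"
  shows "integrable lebesgue (\<lambda>x. LINT y|lebesgue. norm (f (x, y)))"
proof -
  have "integrable lebesgue (\<lambda>z. complex_of_real (norm (f z)))" using assms by simp
  from integrable_Re[OF lebesgue_Fubini(2)[OF this]] show ?thesis by simp
qed

lemma lebesgue_integral_over_sections:
  fixes f :: "'a::euclidean_space \<times> 'b::euclidean_space \<Rightarrow> 'c::{banach, second_countable_topology}"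
  shows "(LINT y|lebesgue. indicator {(x, y). x \<in> P \<and> y \<in> T x} (x, y) *\<^sub>R f (x, y))
    = indicator P x *\<^sub>R (LINT y:T x|lebesgue. f (x, y))"
  by (cases "x \<in> P") (simp_all add: set_lebesgue_integral_def indicator_def)

text \<open>Both the family of real segments and the families of sides of the contours are integrals over
  sets fibred over the parameter \<open>\<gamma>\<close>.\<close>

lemma section_norm_integrable:
  fixes f :: "'a::euclidean_space \<times> 'b::euclidean_space \<Rightarrow> complex"
  assumes f: "set_integrable lebesgue {(x, y). x \<in> P \<and> y \<in> T x} f"
  shows "set_integrable lebesgue P (\<lambda>x. LINT y:T x|lebesgue. norm (f (x, y)))"
    and "AE x in lebesgue. x \<in> P \<longrightarrow> set_integrable lebesgue (T x) (\<lambda>y. f (x, y))"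
proof -
  let ?S = "{(x, y). x \<in> P \<and> y \<in> T x}"
  have i: "integrable lebesgue (\<lambda>z. indicator ?S z *\<^sub>R f z)"
    using f by (simp add: set_integrable_def)
  have "norm (indicator ?S z *\<^sub>R f z) = indicator ?S z *\<^sub>R norm (f z)" for z
    by (simp add: indicator_def)
  then show "set_integrable lebesgue P (\<lambda>x. LINT y:T x|lebesgue. norm (f (x, y)))"
    using lebesgue_Fubini_norm[OF i] lebesgue_integral_over_sections[of P T _ "\<lambda>z. norm (f z)"]
    by (simp only: set_integrable_def)
  show "AE x in lebesgue. x \<in> P \<longrightarrow> set_integrable lebesgue (T x) (\<lambda>y. f (x, y))"
    using lebesgue_Fubini(1)[OF i]
    by eventually_elim (auto simp: set_integrable_def indicator_def)
qed

lemma section_integral_measurable: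
  fixes f :: "'a::euclidean_space \<times> 'b::euclidean_space \<Rightarrow> complex"
  assumes f: "set_borel_measurable lebesgue {(x, y). x \<in> P \<and> y \<in> T x} f"
  shows "set_borel_measurable lebesgue P (\<lambda>x. LINT y:T x|lebesgue. f (x, y))"
  using lebesgue_integral_sections_measurable[OF f[unfolded set_borel_measurable_def]]
  unfolding lebesgue_integral_over_sections set_borel_measurable_def .

lemma lebesgue_integral_isometry:
  fixes \<Phi> :: "'a::euclidean_space \<Rightarrow> 'b::euclidean_space" and f :: "'b \<Rightarrow> complex"
  assumes iso: "\<And>x y. dist (\<Phi> x) (\<Phi> y) = dist x y" and sur: "surj \<Phi>"
    and dim: "DIM('a) = DIM('b)" and f: "integrable lebesgue f"
  shows "integrable lebesgue (\<lambda>x. f (\<Phi> x))"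
    and "(LINT x|lebesgue. f (\<Phi> x)) = integral\<^sup>L lebesgue f"
proof -
  have D: "distr lborel borel \<Phi> = lborel" by (rule lborel_distr_isometry[OF iso sur dim])
  have "continuous_on UNIV \<Phi>" by (rule continuous_onI) (auto simp: iso)
  then have m: "\<Phi> \<in> borel_measurable lborel" by (simp add: borel_measurable_continuous_onI)
  obtain g where g: "g \<in> borel_measurable borel" "AE x in lborel. f x = g x"
    using lebesgue_measurable_AE_borel[OF borel_measurable_integrable[OF f]] .
  have ae: "AE x in lborel. f (\<Phi> x) = g (\<Phi> x)"
  proof (rule AE_distrD[OF m])
    show "AE y in distr lborel borel \<Phi>. f y = g y" unfolding D by (rule g(2))
  qed
  have gm: "(\<lambda>x. g (\<Phi> x)) \<in> borel_measurable borel"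
    using m g(1) by (auto intro: measurable_compose)
  have gi: "integrable lborel g" using f integrable_lebesgue_cong_AE(2)[OF g(2,1)] by simp
  have "integrable lborel (\<lambda>x. g (\<Phi> x))"
    using integrable_distr_eq[OF m g(1)] D gi by simp
  then show "integrable lebesgue (\<lambda>x. f (\<Phi> x))"
    using integrable_lebesgue_cong_AE(2)[OF ae gm] by simp
  have "(LINT x|lborel. g (\<Phi> x)) = integral\<^sup>L lborel g"
    using integral_distr[OF m g(1)] D by simp
  then show "(LINT x|lebesgue. f (\<Phi> x)) = integral\<^sup>L lebesgue f"
    using integrable_lebesgue_cong_AE(3)[OF ae gm] integrable_lebesgue_cong_AE(3)[OF g(2,1)] by simp
qed

text \<open>Completeness of Lebesgue measure makes the limit function measurable although the convergence
  holds only almost everywhere. This matters here: the continuation of the source carries no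
  measurability in \<open>\<gamma>\<close> of its own, so the measurability of the residue is a result of this passage
  to the limit.\<close>

lemma dominated_convergence_at_right_0:
  fixes f :: "real \<Rightarrow> 'a::euclidean_space \<Rightarrow> complex" and G :: "'a \<Rightarrow> real"
  assumes "\<epsilon>\<^sub>0 > 0" and G: "integrable lebesgue G"
    and meas: "\<And>\<epsilon>. 0 < \<epsilon> \<Longrightarrow> \<epsilon> < \<epsilon>\<^sub>0 \<Longrightarrow> f \<epsilon> \<in> borel_measurable lebesgue"
    and bound: "AE x in lebesgue. \<forall>\<epsilon>. 0 < \<epsilon> \<and> \<epsilon> < \<epsilon>\<^sub>0 \<longrightarrow> norm (f \<epsilon> x) \<le> G x"
    and lim: "AE x in lebesgue. ((\<lambda>\<epsilon>. f \<epsilon> x) \<longlongrightarrow> l x) (at_right 0)"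
  shows "integrable lebesgue l"
    and "((\<lambda>\<epsilon>. integral\<^sup>L lebesgue (f \<epsilon>)) \<longlongrightarrow> integral\<^sup>L lebesgue l) (at_right 0)"
proof -
  have conv: "AE x in lebesgue. (\<lambda>k. f (S k) x) \<longlonglongrightarrow> l x"
    if S: "\<And>k. 0 < S k" "S \<longlonglongrightarrow> 0" for S :: "nat \<Rightarrow> real"
    using lim
  proof eventually_elim
    case (elim x)
    have "filterlim S (at_right 0) sequentially"
      unfolding filterlim_at using S by (simp add: less_imp_neq[symmetric])
    with elim show ?case by (rule filterlim_compose)
  qed
  define T :: "nat \<Rightarrow> real" where "T k = \<epsilon>\<^sub>0 / 2 * inverse (real (Suc k))" for k
  have T: "0 < T k" "T k < \<epsilon>\<^sub>0" for k
    using \<open>\<epsilon>\<^sub>0 > 0\<close> by (auto simp: T_def field_simps intro: add_pos_nonneg)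
  have T0: "T \<longlonglongrightarrow> 0"
    unfolding T_def using tendsto_mult_left[OF LIMSEQ_inverse_real_of_nat, of "\<epsilon>\<^sub>0 / 2"] by simp
  have "(\<lambda>x. lim (\<lambda>k. f (T k) x)) \<in> borel_measurable lebesgue"
    by (intro borel_measurable_lim_metric meas T)
  then have lm: "l \<in> borel_measurable lebesgue"
    by (rule borel_measurable_AE) (use conv[OF T(1) T0] in \<open>eventually_elim, simp add: limI\<close>)
  have dct: "integrable lebesgue l \<and> (\<lambda>k. integral\<^sup>L lebesgue (f (S k))) \<longlonglongrightarrow> integral\<^sup>L lebesgue l"
    if S: "\<And>k. 0 < S k" "\<And>k. S k < \<epsilon>\<^sub>0" "S \<longlonglongrightarrow> 0" for S
  proof -
    have b: "AE x in lebesgue. norm (f (S k) x) \<le> G x" for k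
      using bound by eventually_elim (use S in auto)
    show ?thesis
      by (intro conjI integrable_dominated_convergence[OF lm meas[OF S(1,2)] G conv[OF S(1,3)] b]
          integral_dominated_convergence[OF lm meas[OF S(1,2)] G conv[OF S(1,3)] b])
  qed
  show "integrable lebesgue l"
    by (rule conjunct1[OF dct[OF T T0]])
  show "((\<lambda>\<epsilon>. integral\<^sup>L lebesgue (f \<epsilon>)) \<longlongrightarrow> integral\<^sup>L lebesgue l) (at_right 0)"
    by (rule tendsto_at_right_sequentially[OF \<open>\<epsilon>\<^sub>0 > 0\<close>]) (rule conjunct2[OF dct])
qed

section \<open>The contour shift on a single line\<close>

lemma closure_rectangle:
  assumes "\<alpha> < \<beta>" "\<rho> > 0"
  shows "closure (rectangle {\<alpha><..<\<beta>} \<rho>) = cbox (Complex \<alpha> 0) (Complex \<beta> \<rho>)"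
proof
  show "closure (rectangle {\<alpha><..<\<beta>} \<rho>) \<subseteq> cbox (Complex \<alpha> 0) (Complex \<beta> \<rho>)"
    by (rule closure_minimal) (auto simp: rectangle_def in_cbox_complex_iff)
  have "Complex ((\<alpha> + \<beta>) / 2) (\<rho> / 2) \<in> box (Complex \<alpha> 0) (Complex \<beta> \<rho>)"
    using assms by (simp add: in_box_complex_iff)
  then have "cbox (Complex \<alpha> 0) (Complex \<beta> \<rho>) = closure (box (Complex \<alpha> 0) (Complex \<beta> \<rho>))"
    using closure_box by blast
  also have "\<dots> \<subseteq> closure (rectangle {\<alpha><..<\<beta>} \<rho>)"
    by (rule closure_mono) (auto simp: rectangle_def in_box_complex_iff)
  finally show "cbox (Complex \<alpha> 0) (Complex \<beta> \<rho>) \<subseteq> closure (rectangle {\<alpha><..<\<beta>} \<rho>)" .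
qed

lemma path_image_deformed_contour:
  assumes "\<alpha> < \<beta>" "\<rho> > 0"
  shows "path_image (deformed_contour {\<alpha><..<\<beta>} \<rho>) =
    {z \<in> cbox (Complex \<alpha> 0) (Complex \<beta> \<rho>). Re z = \<alpha> \<or> Re z = \<beta> \<or> Im z = \<rho>}"
  using assms
  by (auto simp: deformed_contour_def path_image_join closed_segment_same_Re closed_segment_same_Im
      closed_segment_eq_real_ivl in_cbox_complex_iff)

lemma valid_path_deformed_contour: "valid_path (deformed_contour I \<rho>)"
  by (simp add: deformed_contour_def valid_path_join)

lemma path_image_rectpath_eq:
  assumes "\<alpha> < \<beta>" "\<rho> > 0"
  shows "path_image (rectpath (Complex \<alpha> 0) (Complex \<beta> \<rho>)) =
    path_image (deformed_contour {\<alpha><..<\<beta>} \<rho>) \<union> {z. Im z = 0 \<and> \<alpha> \<le> Re z \<and> Re z \<le> \<beta>}"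
  using assms
  by (auto simp: path_image_deformed_contour path_image_rectpath_cbox_minus_box
      in_cbox_complex_iff in_box_complex_iff)

lemma contour_integral_linepath_same_Im:
  assumes "a < b"
  shows "contour_integral (linepath (Complex a c) (Complex b c)) f = integral {a..b} (\<lambda>x. f (Complex x c))"
proof -
  have "contour_integral (linepath (Complex a c) (Complex b c)) f =
      contour_integral (linepath (of_real a) (of_real b)) (\<lambda>z. f (z + \<i> * of_real c))"
    unfolding contour_integral_integral
    by (simp add: linepath_def Complex_eq algebra_simps scaleR_conv_of_real)
  also have "\<dots> = integral {a..b} (\<lambda>x. f (Complex x c))"
    using assms by (subst contour_integral_linepath_Reals_eq) (auto simp: Complex_eq)
  finally show ?thesis .
qed

text \<open>As a sum of three Lebesgue integrals the contour integral can be estimated, and can be seen to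
  depend measurably on the line.\<close>

lemma deformed_contour_sides:
  assumes "\<alpha> < \<beta>" "\<rho> > 0"
    and G: "continuous_on (path_image (deformed_contour {\<alpha><..<\<beta>} \<rho>)) G"
  shows "G contour_integrable_on deformed_contour {\<alpha><..<\<beta>} \<rho>"
    and "contour_integral (deformed_contour {\<alpha><..<\<beta>} \<rho>) G =
      \<i> * (LINT \<tau>:{0..\<rho>}|lebesgue. G (Complex \<alpha> \<tau>)) + (LINT s:{\<alpha><..<\<beta>}|lebesgue. G (Complex s \<rho>))
      - \<i> * (LINT \<tau>:{0..\<rho>}|lebesgue. G (Complex \<beta> \<tau>))"
    and "set_integrable lebesgue {0..\<rho>} (\<lambda>\<tau>. G (Complex \<alpha> \<tau>))"
    and "set_integrable lebesgue {\<alpha><..<\<beta>} (\<lambda>s. G (Complex s \<rho>))"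
    and "set_integrable lebesgue {0..\<rho>} (\<lambda>\<tau>. G (Complex \<beta> \<tau>))"
proof -
  let ?C = "path_image (deformed_contour {\<alpha><..<\<beta>} \<rho>)"
  note PI = path_image_deformed_contour[OF assms(1,2)]
  have c1: "continuous_on {0..\<rho>} (\<lambda>\<tau>. G (Complex \<alpha> \<tau>))"
    using assms(1,2) by (intro continuous_on_compose2[OF G] continuous_intros) (auto simp: PI in_cbox_complex_iff)
  have c2: "continuous_on {\<alpha>..\<beta>} (\<lambda>s. G (Complex s \<rho>))"
    using assms(1,2) by (intro continuous_on_compose2[OF G] continuous_intros) (auto simp: PI in_cbox_complex_iff)
  have c3: "continuous_on {0..\<rho>} (\<lambda>\<tau>. G (Complex \<beta> \<tau>))"
    using assms(1,2) by (intro continuous_on_compose2[OF G] continuous_intros) (auto simp: PI in_cbox_complex_iff)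
  show i1: "set_integrable lebesgue {0..\<rho>} (\<lambda>\<tau>. G (Complex \<alpha> \<tau>))"
    using c1 by (simp add: absolutely_integrable_continuous_real)
  have i2': "set_integrable lebesgue {\<alpha>..\<beta>} (\<lambda>s. G (Complex s \<rho>))"
    using c2 by (simp add: absolutely_integrable_continuous_real)
  then show i2: "set_integrable lebesgue {\<alpha><..<\<beta>} (\<lambda>s. G (Complex s \<rho>))"
    by (rule set_integrable_subset) auto
  show i3: "set_integrable lebesgue {0..\<rho>} (\<lambda>\<tau>. G (Complex \<beta> \<tau>))"
    using c3 by (simp add: absolutely_integrable_continuous_real)
  have s1: "closed_segment (Complex \<alpha> 0) (Complex \<alpha> \<rho>) \<subseteq> ?C"
    and s2: "closed_segment (Complex \<alpha> \<rho>) (Complex \<beta> \<rho>) \<subseteq> ?C"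
    and s3: "closed_segment (Complex \<beta> \<rho>) (Complex \<beta> 0) \<subseteq> ?C"
    using assms(1) by (auto simp: deformed_contour_def path_image_join)
  have I1: "G contour_integrable_on linepath (Complex \<alpha> 0) (Complex \<alpha> \<rho>)"
    and I2: "G contour_integrable_on linepath (Complex \<alpha> \<rho>) (Complex \<beta> \<rho>)"
    and I3: "G contour_integrable_on linepath (Complex \<beta> \<rho>) (Complex \<beta> 0)"
    using s1 s2 s3 G by (auto intro!: contour_integrable_continuous_linepath intro: continuous_on_subset)
  show "G contour_integrable_on deformed_contour {\<alpha><..<\<beta>} \<rho>"
    using I1 I2 I3 assms by (simp add: deformed_contour_def valid_path_join)
  have "contour_integral (deformed_contour {\<alpha><..<\<beta>} \<rho>) G =
      contour_integral (linepath (Complex \<alpha> 0) (Complex \<alpha> \<rho>)) G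
      + (contour_integral (linepath (Complex \<alpha> \<rho>) (Complex \<beta> \<rho>)) G
      + contour_integral (linepath (Complex \<beta> \<rho>) (Complex \<beta> 0)) G)"
    using I1 I2 I3 assms by (simp add: deformed_contour_def valid_path_join)
  also have "contour_integral (linepath (Complex \<beta> \<rho>) (Complex \<beta> 0)) G =
      - contour_integral (linepath (Complex \<beta> 0) (Complex \<beta> \<rho>)) G"
    using s3 G by (intro contour_integral_reverse_linepath)
      (auto intro: continuous_on_subset simp: closed_segment_commute)
  also have "contour_integral (linepath (Complex \<beta> 0) (Complex \<beta> \<rho>)) G
      = \<i> * integral {0..\<rho>} (\<lambda>\<tau>. G (Complex \<beta> \<tau>))"
    using assms by (intro contour_integral_linepath_same_Re) auto
  also have "contour_integral (linepath (Complex \<alpha> 0) (Complex \<alpha> \<rho>)) G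
      = \<i> * integral {0..\<rho>} (\<lambda>\<tau>. G (Complex \<alpha> \<tau>))"
    using assms by (intro contour_integral_linepath_same_Re) auto
  also have "contour_integral (linepath (Complex \<alpha> \<rho>) (Complex \<beta> \<rho>)) G
      = integral {\<alpha>..\<beta>} (\<lambda>s. G (Complex s \<rho>))"
    using assms(1) by (rule contour_integral_linepath_same_Im)
  also have "integral {\<alpha>..\<beta>} (\<lambda>s. G (Complex s \<rho>)) = integral {\<alpha><..<\<beta>} (\<lambda>s. G (Complex s \<rho>))"
    using integral_open_interval_real[of \<alpha> \<beta> "\<lambda>s. G (Complex s \<rho>)"] by simp
  finally show "contour_integral (deformed_contour {\<alpha><..<\<beta>} \<rho>) G =
      \<i> * (LINT \<tau>:{0..\<rho>}|lebesgue. G (Complex \<alpha> \<tau>)) + (LINT s:{\<alpha><..<\<beta>}|lebesgue. G (Complex s \<rho>))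
      - \<i> * (LINT \<tau>:{0..\<rho>}|lebesgue. G (Complex \<beta> \<tau>))"
    using i1 i2 i3 by (simp add: set_lebesgue_integral_eq_integral)
qed

lemma contour_integral_rectpath_deformed:
  assumes "\<alpha> < \<beta>" "\<rho> > 0"
    and G: "continuous_on (path_image (rectpath (Complex \<alpha> 0) (Complex \<beta> \<rho>))) G"
  shows "contour_integral (rectpath (Complex \<alpha> 0) (Complex \<beta> \<rho>)) G =
    (LINT s:{\<alpha><..<\<beta>}|lebesgue. G (of_real s)) - contour_integral (deformed_contour {\<alpha><..<\<beta>} \<rho>) G"
proof -
  let ?C = "path_image (rectpath (Complex \<alpha> 0) (Complex \<beta> \<rho>))"
  let ?l = "\<lambda>a b. contour_integral (linepath a b) G"
  have sub: "closed_segment (Complex \<alpha> 0) (Complex \<beta> 0) \<subseteq> ?C"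
    "closed_segment (Complex \<beta> 0) (Complex \<beta> \<rho>) \<subseteq> ?C"
    "closed_segment (Complex \<beta> \<rho>) (Complex \<alpha> \<rho>) \<subseteq> ?C"
    "closed_segment (Complex \<alpha> \<rho>) (Complex \<alpha> 0) \<subseteq> ?C"
    by (auto simp: rectpath_def path_image_join Let_def)
  have ints: "continuous_on (closed_segment (Complex \<alpha> 0) (Complex \<beta> 0)) G"
    "continuous_on (closed_segment (Complex \<beta> 0) (Complex \<beta> \<rho>)) G"
    "continuous_on (closed_segment (Complex \<beta> \<rho>) (Complex \<alpha> \<rho>)) G"
    "continuous_on (closed_segment (Complex \<alpha> \<rho>) (Complex \<alpha> 0)) G"
    using sub by (auto intro: continuous_on_subset[OF G])
  have ints': "continuous_on (closed_segment (Complex \<alpha> 0) (Complex \<alpha> \<rho>)) G"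
    "continuous_on (closed_segment (Complex \<alpha> \<rho>) (Complex \<beta> \<rho>)) G"
    "continuous_on (closed_segment (Complex \<beta> \<rho>) (Complex \<beta> 0)) G"
    using ints(2-4) by (simp_all add: closed_segment_commute)
  have "contour_integral (rectpath (Complex \<alpha> 0) (Complex \<beta> \<rho>)) G =
      ?l (Complex \<alpha> 0) (Complex \<beta> 0) + (?l (Complex \<beta> 0) (Complex \<beta> \<rho>)
      + (?l (Complex \<beta> \<rho>) (Complex \<alpha> \<rho>) + ?l (Complex \<alpha> \<rho>) (Complex \<alpha> 0)))"
    using ints by (simp add: rectpath_def Let_def valid_path_join contour_integrable_continuous_linepath)
  also have "?l (Complex \<beta> 0) (Complex \<beta> \<rho>) = - ?l (Complex \<beta> \<rho>) (Complex \<beta> 0)"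
    using ints(2) by (rule contour_integral_reverse_linepath)
  also have "?l (Complex \<beta> \<rho>) (Complex \<alpha> \<rho>) = - ?l (Complex \<alpha> \<rho>) (Complex \<beta> \<rho>)"
    using ints(3) by (rule contour_integral_reverse_linepath)
  also have "?l (Complex \<alpha> \<rho>) (Complex \<alpha> 0) = - ?l (Complex \<alpha> 0) (Complex \<alpha> \<rho>)"
    using ints(4) by (rule contour_integral_reverse_linepath)
  also have "?l (Complex \<alpha> 0) (Complex \<beta> 0) = (LINT s:{\<alpha><..<\<beta>}|lebesgue. G (of_real s))"
  proof -
    have c: "continuous_on {\<alpha>..\<beta>} (\<lambda>s. G (of_real s))"
      using assms(1,2)
      by (intro continuous_on_compose2[OF G] continuous_intros) (auto simp: path_image_rectpath_eq)
    have "set_integrable lebesgue {\<alpha>..\<beta>} (\<lambda>s. G (of_real s))"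
      using c by (simp add: absolutely_integrable_continuous_real)
    then have i: "set_integrable lebesgue {\<alpha><..<\<beta>} (\<lambda>s. G (of_real s))"
      by (rule set_integrable_subset) auto
    have "?l (Complex \<alpha> 0) (Complex \<beta> 0) = integral {\<alpha>..\<beta>} (\<lambda>s. G (Complex s 0))"
      using assms(1) by (rule contour_integral_linepath_same_Im)
    also have "\<dots> = integral {\<alpha><..<\<beta>} (\<lambda>s. G (of_real s))"
      using integral_open_interval_real[of \<alpha> \<beta> "\<lambda>s. G (of_real s)"]
      by (simp add: complex_of_real_def)
    finally show ?thesis using i by (simp add: set_lebesgue_integral_eq_integral)
  qed
  finally show ?thesis
    using ints' assms
    by (simp add: deformed_contour_def valid_path_join contour_integrable_continuous_linepath)
qed

text \<open>Cauchy's integral formula for \<open>s\<close> inside and Cauchy's theorem for \<open>s\<close> outside. The cut-off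
  continuation \<open>cont_on_rect\<close> makes the same distinction, which is why the residue formula below needs no
  information on the position of the root.\<close>

lemma Cauchy_rectpath:
  assumes "\<alpha> < \<beta>" "\<rho> > 0" and "open V" and V: "cbox (Complex \<alpha> 0) (Complex \<beta> \<rho>) \<subseteq> V"
    and f: "f holomorphic_on V" and s: "s \<notin> path_image (rectpath (Complex \<alpha> 0) (Complex \<beta> \<rho>))"
  shows "((\<lambda>z. f z / (z - s)) has_contour_integral
      (if s \<in> cbox (Complex \<alpha> 0) (Complex \<beta> \<rho>) then 2 * pi * \<i> * f s else 0))
      (rectpath (Complex \<alpha> 0) (Complex \<beta> \<rho>))"
proof -
  let ?K = "cbox (Complex \<alpha> 0) (Complex \<beta> \<rho>)" and ?r = "rectpath (Complex \<alpha> 0) (Complex \<beta> \<rho>)"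
  have sub: "path_image ?r \<subseteq> ?K" using assms by (intro path_image_rectpath_subset_cbox) auto
  have PI: "path_image ?r = ?K - box (Complex \<alpha> 0) (Complex \<beta> \<rho>)"
    using assms by (intro path_image_rectpath_cbox_minus_box) auto
  show ?thesis
  proof (cases "s \<in> ?K")
    case True
    then have sb: "s \<in> box (Complex \<alpha> 0) (Complex \<beta> \<rho>)" using s PI by auto
    have "((\<lambda>z. f z / (z - s)) has_contour_integral (2 * pi * \<i> * winding_number ?r s * f s)) ?r"
    proof (rule Cauchy_integral_formula_weak[where S = ?K and k = "{}"])
      show "continuous_on ?K f" using f V holomorphic_on_imp_continuous_on continuous_on_subset by blast
      show "f field_differentiable at x" if "x \<in> interior ?K - {}" for x
        using that f V \<open>open V\<close> interior_subset holomorphic_on_imp_differentiable_at by blast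
    qed (use sb s sub in auto)
    moreover have "winding_number ?r s = 1" using winding_number_rectpath[OF sb] .
    ultimately show ?thesis using True by simp
  next
    case False
    have "((\<lambda>z. f z / (z - s)) has_contour_integral 0) ?r"
    proof (rule Cauchy_theorem_convex_simple)
      show "(\<lambda>z. f z / (z - s)) holomorphic_on ?K"
        using False by (intro holomorphic_intros holomorphic_on_subset[OF f V]) auto
    qed (use sub in auto)
    then show ?thesis using False by simp
  qed
qed

text \<open>The quadratic is \<open>a (z - s) (z - s')\<close>. The root \<open>s'\<close> lies in the lower half-plane, so only \<open>s\<close> can lie
  in the rectangle; \<open>1 / (z - s)\<close> then has the coefficient \<open>1 / (a (s - s')) = 1 / (2 q)\<close>, which turns
  the factor \<open>2 \<pi> i\<close> into \<open>\<pi> i / q\<close>.\<close>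

lemma line_integral_eq_contour_plus_residue:
  fixes a b c R \<epsilon> :: real and q :: complex
  defines "p \<equiv> \<lambda>z. of_real a * z\<^sup>2 + 2 * of_real b * z + of_real c - \<i> * of_real \<epsilon>"
  defines "s \<equiv> - of_real b / of_real a + q / of_real a"
  assumes "\<alpha> < \<beta>" "\<rho> > 0" "open V" and V: "cbox (Complex \<alpha> 0) (Complex \<beta> \<rho>) \<subseteq> V"
    and F: "F holomorphic_on V" and "a > 0"
    and q: "q\<^sup>2 = of_real (b\<^sup>2 - a * c) + \<i> * of_real (a * \<epsilon>)" and "Im q > 0"
    and s: "s \<notin> path_image (rectpath (Complex \<alpha> 0) (Complex \<beta> \<rho>))"
  shows "(LINT x:{\<alpha><..<\<beta>}|lebesgue. exp (\<i> * of_real R * of_real x) * F (of_real x) / p (of_real x)) =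
    contour_integral (deformed_contour {\<alpha><..<\<beta>} \<rho>) (\<lambda>z. exp (\<i> * of_real R * z) * F z / p z)
    + pi * \<i> * (exp (\<i> * of_real R * s) * cont_on_rect {\<alpha><..<\<beta>} \<rho> F s / q)"
proof -
  let ?K = "cbox (Complex \<alpha> 0) (Complex \<beta> \<rho>)" and ?r = "rectpath (Complex \<alpha> 0) (Complex \<beta> \<rho>)"
  define s' where "s' = - of_real b / of_real a - q / of_real a"
  have p: "p z = of_real a * (z - s') * (z - s)" for z
  proof -
    have "of_real a * (of_real a * (z - s') * (z - s)) = (of_real a * z + of_real b)\<^sup>2 - q\<^sup>2"
      using \<open>a > 0\<close> by (simp add: s_def s'_def field_simps power2_eq_square)
    also have "\<dots> = of_real a * p z"
      unfolding q p_def by (simp add: algebra_simps power2_eq_square)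
    finally show ?thesis using \<open>a > 0\<close> by simp
  qed
  have "Im s' < 0"
    using \<open>a > 0\<close> \<open>Im q > 0\<close> by (simp add: s'_def)
  then have s': "s' \<notin> ?K" by (auto simp: in_cbox_complex_iff)
  define f where "f = (\<lambda>z. exp (\<i> * of_real R * z) * F z / (of_real a * (z - s')))"
  have fh: "f holomorphic_on (V - {s'})" unfolding f_def
    using \<open>a > 0\<close> by (intro holomorphic_intros holomorphic_on_subset[OF F]) auto
  have sub: "path_image ?r \<subseteq> ?K" using assms by (intro path_image_rectpath_subset_cbox) auto
  have eq: "exp (\<i> * of_real R * z) * F z / p z = f z / (z - s)" for z
    by (simp add: f_def p)
  have cont: "continuous_on (path_image ?r) (\<lambda>z. exp (\<i> * of_real R * z) * F z / p z)"
    unfolding eq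
    using s s' sub V by (intro continuous_intros holomorphic_on_imp_continuous_on[OF holomorphic_on_subset[OF fh]]) auto
  have res: "(if s \<in> ?K then 2 * pi * \<i> * f s else 0)
      = pi * \<i> * (exp (\<i> * of_real R * s) * cont_on_rect {\<alpha><..<\<beta>} \<rho> F s / q)"
  proof -
    have "s - s' = 2 * q / of_real a" by (simp add: s_def s'_def field_simps)
    then have "f s = exp (\<i> * of_real R * s) * F s / (2 * q)"
      using \<open>a > 0\<close> by (simp add: f_def)
    then show ?thesis
      using assms(3,4) by (simp add: cont_on_rect_def closure_rectangle)
  qed
  have "((\<lambda>z. f z / (z - s)) has_contour_integral (if s \<in> ?K then 2 * pi * \<i> * f s else 0)) ?r"
    using s' V \<open>open V\<close> by (intro Cauchy_rectpath[OF assms(3,4) _ _ fh s]) auto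
  then have "contour_integral ?r (\<lambda>z. exp (\<i> * of_real R * z) * F z / p z)
      = pi * \<i> * (exp (\<i> * of_real R * s) * cont_on_rect {\<alpha><..<\<beta>} \<rho> F s / q)"
    unfolding eq res[symmetric] by (rule contour_integral_unique)
  with contour_integral_rectpath_deformed[OF assms(3,4) cont] show ?thesis
    by (simp add: algebra_simps)
qed


text \<open>On the compact contour \<open>p\<close> is bounded away from \<open>0\<close>, so the integrands converge uniformly.\<close>

lemma deformed_contour_integral_tendsto:
  fixes N p :: "complex \<Rightarrow> complex"
  assumes "\<alpha> < \<beta>" "\<rho> > 0"
    and N: "continuous_on (path_image (deformed_contour {\<alpha><..<\<beta>} \<rho>)) N"
    and p: "continuous_on (path_image (deformed_contour {\<alpha><..<\<beta>} \<rho>)) p"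
    and nz: "\<And>z. z \<in> path_image (deformed_contour {\<alpha><..<\<beta>} \<rho>) \<Longrightarrow> p z \<noteq> 0"
  shows "((\<lambda>\<epsilon>. contour_integral (deformed_contour {\<alpha><..<\<beta>} \<rho>) (\<lambda>z. N z / (p z - \<i> * of_real \<epsilon>)))
    \<longlongrightarrow> contour_integral (deformed_contour {\<alpha><..<\<beta>} \<rho>) (\<lambda>z. N z / p z)) (at_right 0)"
proof -
  let ?C = "deformed_contour {\<alpha><..<\<beta>} \<rho>"
  let ?h = "\<lambda>\<epsilon> z. N z / (p z - \<i> * of_real \<epsilon>)"
  have cpt: "compact (path_image ?C)" by (simp add: compact_valid_path_image valid_path_deformed_contour)
  have ne: "path_image ?C \<noteq> {}" by simp
  obtain z0 where z0: "z0 \<in> path_image ?C" "\<And>z. z \<in> path_image ?C \<Longrightarrow> norm (p z0) \<le> norm (p z)"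
    using continuous_attains_inf[OF cpt ne continuous_on_norm[OF p]] by blast
  define c where "c = norm (p z0)"
  have c: "c > 0" "\<And>z. z \<in> path_image ?C \<Longrightarrow> c \<le> norm (p z)"
    using z0 nz by (auto simp: c_def)
  obtain M where M: "\<And>z. z \<in> path_image ?C \<Longrightarrow> norm (N z) \<le> M"
    using compact_imp_bounded[OF compact_continuous_image[OF N cpt]] unfolding bounded_iff by auto
  have low: "norm (p z - \<i> * of_real \<epsilon>) \<ge> c / 2" if "z \<in> path_image ?C" "0 < \<epsilon>" "\<epsilon> < c / 2" for z \<epsilon>
    using c(2)[OF that(1)] norm_triangle_ineq2[of "p z" "\<i> * of_real \<epsilon>"] that by (simp add: norm_mult)
  have diff: "norm (?h \<epsilon> z - N z / p z) \<le> M * \<epsilon> / (c * (c / 2))"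
    if "z \<in> path_image ?C" "0 < \<epsilon>" "\<epsilon> < c / 2" for z \<epsilon>
  proof -
    have nz': "p z - \<i> * of_real \<epsilon> \<noteq> 0" using low[OF that] c by auto
    have "?h \<epsilon> z - N z / p z = N z * (\<i> * of_real \<epsilon>) / (p z * (p z - \<i> * of_real \<epsilon>))"
      using nz[OF that(1)] nz' by (simp add: field_simps)
    also have "norm \<dots> = norm (N z) * \<epsilon> / (norm (p z) * norm (p z - \<i> * of_real \<epsilon>))"
      using that by (simp add: norm_mult norm_divide)
    also have "\<dots> \<le> M * \<epsilon> / (c * (c / 2))"
      using that c low[OF that] M[OF that(1)] order_trans[OF norm_ge_zero M[OF that(1)]]
      by (intro frac_le mult_mono) (auto intro: order_trans)
    finally show ?thesis .
  qed
  have small: "\<forall>\<^sub>F \<epsilon> in at_right 0. 0 < \<epsilon> \<and> \<epsilon> < c / 2"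
    using c(1) eventually_at_right_real[of 0 "c / 2"] by simp
  have ul: "uniform_limit (path_image ?C) ?h (\<lambda>z. N z / p z) (at_right 0)"
  proof (rule uniform_limitI)
    fix e :: real assume "e > 0"
    have "((\<lambda>\<epsilon>. M * \<epsilon> / (c * (c / 2))) \<longlongrightarrow> M * 0 / (c * (c / 2))) (at_right 0)"
      using c(1) by (intro tendsto_intros) auto
    then have "\<forall>\<^sub>F \<epsilon> in at_right 0. M * \<epsilon> / (c * (c / 2)) < e"
      by (rule order_tendstoD) (use \<open>e > 0\<close> in simp)
    with small show "\<forall>\<^sub>F \<epsilon> in at_right 0. \<forall>z\<in>path_image ?C. dist (?h \<epsilon> z) (N z / p z) < e"
      by eventually_elim (use diff in \<open>fastforce simp: dist_norm\<close>)
  qed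
  have cont: "continuous_on (path_image ?C) (?h \<epsilon>)" if "0 < \<epsilon>" "\<epsilon> < c / 2" for \<epsilon>
    using low that c(1) by (intro continuous_intros N p) force
  have cont0: "continuous_on (path_image ?C) (\<lambda>z. N z / p z)"
    using nz by (intro continuous_intros N p) auto
  have side: "((\<lambda>\<epsilon>. contour_integral (linepath u v) (?h \<epsilon>)) \<longlongrightarrow>
      contour_integral (linepath u v) (\<lambda>z. N z / p z)) (at_right 0)"
    if "closed_segment u v \<subseteq> path_image ?C" for u v
  proof (rule contour_integral_uniform_limit(2)[where B = "norm (v - u)"])
    show "\<forall>\<^sub>F \<epsilon> in at_right 0. ?h \<epsilon> contour_integrable_on linepath u v"
      using small by eventually_elim
        (use cont that in \<open>auto intro!: contour_integrable_continuous_linepath intro: continuous_on_subset\<close>)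
    show "uniform_limit (path_image (linepath u v)) ?h (\<lambda>z. N z / p z) (at_right 0)"
      using ul that by (auto intro: uniform_limit_on_subset)
  qed (auto simp: vector_derivative_linepath_at)
  have sub: "closed_segment (Complex \<alpha> 0) (Complex \<alpha> \<rho>) \<subseteq> path_image ?C"
    "closed_segment (Complex \<alpha> \<rho>) (Complex \<beta> \<rho>) \<subseteq> path_image ?C"
    "closed_segment (Complex \<beta> \<rho>) (Complex \<beta> 0) \<subseteq> path_image ?C"
    using assms(1) by (auto simp: deformed_contour_def path_image_join)
  have split: "contour_integral ?C g =
      contour_integral (linepath (Complex \<alpha> 0) (Complex \<alpha> \<rho>)) g
      + (contour_integral (linepath (Complex \<alpha> \<rho>) (Complex \<beta> \<rho>)) g
      + contour_integral (linepath (Complex \<beta> \<rho>) (Complex \<beta> 0)) g)"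
    if "continuous_on (path_image ?C) g" for g
  proof -
    have "continuous_on (closed_segment (Complex \<alpha> 0) (Complex \<alpha> \<rho>)) g"
      "continuous_on (closed_segment (Complex \<alpha> \<rho>) (Complex \<beta> \<rho>)) g"
      "continuous_on (closed_segment (Complex \<beta> \<rho>) (Complex \<beta> 0)) g"
      using that sub by (auto intro: continuous_on_subset)
    then show ?thesis
      using assms(1) by (simp add: deformed_contour_def valid_path_join contour_integrable_continuous_linepath)
  qed
  have "((\<lambda>\<epsilon>. contour_integral (linepath (Complex \<alpha> 0) (Complex \<alpha> \<rho>)) (?h \<epsilon>)
      + (contour_integral (linepath (Complex \<alpha> \<rho>) (Complex \<beta> \<rho>)) (?h \<epsilon>)
      + contour_integral (linepath (Complex \<beta> \<rho>) (Complex \<beta> 0)) (?h \<epsilon>)))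
     \<longlongrightarrow> contour_integral ?C (\<lambda>z. N z / p z)) (at_right 0)"
    unfolding split[OF cont0] by (intro tendsto_add side sub)
  then show ?thesis
    by (rule Lim_transform_eventually) (use small in eventually_elim, use split cont in simp)
qed

text \<open>The cut-off is discontinuous on the boundary of the rectangle. A limit point off the deformed
  contour is either an interior or exterior point, or a point of the open lower side; the latter is
  approached from above and hence from inside the rectangle.\<close>

lemma cont_on_rect_tendsto:
  assumes "\<alpha> < \<beta>" "\<rho> > 0" "open V" and V: "cbox (Complex \<alpha> 0) (Complex \<beta> \<rho>) \<subseteq> V"
    and F: "F holomorphic_on V"
    and z: "(z \<longlongrightarrow> z0) (at_right 0)" and pos: "\<forall>\<^sub>F \<epsilon> in at_right 0. Im (z \<epsilon>) > 0"
    and z0: "z0 \<notin> path_image (deformed_contour {\<alpha><..<\<beta>} \<rho>)"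
  shows "((\<lambda>\<epsilon>::real. cont_on_rect {\<alpha><..<\<beta>} \<rho> F (z \<epsilon>)) \<longlongrightarrow> cont_on_rect {\<alpha><..<\<beta>} \<rho> F z0) (at_right 0)"
proof (cases "z0 \<in> cbox (Complex \<alpha> 0) (Complex \<beta> \<rho>)")
  case True
  then have lim: "\<alpha> < Re z0" "Re z0 < \<beta>" "Im z0 < \<rho>"
    using z0 assms(1,2) by (auto simp: path_image_deformed_contour in_cbox_complex_iff)
  have "\<forall>\<^sub>F \<epsilon> in at_right 0. \<alpha> < Re (z \<epsilon>)" "\<forall>\<^sub>F \<epsilon> in at_right 0. Re (z \<epsilon>) < \<beta>"
    "\<forall>\<^sub>F \<epsilon> in at_right 0. Im (z \<epsilon>) < \<rho>"
    using order_tendstoD[OF tendsto_Re[OF z]] order_tendstoD[OF tendsto_Im[OF z]] lim by auto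
  with pos have ev: "\<forall>\<^sub>F \<epsilon> in at_right 0. z \<epsilon> \<in> cbox (Complex \<alpha> 0) (Complex \<beta> \<rho>)"
    by eventually_elim (auto simp: in_cbox_complex_iff)
  have "isCont F z0"
    using True V F \<open>open V\<close> holomorphic_on_imp_continuous_on continuous_on_eq_continuous_at by blast
  then have "((\<lambda>\<epsilon>. F (z \<epsilon>)) \<longlongrightarrow> F z0) (at_right 0)" using z by (rule isCont_tendsto_compose)
  then have "((\<lambda>\<epsilon>. F (z \<epsilon>)) \<longlongrightarrow> cont_on_rect {\<alpha><..<\<beta>} \<rho> F z0) (at_right 0)"
    using True assms(1,2) by (simp add: cont_on_rect_def closure_rectangle)
  then show ?thesis
    by (rule Lim_transform_eventually)
      (use ev in eventually_elim, use assms(1,2) in \<open>simp add: cont_on_rect_def closure_rectangle\<close>)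
next
  case False
  have "\<forall>\<^sub>F \<epsilon> in at_right 0. z \<epsilon> \<in> - cbox (Complex \<alpha> 0) (Complex \<beta> \<rho>)"
    using topological_tendstoD[OF z, of "- cbox (Complex \<alpha> 0) (Complex \<beta> \<rho>)"] False by auto
  then have ev: "\<forall>\<^sub>F \<epsilon> in at_right 0. 0 = cont_on_rect {\<alpha><..<\<beta>} \<rho> F (z \<epsilon>)"
    by eventually_elim (use assms(1,2) in \<open>simp add: cont_on_rect_def closure_rectangle\<close>)
  have "cont_on_rect {\<alpha><..<\<beta>} \<rho> F z0 = 0"
    using False assms(1,2) by (simp add: cont_on_rect_def closure_rectangle)
  then show ?thesis using Lim_transform_eventually[OF tendsto_const ev] by simp
qed

text \<open>A root whose limit lies on the real segment does no harm, because the damping pushes it into the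
  upper half-plane; only a limit root on the deformed contour has to be excluded.\<close>

lemma line_integral_limit:
  fixes a b c R :: real and q :: "real \<Rightarrow> complex"
  defines "p \<equiv> \<lambda>z. of_real a * z\<^sup>2 + 2 * of_real b * z + of_real c"
  defines "s \<equiv> \<lambda>q. - of_real b / of_real a + q / of_real a"
  assumes "\<alpha> < \<beta>" "\<rho> > 0" "open V" and V: "cbox (Complex \<alpha> 0) (Complex \<beta> \<rho>) \<subseteq> V"
    and F: "F holomorphic_on V" and "a > 0"
    and q: "\<And>\<epsilon>. \<epsilon> > 0 \<Longrightarrow> (q \<epsilon>)\<^sup>2 = of_real (b\<^sup>2 - a * c) + \<i> * of_real (a * \<epsilon>)"
    and qpos: "\<And>\<epsilon>. \<epsilon> > 0 \<Longrightarrow> Im (q \<epsilon>) > 0"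
    and q\<^sub>0: "(q \<longlongrightarrow> q\<^sub>0) (at_right 0)" and "b\<^sup>2 - a * c \<noteq> 0"
    and nz: "\<And>z. z \<in> path_image (deformed_contour {\<alpha><..<\<beta>} \<rho>) \<Longrightarrow> p z \<noteq> 0"
  shows "((\<lambda>\<epsilon>. LINT x:{\<alpha><..<\<beta>}|lebesgue. exp (\<i> * of_real R * of_real x) * F (of_real x) / (p (of_real x) - \<i> * of_real \<epsilon>))
    \<longlongrightarrow> contour_integral (deformed_contour {\<alpha><..<\<beta>} \<rho>) (\<lambda>z. exp (\<i> * of_real R * z) * F z / p z)
    + pi * \<i> * (exp (\<i> * of_real R * s q\<^sub>0) * cont_on_rect {\<alpha><..<\<beta>} \<rho> F (s q\<^sub>0) / q\<^sub>0)) (at_right 0)"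
proof -
  let ?C = "deformed_contour {\<alpha><..<\<beta>} \<rho>"
  have pos: "\<forall>\<^sub>F \<epsilon>::real in at_right 0. \<epsilon> > 0" by (simp add: eventually_at_filter)
  have s0: "((\<lambda>\<epsilon>. s (q \<epsilon>)) \<longlongrightarrow> s q\<^sub>0) (at_right 0)"
    unfolding s_def using \<open>a > 0\<close> by (intro tendsto_intros q\<^sub>0) auto
  have ims: "Im (s (q \<epsilon>)) > 0" if "\<epsilon> > 0" for \<epsilon>
    using qpos[OF that] \<open>a > 0\<close> by (simp add: s_def)
  have "((\<lambda>\<epsilon>. (q \<epsilon>)\<^sup>2) \<longlongrightarrow> of_real (b\<^sup>2 - a * c) + \<i> * of_real (a * 0)) (at_right 0)"
  proof (rule Lim_transform_eventually)
    show "((\<lambda>\<epsilon>. of_real (b\<^sup>2 - a * c) + \<i> * of_real (a * \<epsilon>)) \<longlongrightarrow>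
      of_real (b\<^sup>2 - a * c) + \<i> * of_real (a * 0)) (at_right (0::real))"
      by (intro tendsto_intros)
    show "\<forall>\<^sub>F \<epsilon> in at_right 0. of_real (b\<^sup>2 - a * c) + \<i> * of_real (a * \<epsilon>) = (q \<epsilon>)\<^sup>2"
      using pos by eventually_elim (simp add: q)
  qed
  moreover have "((\<lambda>\<epsilon>. (q \<epsilon>)\<^sup>2) \<longlongrightarrow> q\<^sub>0\<^sup>2) (at_right 0)" by (intro tendsto_intros q\<^sub>0)
  ultimately have q_sq: "q\<^sub>0\<^sup>2 = of_real (b\<^sup>2 - a * c)"
    using tendsto_unique[of "at_right (0::real)"] by fastforce
  then have "q\<^sub>0 \<noteq> 0" using \<open>b\<^sup>2 - a * c \<noteq> 0\<close> by (metis of_real_eq_0_iff power_zero_numeral)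
  have "of_real a * p (s q\<^sub>0) = q\<^sub>0\<^sup>2 - of_real (b\<^sup>2 - a * c)"
    using \<open>a > 0\<close> by (simp add: p_def s_def field_simps power2_eq_square)
  then have "p (s q\<^sub>0) = 0" using q_sq \<open>a > 0\<close> by simp
  then have s0C: "s q\<^sub>0 \<notin> path_image ?C" using nz by blast
  have "closed (path_image ?C)"
    by (simp add: closed_path_image valid_path_imp_path valid_path_deformed_contour)
  then have "\<forall>\<^sub>F \<epsilon> in at_right 0. s (q \<epsilon>) \<in> - path_image ?C"
    using topological_tendstoD[OF s0, of "- path_image ?C"] s0C by auto
  with pos have "\<forall>\<^sub>F \<epsilon> in at_right 0. contour_integral ?C
        (\<lambda>z. exp (\<i> * of_real R * z) * F z / (p z - \<i> * of_real \<epsilon>))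
      + pi * \<i> * (exp (\<i> * of_real R * s (q \<epsilon>)) * cont_on_rect {\<alpha><..<\<beta>} \<rho> F (s (q \<epsilon>)) / q \<epsilon>)
      = (LINT x:{\<alpha><..<\<beta>}|lebesgue. exp (\<i> * of_real R * of_real x) * F (of_real x) / (p (of_real x) - \<i> * of_real \<epsilon>))"
  proof eventually_elim
    case (elim \<epsilon>)
    have "s (q \<epsilon>) \<notin> path_image (rectpath (Complex \<alpha> 0) (Complex \<beta> \<rho>))"
      using elim ims[of \<epsilon>] assms(3,4) by (auto simp: path_image_rectpath_eq)
    then show ?case
      using line_integral_eq_contour_plus_residue[OF assms(3-7) \<open>a > 0\<close> q qpos, of \<epsilon> R] elim(1)
      by (simp add: p_def s_def)
  qed
  moreover have "((\<lambda>\<epsilon>. contour_integral ?C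
        (\<lambda>z. exp (\<i> * of_real R * z) * F z / (p z - \<i> * of_real \<epsilon>))
      + pi * \<i> * (exp (\<i> * of_real R * s (q \<epsilon>)) * cont_on_rect {\<alpha><..<\<beta>} \<rho> F (s (q \<epsilon>)) / q \<epsilon>))
    \<longlongrightarrow> contour_integral ?C (\<lambda>z. exp (\<i> * of_real R * z) * F z / p z)
      + pi * \<i> * (exp (\<i> * of_real R * s q\<^sub>0) * cont_on_rect {\<alpha><..<\<beta>} \<rho> F (s q\<^sub>0) / q\<^sub>0)) (at_right 0)"
  proof (intro tendsto_intros deformed_contour_integral_tendsto s0 q\<^sub>0 \<open>q\<^sub>0 \<noteq> 0\<close> assms(3,4) nz)
    show "((\<lambda>\<epsilon>. cont_on_rect {\<alpha><..<\<beta>} \<rho> F (s (q \<epsilon>))) \<longlongrightarrow> cont_on_rect {\<alpha><..<\<beta>} \<rho> F (s q\<^sub>0)) (at_right 0)"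
      by (rule cont_on_rect_tendsto[OF assms(3-7) s0 _ s0C])
        (use pos in eventually_elim, use ims in simp)
    have "path_image ?C \<subseteq> V" using V assms(3,4) by (auto simp: path_image_deformed_contour)
    then show "continuous_on (path_image ?C) (\<lambda>z. exp (\<i> * of_real R * z) * F z)"
      by (intro continuous_intros holomorphic_on_imp_continuous_on holomorphic_on_subset[OF F])
    show "continuous_on (path_image ?C) p" unfolding p_def by (intro continuous_intros)
  qed
  ultimately show ?thesis by (rule Lim_transform_eventually[rotated])
qed

text \<open>In units of \<open>a\<close>, with \<open>X + i Y\<close> measured from the midpoint of the roots, the quadratic is
  \<open>((X + i Y)\<^sup>2 - D) / a\<close>. The vertical sides have \<open>X\<^sup>2 = D \<plusminus> e\<close>, the upper side has \<open>Y = h\<close>.\<close>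

lemma quadratic_lower_bound_on_contour:
  fixes X Y D e h :: real
  assumes "e > 0" "D \<ge> - e / 2" "D \<ge> - h\<^sup>2 / 2" and side: "X\<^sup>2 = D + e \<or> X\<^sup>2 = D - e \<or> Y = h"
  shows "norm ((Complex X Y)\<^sup>2 - of_real D) \<ge> min (e / 2) (h\<^sup>2 / 4)"
proof -
  let ?z = "(Complex X Y)\<^sup>2 - of_real D"
  have re: "Re ?z = X\<^sup>2 - Y\<^sup>2 - D" and im: "Im ?z = 2 * X * Y"
    by (simp_all add: power2_eq_square)
  have sq: "norm ?z \<ge> u" if "\<bar>X\<bar> \<ge> v" "\<bar>Y\<bar> \<ge> w" "v \<ge> 0" "w \<ge> 0" "u = 2 * (v * w)" for u v w
  proof -
    have "u \<le> 2 * (\<bar>X\<bar> * \<bar>Y\<bar>)" using mult_mono[OF that(1,2)] that by simp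
    also have "\<dots> = \<bar>Im ?z\<bar>" unfolding im by (simp add: abs_mult)
    finally show ?thesis using abs_Im_le_cmod[of ?z] by linarith
  qed
  consider "X\<^sup>2 = D + e" "Y\<^sup>2 \<le> e / 2" | "X\<^sup>2 = D + e" "Y\<^sup>2 > e / 2" | "X\<^sup>2 = D - e"
    | "Y = h" "X\<^sup>2 \<le> h\<^sup>2 / 4" | "Y = h" "X\<^sup>2 > h\<^sup>2 / 4"
    using side by linarith
  then show ?thesis
  proof cases
    case 1
    then have "Re ?z \<ge> e / 2" unfolding re by simp
    then show ?thesis using complex_Re_le_cmod[of ?z] by linarith
  next
    case 2
    have "\<bar>X\<bar> \<ge> sqrt (e / 2)" "\<bar>Y\<bar> \<ge> sqrt (e / 2)"
      using 2 assms by (auto intro!: real_le_lsqrt simp: real_sqrt_abs[symmetric] simp del: real_sqrt_abs)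
    then have "norm ?z \<ge> 2 * (sqrt (e / 2) * sqrt (e / 2))"
      by (rule sq) (use assms in auto)
    moreover have "sqrt (e / 2) * sqrt (e / 2) = e / 2" using \<open>e > 0\<close> by simp
    ultimately show ?thesis using \<open>e > 0\<close> by linarith
  next
    case 3
    then have "Re ?z \<le> - e" unfolding re by simp
    then show ?thesis using abs_Re_le_cmod[of ?z] \<open>e > 0\<close> by linarith
  next
    case 4
    then have "Re ?z \<le> - (h\<^sup>2 / 4)" unfolding re using assms(3) by simp
    then show ?thesis using abs_Re_le_cmod[of ?z] by linarith
  next
    case 5
    have "sqrt ((h / 2)\<^sup>2) \<le> sqrt (X\<^sup>2)"
      using 5 by (intro real_sqrt_le_mono) (simp add: power_divide)
    then have "\<bar>X\<bar> \<ge> \<bar>h\<bar> / 2" by simp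
    then have "norm ?z \<ge> 2 * (\<bar>h\<bar> / 2 * \<bar>h\<bar>)"
      by (rule sq) (use 5 in auto)
    moreover have "\<bar>h\<bar> * \<bar>h\<bar> = h\<^sup>2" by (simp add: power2_eq_square)
    ultimately show ?thesis
      using min.cobounded2[of "e / 2" "h\<^sup>2 / 4"] zero_le_power2[of h] by linarith
  qed
qed

section \<open>Geometry of the lines and of the neighbourhood\<close>

locale fermi_geometry =
  fixes A :: "real ^ 'd ^ 'd" and lam :: real and n :: "real ^ 'd"
    and t :: "'m::finite \<Rightarrow> real ^ 'd" and \<delta> \<eta> :: real
  assumes lam_pos: "lam > 0"
    and posdef: "positive_definite A"
    and norm_n: "norm n = 1"
    and onb: "orthonormal_basis_perp n t"
    and \<delta>_pos: "\<delta> > 0"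
    and \<eta>_pos: "0 < \<eta>" and \<eta>_small: "\<eta> < \<delta> / (2 * coef_a A n)"
begin

abbreviation a :: real where "a \<equiv> coef_a A n"
abbreviation b :: "real ^ 'm \<Rightarrow> real" where "b \<equiv> coef_b A n t"
abbreviation c :: "real ^ 'm \<Rightarrow> real" where "c \<equiv> coef_c A lam t"
abbreviation D :: "real ^ 'm \<Rightarrow> real" where "D \<equiv> discr A lam n t"

definition line_point :: "(real ^ 'm) \<times> real \<Rightarrow> real ^ 'd" where
  "line_point = (\<lambda>(\<gamma>, s). tangential t \<gamma> + s *\<^sub>R n)"

lemma a_pos: "a > 0"
proof -
  have "n \<noteq> 0" using norm_n by auto
  then show ?thesis using posdef by (auto simp: positive_definite_def coef_a_def)
qed

lemma a\<eta>_less: "a * \<eta> < \<delta> / 2"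
  using \<eta>_small a_pos by (simp add: field_simps)

lemma A_symmetric: "x \<bullet> (A *v y) = y \<bullet> (A *v x)"
proof -
  have "transpose A = A" using posdef by (simp add: positive_definite_def)
  have "x \<bullet> (A *v y) = (x v* A) \<bullet> y" by (rule dot_lmul_matrix[symmetric])
  also have "\<dots> = (transpose A *v x) \<bullet> y" by (simp only: transpose_matrix_vector)
  also have "\<dots> = y \<bullet> (A *v x)" unfolding \<open>transpose A = A\<close> by (rule inner_commute)
  finally show ?thesis .
qed

lemma tangential_linear: "linear (tangential t)"
  by (rule linearI) (simp_all add: tangential_def scaleR_left.add sum.distrib scaleR_sum_right)

lemma tangential_perp: "tangential t \<gamma> \<bullet> n = 0"
proof -
  have "t k \<bullet> n = 0" for k
    using onb span_base[of "t k" "range t"] by (auto simp: orthonormal_basis_perp_def)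
  then show ?thesis by (simp add: tangential_def inner_sum_left)
qed

lemma tangential_inner: "tangential t \<gamma> \<bullet> tangential t \<gamma>' = \<gamma> \<bullet> \<gamma>'"
proof -
  have t: "t k \<bullet> t l = (if k = l then 1 else 0)" for k l
    using onb by (simp add: orthonormal_basis_perp_def)
  show ?thesis
    unfolding inner_vec_def[of \<gamma> \<gamma>'] inner_real_def
    by (simp add: tangential_def inner_sum_left inner_sum_right t if_distrib mult.commute cong: if_cong)
qed

lemma line_point_linear: "linear line_point"
  using linear_add[OF tangential_linear] linear_scale[OF tangential_linear]
  by (intro linearI) (auto simp: line_point_def algebra_simps)

lemma norm_line_point: "norm (line_point z) = norm z"
proof -
  have "n \<bullet> n = 1" using norm_n by (simp add: norm_eq_1)
  moreover have np: "n \<bullet> tangential t \<gamma> = 0" for \<gamma>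
    using tangential_perp[of \<gamma>] by (simp add: inner_commute)
  ultimately have "line_point z \<bullet> line_point z = z \<bullet> z"
    by (cases z) (simp add: line_point_def inner_add_left inner_add_right tangential_inner
      tangential_perp np)
  then show ?thesis by (simp add: norm_eq_sqrt_inner)
qed

lemma dist_line_point: "dist (line_point y) (line_point z) = dist y z"
  using norm_line_point[of "y - z"] by (simp add: dist_norm linear_diff[OF line_point_linear])

lemma inj_line_point: "inj line_point"
  by (rule injI) (metis dist_line_point dist_eq_0_iff)

lemma surj_line_point: "surj line_point"
  unfolding surj_def
proof
  fix \<xi> :: "real ^ 'd"
  define v where "v = \<xi> - (\<xi> \<bullet> n) *\<^sub>R n"
  have "v \<bullet> n = 0" using norm_n by (simp add: v_def inner_diff_left norm_eq_1)
  then have "v \<in> span (range t)" using onb by (auto simp: orthonormal_basis_perp_def)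
  moreover have "span (range t) \<subseteq> range (tangential t)"
  proof (rule span_minimal)
    show "subspace (range (tangential t))"
      using tangential_linear by (simp add: linear_subspace_image)
    have "t k = tangential t (axis k 1)" for k
      by (simp add: tangential_def axis_def if_distrib[of "\<lambda>x. x *\<^sub>R _"] cong: if_cong)
    then show "range t \<subseteq> range (tangential t)" by auto
  qed
  ultimately obtain \<gamma> where "v = tangential t \<gamma>" by auto
  then have "\<xi> = tangential t \<gamma> + (\<xi> \<bullet> n) *\<^sub>R n" by (simp only: v_def diff_eq_eq)
  then have "\<xi> = line_point (\<gamma>, \<xi> \<bullet> n)" by (simp add: line_point_def)
  then show "\<exists>z. \<xi> = line_point z" by blast
qed

lemma dim_line_point: "DIM((real ^ 'm) \<times> real) = DIM(real ^ 'd)"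
proof -
  have "dim (line_point ` UNIV) = dim (UNIV :: ((real ^ 'm) \<times> real) set)"
    using line_point_linear inj_line_point by (intro dim_image_eq) auto
  then show ?thesis using surj_line_point by (simp add: dim_UNIV)
qed

lemma symbol_line_point:
  "line_point (\<gamma>, s) \<bullet> (A *v line_point (\<gamma>, s)) - lam = a * s\<^sup>2 + 2 * b \<gamma> * s + c \<gamma>"
  using A_symmetric[of n "tangential t \<gamma>"]
  by (simp add: line_point_def coef_a_def coef_b_def coef_c_def matrix_vector_right_distrib
      inner_add_left inner_add_right matrix_vector_mult_scaleR power2_eq_square algebra_simps)

lemma symbol_of_real: "symbol A lam n t \<gamma> (of_real s) = of_real (a * s\<^sup>2 + 2 * b \<gamma> * s + c \<gamma>)"
  by (simp add: symbol_def)

lemma a_symbol: "of_real a * symbol A lam n t \<gamma> z = (of_real a * z + of_real (b \<gamma>))\<^sup>2 - of_real (D \<gamma>)"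
  by (simp add: symbol_def discr_def algebra_simps power2_eq_square)

lemma a_symbol_real: "a * (a * s\<^sup>2 + 2 * b \<gamma> * s + c \<gamma>) = (a * s + b \<gamma>)\<^sup>2 - D \<gamma>"
  by (simp add: discr_def algebra_simps power2_eq_square)

lemma near_Fermi_iff:
  "\<bar>a * s\<^sup>2 + 2 * b \<gamma> * s + c \<gamma>\<bar> < \<eta> \<longleftrightarrow> \<bar>(a * s + b \<gamma>)\<^sup>2 - D \<gamma>\<bar> < a * \<eta>"
proof -
  have "\<bar>(a * s + b \<gamma>)\<^sup>2 - D \<gamma>\<bar> = a * \<bar>a * s\<^sup>2 + 2 * b \<gamma> * s + c \<gamma>\<bar>"
    unfolding a_symbol_real[symmetric] using a_pos by (simp add: abs_mult)
  then show ?thesis using a_pos by simp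
qed

lemma line_point_in_nbhd:
  "line_point (\<gamma>, s) \<in> fermi_nbhd A lam n t \<delta> \<eta> \<longleftrightarrow> \<bar>(a * s + b \<gamma>)\<^sup>2 - D \<gamma>\<bar> < a * \<eta>"
proof
  assume "line_point (\<gamma>, s) \<in> fermi_nbhd A lam n t \<delta> \<eta>"
  then have "\<bar>line_point (\<gamma>, s) \<bullet> (A *v line_point (\<gamma>, s)) - lam\<bar> < \<eta>"
    by (auto simp: fermi_nbhd_def)
  then show "\<bar>(a * s + b \<gamma>)\<^sup>2 - D \<gamma>\<bar> < a * \<eta>"
    by (simp only: symbol_line_point near_Fermi_iff)
next
  assume *: "\<bar>(a * s + b \<gamma>)\<^sup>2 - D \<gamma>\<bar> < a * \<eta>"
  have "D \<gamma> > - \<delta> / 2" using * a\<eta>_less zero_le_power2[of "a * s + b \<gamma>"] by linarith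
  moreover have "\<bar>line_point (\<gamma>, s) \<bullet> (A *v line_point (\<gamma>, s)) - lam\<bar> < \<eta>"
    using * by (simp only: symbol_line_point near_Fermi_iff)
  ultimately show "line_point (\<gamma>, s) \<in> fermi_nbhd A lam n t \<delta> \<eta>"
    unfolding fermi_nbhd_def line_point_def by auto
qed

lemma symbol_off_nbhd:
  assumes "\<xi> \<notin> fermi_nbhd A lam n t \<delta> \<eta>"
  shows "\<bar>\<xi> \<bullet> (A *v \<xi>) - lam\<bar> \<ge> \<eta>"
proof -
  obtain \<gamma> s where \<xi>: "\<xi> = line_point (\<gamma>, s)" using surj_line_point by (metis surjD prod.exhaust)
  show ?thesis
    using assms near_Fermi_iff[of s \<gamma>] unfolding \<xi> symbol_line_point line_point_in_nbhd by linarith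
qed

lemma line_params_eq: "line_params A lam n t \<delta> \<eta> \<gamma> = {s. \<bar>(a * s + b \<gamma>)\<^sup>2 - D \<gamma>\<bar> < a * \<eta>}"
  using line_point_in_nbhd by (simp add: line_params_def line_point_def)

text \<open>With the convention \<open>sqrt (- x) = - sqrt x\<close> the formulas for the index \<open>0\<close> give an empty interval
  exactly when the line misses the neighbourhood, and the ends depend continuously on \<open>\<gamma>\<close>
  everywhere.\<close>

fun lower_end :: "seg_index \<Rightarrow> real ^ 'm \<Rightarrow> real" where
  "lower_end Seg_Plus \<gamma> = (- b \<gamma> + sqrt (D \<gamma> - a * \<eta>)) / a"
| "lower_end i \<gamma> = (- b \<gamma> - sqrt (D \<gamma> + a * \<eta>)) / a"

fun upper_end :: "seg_index \<Rightarrow> real ^ 'm \<Rightarrow> real" where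
  "upper_end Seg_Minus \<gamma> = (- b \<gamma> - sqrt (D \<gamma> - a * \<eta>)) / a"
| "upper_end i \<gamma> = (- b \<gamma> + sqrt (D \<gamma> + a * \<eta>)) / a"

lemma a\<eta>_pos: "a * \<eta> > 0" using a_pos \<eta>_pos by simp

lemma line_params_low:
  assumes "D \<gamma> < a * \<eta>"
  shows "line_params A lam n t \<delta> \<eta> \<gamma> = {lower_end Seg_Zero \<gamma><..<upper_end Seg_Zero \<gamma>}"
proof -
  have "\<bar>y\<^sup>2 - D \<gamma>\<bar> < a * \<eta> \<longleftrightarrow> \<bar>y\<bar> < sqrt (D \<gamma> + a * \<eta>)" for y
  proof -
    have "y\<^sup>2 - D \<gamma> > - (a * \<eta>)" using assms zero_le_power2[of y] by linarith
    then have "\<bar>y\<^sup>2 - D \<gamma>\<bar> < a * \<eta> \<longleftrightarrow> y\<^sup>2 < D \<gamma> + a * \<eta>" by linarith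
    also have "\<dots> \<longleftrightarrow> \<bar>y\<bar> < sqrt (D \<gamma> + a * \<eta>)"
      by (metis real_sqrt_abs real_sqrt_less_iff)
    finally show ?thesis .
  qed
  moreover have "\<bar>a * s + b \<gamma>\<bar> < r \<longleftrightarrow> s \<in> {(- b \<gamma> - r) / a<..<(- b \<gamma> + r) / a}" for s r
    using a_pos by (auto simp: field_simps abs_less_iff)
  ultimately show ?thesis unfolding line_params_eq by auto
qed

lemma line_params_high:
  assumes "D \<gamma> \<ge> a * \<eta>"
  shows "line_params A lam n t \<delta> \<eta> \<gamma> = {lower_end Seg_Minus \<gamma><..<upper_end Seg_Minus \<gamma>}
    \<union> {lower_end Seg_Plus \<gamma><..<upper_end Seg_Plus \<gamma>}"
proof -
  have "\<bar>y\<^sup>2 - D \<gamma>\<bar> < a * \<eta> \<longleftrightarrow> sqrt (D \<gamma> - a * \<eta>) < \<bar>y\<bar> \<and> \<bar>y\<bar> < sqrt (D \<gamma> + a * \<eta>)" for y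
  proof -
    have "\<bar>y\<^sup>2 - D \<gamma>\<bar> < a * \<eta> \<longleftrightarrow> D \<gamma> - a * \<eta> < y\<^sup>2 \<and> y\<^sup>2 < D \<gamma> + a * \<eta>" by linarith
    then show ?thesis by (metis real_sqrt_abs real_sqrt_less_iff)
  qed
  moreover have "sqrt (D \<gamma> - a * \<eta>) \<ge> 0" using assms by simp
  moreover have "r' < \<bar>a * s + b \<gamma>\<bar> \<and> \<bar>a * s + b \<gamma>\<bar> < r \<longleftrightarrow>
      s \<in> {(- b \<gamma> - r) / a<..<(- b \<gamma> - r') / a} \<union> {(- b \<gamma> + r') / a<..<(- b \<gamma> + r) / a}"
    if "r' \<ge> 0" for s r r'
  proof -
    have "r' < \<bar>y\<bar> \<and> \<bar>y\<bar> < r \<longleftrightarrow> - r < y \<and> y < - r' \<or> r' < y \<and> y < r" for y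
      using that by linarith
    moreover have "l < a * s + b \<gamma> \<longleftrightarrow> (- b \<gamma> + l) / a < s" "a * s + b \<gamma> < l \<longleftrightarrow> s < (- b \<gamma> + l) / a" for l
      using a_pos by (simp_all add: field_simps)
    ultimately show ?thesis by (simp add: minus_diff_commute)
  qed
  ultimately show ?thesis unfolding line_params_eq by auto
qed

text \<open>For \<open>D = a \<eta>\<close> the two open intervals share an endpoint, and they are still two components.\<close>

lemma components_high:
  assumes "D \<gamma> \<ge> a * \<eta>"
  defines "M \<equiv> {lower_end Seg_Minus \<gamma><..<upper_end Seg_Minus \<gamma>}"
    and "Q \<equiv> {lower_end Seg_Plus \<gamma><..<upper_end Seg_Plus \<gamma>}"
  shows "components (line_params A lam n t \<delta> \<eta> \<gamma>) = {M, Q}"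
    and "M \<noteq> Q" and "Sup M \<le> Inf Q" and "\<not> Sup Q \<le> Inf M"
proof -
  have s: "sqrt (D \<gamma> - a * \<eta>) < sqrt (D \<gamma> + a * \<eta>)" "0 \<le> sqrt (D \<gamma> - a * \<eta>)"
    using a\<eta>_pos assms(1) by auto
  then have o: "lower_end Seg_Minus \<gamma> < upper_end Seg_Minus \<gamma>" "upper_end Seg_Minus \<gamma> \<le> lower_end Seg_Plus \<gamma>"
    "lower_end Seg_Plus \<gamma> < upper_end Seg_Plus \<gamma>"
    using a_pos by (auto simp: divide_simps)
  have disj: "M \<inter> Q = {}" using o(2) by (auto simp: M_def Q_def)
  have ne: "M \<noteq> {}" "Q \<noteq> {}" using o by (auto simp: M_def Q_def)
  show "M \<noteq> Q" using disj ne by auto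
  show "components (line_params A lam n t \<delta> \<eta> \<gamma>) = {M, Q}"
    using disj ne line_params_high[OF assms(1)]
    by (intro components_open_unique) (auto simp: M_def Q_def pairwise_insert disjnt_def)
  have "Inf M = lower_end Seg_Minus \<gamma>" "Sup M = upper_end Seg_Minus \<gamma>"
    "Inf Q = lower_end Seg_Plus \<gamma>" "Sup Q = upper_end Seg_Plus \<gamma>"
    unfolding M_def Q_def using o by (simp_all only: cInf_greaterThanLessThan cSup_greaterThanLessThan)
  then show "Sup M \<le> Inf Q" "\<not> Sup Q \<le> Inf M" using o by auto
qed

lemma ind_high: "D \<gamma> \<ge> a * \<eta> \<Longrightarrow> ind A lam n t \<delta> \<eta> \<gamma> = {Seg_Minus, Seg_Plus}"
  using components_high[of \<gamma>] by (simp add: ind_def)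

lemma ind_low:
  assumes "D \<gamma> < a * \<eta>"
  shows "ind A lam n t \<delta> \<eta> \<gamma> = {Seg_Zero}"
proof -
  let ?I = "{lower_end Seg_Zero \<gamma><..<upper_end Seg_Zero \<gamma>}"
  have "components ?I \<subseteq> {?I}"
    by (cases "?I = {}") (auto simp: components_eq_sing_iff[THEN iffD2] simp del: greaterThanLessThan_empty_iff)
  then have "card (components ?I) \<le> 1" using card_mono[of "{?I}" "components ?I"] by simp
  then show ?thesis by (simp add: ind_def line_params_low[OF assms])
qed

lemma in_ind_cases:
  assumes "i \<in> ind A lam n t \<delta> \<eta> \<gamma>"
  obtains "D \<gamma> < a * \<eta>" "i = Seg_Zero" | "D \<gamma> \<ge> a * \<eta>" "i = Seg_Minus" | "D \<gamma> \<ge> a * \<eta>" "i = Seg_Plus"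
  using assms ind_low ind_high by (cases "D \<gamma> < a * \<eta>") auto

lemma segment_eq:
  assumes "i \<in> ind A lam n t \<delta> \<eta> \<gamma>"
  shows "segment A lam n t \<delta> \<eta> i \<gamma> = {lower_end i \<gamma><..<upper_end i \<gamma>}"
  using assms
proof (cases rule: in_ind_cases)
  case 1
  then show ?thesis by (simp add: segment_def line_params_low[OF 1(1)])
next
  case 2
  note C = components_high[OF 2(1)]
  show ?thesis unfolding segment_def C(1) Let_def 2(2) seg_index.case
    by (rule the_equality) (use C(2-4) in auto)
next
  case 3
  note C = components_high[OF 3(1)]
  show ?thesis unfolding segment_def C(1) Let_def 3(2) seg_index.case
    by (rule the_equality) (use C(2-4) in auto)
qed

lemma lower_less_upper_iff:
  assumes "i \<in> ind A lam n t \<delta> \<eta> \<gamma>"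
  shows "lower_end i \<gamma> < upper_end i \<gamma> \<longleftrightarrow> D \<gamma> > - (a * \<eta>)"
  using assms
proof (cases rule: in_ind_cases)
  case 1
  have "lower_end i \<gamma> < upper_end i \<gamma> \<longleftrightarrow> 0 < sqrt (D \<gamma> + a * \<eta>)"
    using a_pos 1 by (simp add: divide_less_cancel)
  also have "\<dots> \<longleftrightarrow> D \<gamma> > - (a * \<eta>)" unfolding real_sqrt_gt_0_iff by linarith
  finally show ?thesis .
qed (use a_pos a\<eta>_pos in \<open>auto simp: divide_less_cancel\<close>)

lemma continuous_coefs [continuous_intros]:
  "continuous_on S b" "continuous_on S c" "continuous_on S D"
proof -
  have T: "continuous_on S (tangential t)"
    using tangential_linear by (simp add: linear_continuous_on linear_linear)
  show b: "continuous_on S b" unfolding coef_b_def by (intro continuous_intros T)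
  have "continuous_on S (\<lambda>\<gamma>. A *v tangential t \<gamma>)"
    by (intro continuous_on_compose2[OF matrix_vector_mult_linear_continuous_on T]) auto
  then show c: "continuous_on S c" unfolding coef_c_def by (intro continuous_intros T)
  show "continuous_on S D" unfolding discr_def by (intro continuous_intros b c)
qed

lemma continuous_ends: "continuous_on S (lower_end i)" "continuous_on S (upper_end i)"
  using a_pos by (cases i; auto intro!: continuous_intros)+

lemma side_points:
  assumes i: "i \<in> ind A lam n t \<delta> \<eta> \<gamma>" and D: "D \<gamma> > - (a * \<eta>)" and "\<rho> > 0"
    and z: "z \<in> path_image (deformed_contour {lower_end i \<gamma><..<upper_end i \<gamma>} \<rho>)"
  shows "(a * Re z + b \<gamma>)\<^sup>2 = D \<gamma> + a * \<eta> \<or> (a * Re z + b \<gamma>)\<^sup>2 = D \<gamma> - a * \<eta> \<and> D \<gamma> \<ge> a * \<eta> \<or> a * Im z = a * \<rho>"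
proof -
  have lu: "lower_end i \<gamma> < upper_end i \<gamma>" using lower_less_upper_iff[OF i] D by simp
  have "Re z = lower_end i \<gamma> \<or> Re z = upper_end i \<gamma> \<or> Im z = \<rho>"
    using z by (simp add: path_image_deformed_contour[OF lu \<open>\<rho> > 0\<close>])
  moreover have "a * ((- b \<gamma> + r) / a) + b \<gamma> = r" "a * ((- b \<gamma> - r) / a) + b \<gamma> = - r" for r
    using a_pos by simp_all
  ultimately show ?thesis
    using i D by - (erule in_ind_cases, auto)
qed

lemma symbol_as_square:
  "of_real a * symbol A lam n t \<gamma> z = (Complex (a * Re z + b \<gamma>) (a * Im z))\<^sup>2 - of_real (D \<gamma>)"
proof -
  have "Complex (a * Re z + b \<gamma>) (a * Im z) = of_real a * z + of_real (b \<gamma>)"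
    by (simp add: complex_eq_iff)
  then show ?thesis by (simp only: a_symbol)
qed

text \<open>For \<open>D \<ge> 0\<close> the roots are real points between the ends of the segments, and for slightly negative
  \<open>D\<close> they are close to the midpoint of the only segment. In both cases they keep a distance from the
  contour, which depends on \<open>a\<close>, \<open>\<eta>\<close> and \<open>\<rho>\<close> only.\<close>

lemma symbol_lower_bound_on_contour:
  assumes i: "i \<in> ind A lam n t \<delta> \<eta> \<gamma>" and "\<rho> > 0"
    and D: "D \<gamma> \<ge> - (a * \<eta>) / 2" "D \<gamma> \<ge> - (a * \<rho>)\<^sup>2 / 2"
    and z: "z \<in> path_image (deformed_contour {lower_end i \<gamma><..<upper_end i \<gamma>} \<rho>)"
  shows "norm (symbol A lam n t \<gamma> z) \<ge> min (a * \<eta> / 2) ((a * \<rho>)\<^sup>2 / 4) / a"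
proof -
  have "D \<gamma> > - (a * \<eta>)" using D(1) a\<eta>_pos by linarith
  then have "norm (of_real a * symbol A lam n t \<gamma> z) \<ge> min (a * \<eta> / 2) ((a * \<rho>)\<^sup>2 / 4)"
    unfolding symbol_as_square using side_points[OF i _ \<open>\<rho> > 0\<close> z] D a\<eta>_pos
    by (intro quadratic_lower_bound_on_contour) auto
  then show ?thesis using a_pos by (simp add: norm_mult field_simps)
qed

text \<open>A root can meet the contour only if \<open>D < 0\<close>: the roots are then the midpoint of the segment shifted by
  \<open>\<plusminus> i sqrt (- D) / a\<close>, and the upper one hits the upper side for exactly one value of \<open>D\<close>.\<close>

lemma symbol_nonzero_on_contour:
  assumes i: "i \<in> ind A lam n t \<delta> \<eta> \<gamma>" and "\<rho> > 0"
    and D: "D \<gamma> > - (a * \<eta>)" "D \<gamma> \<noteq> - (a * \<rho>)\<^sup>2"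
    and z: "z \<in> path_image (deformed_contour {lower_end i \<gamma><..<upper_end i \<gamma>} \<rho>)"
  shows "symbol A lam n t \<gamma> z \<noteq> 0"
proof
  let ?X = "a * Re z + b \<gamma>" and ?Y = "a * Im z"
  assume "symbol A lam n t \<gamma> z = 0"
  then have sq: "(Complex ?X ?Y)\<^sup>2 = of_real (D \<gamma>)" using symbol_as_square[of \<gamma> z] by simp
  have "Re ((Complex ?X ?Y)\<^sup>2) = D \<gamma>" "Im ((Complex ?X ?Y)\<^sup>2) = 0" unfolding sq by simp_all
  then have re: "?X\<^sup>2 - ?Y\<^sup>2 = D \<gamma>" and im: "?X = 0 \<or> ?Y = 0"
    by (auto simp: power2_eq_square)
  show False
    using side_points[OF i D(1) \<open>\<rho> > 0\<close> z]
  proof (elim disjE conjE)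
    assume "?X\<^sup>2 = D \<gamma> + a * \<eta>"
    then show False using im re D(1) a\<eta>_pos by auto
  next
    assume "?X\<^sup>2 = D \<gamma> - a * \<eta>"
    then show False using re a\<eta>_pos zero_le_power2[of ?Y] by linarith
  next
    assume Y: "?Y = a * \<rho>"
    then have "?Y \<noteq> 0" using a_pos \<open>\<rho> > 0\<close> by simp
    then show False using im re D(2) Y by auto
  qed
qed

lemma sqrt_discr_eps_square:
  "(sqrt_discr_eps A lam n t \<gamma> \<epsilon>)\<^sup>2 = of_real ((b \<gamma>)\<^sup>2 - a * c \<gamma>) + \<i> * of_real (a * \<epsilon>)"
  by (simp add: sqrt_discr_eps_def discr_def)

text \<open>The principal root is discontinuous across the negative axis, but \<open>D + i a \<epsilon>\<close> approaches it from
  above, where this formula is continuous.\<close>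

lemma sqrt_discr_eps_eq:
  assumes "\<epsilon> > 0"
  shows "sqrt_discr_eps A lam n t \<gamma> \<epsilon> =
    Complex (sqrt ((norm (of_real (D \<gamma>) + \<i> * of_real (a * \<epsilon>)) + D \<gamma>) / 2))
            (sqrt ((norm (of_real (D \<gamma>) + \<i> * of_real (a * \<epsilon>)) - D \<gamma>) / 2))"
proof -
  have "a * \<epsilon> > 0" using assms a_pos by simp
  then show ?thesis by (simp add: sqrt_discr_eps_def complex_eq_iff)
qed

lemma Im_sqrt_discr_eps_pos:
  assumes "\<epsilon> > 0"
  shows "Im (sqrt_discr_eps A lam n t \<gamma> \<epsilon>) > 0"
proof -
  have "a * \<epsilon> > 0" using assms a_pos by simp
  then have "(a * \<epsilon>)\<^sup>2 > 0" by (rule zero_less_power)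
  then have "(D \<gamma>)\<^sup>2 < (D \<gamma>)\<^sup>2 + (a * \<epsilon>)\<^sup>2" by simp
  then have "\<bar>D \<gamma>\<bar> < norm (of_real (D \<gamma>) + \<i> * of_real (a * \<epsilon>))"
    unfolding cmod_def real_sqrt_abs[symmetric] by (intro real_sqrt_less_mono) simp
  then show ?thesis unfolding sqrt_discr_eps_eq[OF assms] by simp
qed

lemma sqrt_discr_eps_tendsto: "(sqrt_discr_eps A lam n t \<gamma> \<longlongrightarrow> csqrt (of_real (D \<gamma>))) (at_right 0)"
proof (rule Lim_transform_eventually)
  have "((\<lambda>\<epsilon>. Complex (sqrt ((norm (of_real (D \<gamma>) + \<i> * of_real (a * \<epsilon>)) + D \<gamma>) / 2))
            (sqrt ((norm (of_real (D \<gamma>) + \<i> * of_real (a * \<epsilon>)) - D \<gamma>) / 2))) \<longlongrightarrow>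
         Complex (sqrt ((norm (of_real (D \<gamma>) + \<i> * of_real (a * 0)) + D \<gamma>) / 2))
            (sqrt ((norm (of_real (D \<gamma>) + \<i> * of_real (a * 0)) - D \<gamma>) / 2))) (at_right (0::real))"
    by (intro tendsto_intros) auto
  also have "Complex (sqrt ((norm (of_real (D \<gamma>) + \<i> * of_real (a * 0)) + D \<gamma>) / 2))
            (sqrt ((norm (of_real (D \<gamma>) + \<i> * of_real (a * 0)) - D \<gamma>) / 2)) = csqrt (of_real (D \<gamma>))"
    by (simp add: complex_eq_iff)
  finally show "((\<lambda>\<epsilon>. Complex (sqrt ((norm (of_real (D \<gamma>) + \<i> * of_real (a * \<epsilon>)) + D \<gamma>) / 2))
            (sqrt ((norm (of_real (D \<gamma>) + \<i> * of_real (a * \<epsilon>)) - D \<gamma>) / 2))) \<longlongrightarrow>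
         csqrt (of_real (D \<gamma>))) (at_right (0::real))" .
  show "\<forall>\<^sub>F \<epsilon> in at_right 0. Complex (sqrt ((norm (of_real (D \<gamma>) + \<i> * of_real (a * \<epsilon>)) + D \<gamma>) / 2))
            (sqrt ((norm (of_real (D \<gamma>) + \<i> * of_real (a * \<epsilon>)) - D \<gamma>) / 2)) = sqrt_discr_eps A lam n t \<gamma> \<epsilon>"
    using sqrt_discr_eps_eq by (simp add: eventually_at_filter)
qed

lemma sqrt_discr_eq: "sqrt_discr A lam n t \<gamma> = csqrt (of_real (D \<gamma>))"
  unfolding sqrt_discr_def by (rule tendsto_Lim[OF _ sqrt_discr_eps_tendsto]) simp

lemma s_plus_eq: "s_plus A lam n t \<gamma> = - of_real (b \<gamma>) / of_real a + sqrt_discr A lam n t \<gamma> / of_real a"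
  unfolding s_plus_def s_plus_eps_def sqrt_discr_eq
  by (rule tendsto_Lim) (use a_pos in \<open>auto intro!: tendsto_intros sqrt_discr_eps_tendsto\<close>)

text \<open>The discriminant is \<open>a lam\<close> minus a quadratic form, hence its other level sets meet every ray
  from the origin at most once.\<close>

lemma negligible_discr_level:
  assumes "\<mu> \<noteq> a * lam"
  shows "negligible {\<gamma>. D \<gamma> = \<mu>}"
proof (rule starlike_negligible[where a = 0])
  have "continuous_on UNIV D" by (rule continuous_coefs)
  then have "closed (D -` {\<mu>})" using continuous_on_closed_vimage[of UNIV D] by simp
  then show "closed {\<gamma>. D \<gamma> = \<mu>}" by (simp add: vimage_def)
  fix k :: real and \<gamma> assume *: "0 + k *\<^sub>R \<gamma> \<in> {\<gamma>. D \<gamma> = \<mu>}" "0 \<le> k" "0 + \<gamma> \<in> {\<gamma>. D \<gamma> = \<mu>}"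
  have "D (k *\<^sub>R \<gamma>) = a * lam + k\<^sup>2 * (D \<gamma> - a * lam)"
    by (simp add: discr_def coef_b_def coef_c_def linear_scale[OF tangential_linear]
        matrix_vector_mult_scaleR algebra_simps power2_eq_square)
  then have "(k\<^sup>2 - 1) * (\<mu> - a * lam) = 0" using * by (simp add: algebra_simps)
  then have "k\<^sup>2 = 1" using assms by simp
  then show "k = 1" using \<open>0 \<le> k\<close> by (simp add: power2_eq_1_iff)
qed

lemma AE_discr_neq:
  assumes "\<mu> \<noteq> a * lam"
  shows "AE \<gamma> in lebesgue. D \<gamma> \<noteq> \<mu>"
  using AE_not_in[of "{\<gamma>. D \<gamma> = \<mu>}" lebesgue] negligible_discr_level[OF assms]
  by (simp add: negligible_iff_null_sets)

text \<open>A line with \<open>D < 0\<close> does not meet the Fermi surface.\<close>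

lemma symbol_real_lower_bound:
  assumes "D \<gamma> \<le> - \<kappa>" "\<kappa> > 0"
  shows "norm (symbol A lam n t \<gamma> (of_real s) - \<i> * of_real \<epsilon>) \<ge> \<kappa> / a"
proof -
  have "a * (a * s\<^sup>2 + 2 * b \<gamma> * s + c \<gamma>) \<ge> \<kappa>"
    unfolding a_symbol_real using assms zero_le_power2[of "a * s + b \<gamma>"] by linarith
  then have "\<kappa> / a \<le> a * s\<^sup>2 + 2 * b \<gamma> * s + c \<gamma>" using a_pos by (simp add: field_simps)
  also have "\<dots> = Re (symbol A lam n t \<gamma> (of_real s) - \<i> * of_real \<epsilon>)"
    by (simp add: symbol_of_real)
  finally show ?thesis using complex_Re_le_cmod order_trans by blast
qed

text \<open>The root \<open>s\<^sub>+(\<gamma>, \<epsilon>)\<close> is not on the boundary of the rectangle: the damped symbol vanishes at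
  the root but not on the deformed contour, and the imaginary part of the root is positive.\<close>

lemma line_integral_cauchy:
  assumes i: "i \<in> ind A lam n t \<delta> \<eta> \<gamma>" and "D \<gamma> > - (a * \<eta>)" and "\<rho> > 0" and "\<epsilon> > 0"
  defines "I \<equiv> {lower_end i \<gamma><..<upper_end i \<gamma>}"
  assumes V: "open V" "closure (rectangle I \<rho>) \<subseteq> V" "F holomorphic_on V"
    and nz: "\<And>z. z \<in> path_image (deformed_contour I \<rho>) \<Longrightarrow> symbol A lam n t \<gamma> z \<noteq> \<i> * of_real \<epsilon>"
  shows "(LINT s:I|lebesgue. exp (\<i> * of_real R * of_real s) * F (of_real s) /
        (symbol A lam n t \<gamma> (of_real s) - \<i> * of_real \<epsilon>)) =
    contour_integral (deformed_contour I \<rho>) (\<lambda>z. exp (\<i> * of_real R * z) * cont_on_rect I \<rho> F z /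
        (symbol A lam n t \<gamma> z - \<i> * of_real \<epsilon>))
    + pi * \<i> * (exp (\<i> * of_real R * s_plus_eps A lam n t \<gamma> \<epsilon>) *
        cont_on_rect I \<rho> F (s_plus_eps A lam n t \<gamma> \<epsilon>) / sqrt_discr_eps A lam n t \<gamma> \<epsilon>)"
proof -
  let ?q = "sqrt_discr_eps A lam n t \<gamma> \<epsilon>" and ?s = "s_plus_eps A lam n t \<gamma> \<epsilon>"
  have lu: "lower_end i \<gamma> < upper_end i \<gamma>" using lower_less_upper_iff[OF i] assms(2) by simp
  have K: "closure (rectangle I \<rho>) = cbox (Complex (lower_end i \<gamma>) 0) (Complex (upper_end i \<gamma>) \<rho>)"
    unfolding I_def by (rule closure_rectangle[OF lu \<open>\<rho> > 0\<close>])
  have "of_real a * symbol A lam n t \<gamma> ?s = ?q\<^sup>2 - of_real (D \<gamma>)"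
    unfolding a_symbol using a_pos by (simp add: s_plus_eps_def field_simps)
  also have "\<dots> = of_real a * (\<i> * of_real \<epsilon>)"
    by (simp add: sqrt_discr_eps_square discr_def)
  finally have "symbol A lam n t \<gamma> ?s = \<i> * of_real \<epsilon>" using a_pos by simp
  then have "?s \<notin> path_image (deformed_contour I \<rho>)" using nz by blast
  moreover have "Im ?s > 0" using Im_sqrt_discr_eps_pos[OF \<open>\<epsilon> > 0\<close>] a_pos by (simp add: s_plus_eps_def)
  ultimately have off: "?s \<notin> path_image (rectpath (Complex (lower_end i \<gamma>) 0) (Complex (upper_end i \<gamma>) \<rho>))"
    using lu \<open>\<rho> > 0\<close> by (auto simp: path_image_rectpath_eq I_def)
  have "contour_integral (deformed_contour I \<rho>) (\<lambda>z. exp (\<i> * of_real R * z) * cont_on_rect I \<rho> F z /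
        (symbol A lam n t \<gamma> z - \<i> * of_real \<epsilon>))
     = contour_integral (deformed_contour I \<rho>) (\<lambda>z. exp (\<i> * of_real R * z) * F z /
        (symbol A lam n t \<gamma> z - \<i> * of_real \<epsilon>))"
    using lu \<open>\<rho> > 0\<close>
    by (intro contour_integral_eq) (auto simp: cont_on_rect_def K[unfolded I_def] path_image_deformed_contour I_def)
  then show ?thesis
    using line_integral_eq_contour_plus_residue[OF lu \<open>\<rho> > 0\<close> V(1) V(2)[unfolded K] V(3) a_pos
        sqrt_discr_eps_square Im_sqrt_discr_eps_pos[OF \<open>\<epsilon> > 0\<close>], where R = R] off
    unfolding s_plus_eps_def symbol_def I_def by simp
qed

lemma line_integral_damping_limit:
  assumes i: "i \<in> ind A lam n t \<delta> \<eta> \<gamma>" and "D \<gamma> > - (a * \<eta>)" and "\<rho> > 0"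
    and D: "D \<gamma> \<noteq> 0" "D \<gamma> \<noteq> - (a * \<rho>)\<^sup>2"
  defines "I \<equiv> {lower_end i \<gamma><..<upper_end i \<gamma>}"
  assumes V: "open V" "closure (rectangle I \<rho>) \<subseteq> V" "F holomorphic_on V"
  shows "((\<lambda>\<epsilon>. LINT s:I|lebesgue. exp (\<i> * of_real R * of_real s) * F (of_real s) /
        (symbol A lam n t \<gamma> (of_real s) - \<i> * of_real \<epsilon>)) \<longlongrightarrow>
    contour_integral (deformed_contour I \<rho>) (\<lambda>z. exp (\<i> * of_real R * z) * cont_on_rect I \<rho> F z /
        symbol A lam n t \<gamma> z)
    + pi * \<i> * (exp (\<i> * of_real R * s_plus A lam n t \<gamma>) *
        cont_on_rect I \<rho> F (s_plus A lam n t \<gamma>) / sqrt_discr A lam n t \<gamma>)) (at_right 0)"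
proof -
  have lu: "lower_end i \<gamma> < upper_end i \<gamma>" using lower_less_upper_iff[OF i] assms(2) by simp
  have K: "closure (rectangle I \<rho>) = cbox (Complex (lower_end i \<gamma>) 0) (Complex (upper_end i \<gamma>) \<rho>)"
    unfolding I_def by (rule closure_rectangle[OF lu \<open>\<rho> > 0\<close>])
  have "contour_integral (deformed_contour I \<rho>) (\<lambda>z. exp (\<i> * of_real R * z) * cont_on_rect I \<rho> F z /
        symbol A lam n t \<gamma> z)
     = contour_integral (deformed_contour I \<rho>) (\<lambda>z. exp (\<i> * of_real R * z) * F z / symbol A lam n t \<gamma> z)"
    using lu \<open>\<rho> > 0\<close>
    by (intro contour_integral_eq) (auto simp: cont_on_rect_def K[unfolded I_def] path_image_deformed_contour I_def)
  moreover have "(b \<gamma>)\<^sup>2 - a * c \<gamma> \<noteq> 0" using D(1) by (simp add: discr_def)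
  moreover have "of_real a * z\<^sup>2 + 2 * of_real (b \<gamma>) * z + of_real (c \<gamma>) \<noteq> 0"
    if "z \<in> path_image (deformed_contour I \<rho>)" for z
    using symbol_nonzero_on_contour[OF i \<open>\<rho> > 0\<close> assms(2) D(2)] that
    unfolding I_def symbol_def by blast
  moreover have "(sqrt_discr_eps A lam n t \<gamma> \<longlongrightarrow> sqrt_discr A lam n t \<gamma>) (at_right 0)"
    unfolding sqrt_discr_eq by (rule sqrt_discr_eps_tendsto)
  ultimately show ?thesis
    using line_integral_limit[OF lu \<open>\<rho> > 0\<close> V(1) V(2)[unfolded K] V(3) a_pos
        sqrt_discr_eps_square Im_sqrt_discr_eps_pos, where q\<^sub>0 = "sqrt_discr A lam n t \<gamma>" and R = R]
    unfolding s_plus_eq symbol_def I_def by simp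
qed

text \<open>The factor \<open>exp (i R z)\<close> is bounded by \<open>1\<close> in the upper half-plane because \<open>R > 0\<close>.\<close>

lemma norm_exp_upper_half_plane:
  assumes "R > 0" "Im z \<ge> 0"
  shows "norm (exp (\<i> * of_real R * z)) \<le> 1"
  using assms by (simp add: norm_exp_eq_Re)

text \<open>The bound is uniform in \<open>\<gamma>\<close> and \<open>\<epsilon>\<close> in terms of the quantities that the integrability assumption
  controls: the mass of the source on the contour, and the residue at the damped root.\<close>

lemma line_integral_bound_by_contour:
  assumes i: "i \<in> ind A lam n t \<delta> \<eta> \<gamma>" and "\<rho> > 0" and "R > 0"
    and D: "D \<gamma> \<ge> - (a * \<eta>) / 2" "D \<gamma> \<ge> - (a * \<rho>)\<^sup>2 / 2"
  defines "I \<equiv> {lower_end i \<gamma><..<upper_end i \<gamma>}"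
    and "\<mu> \<equiv> min (a * \<eta> / 2) ((a * \<rho>)\<^sup>2 / 4) / a"
  assumes V: "open V" "closure (rectangle I \<rho>) \<subseteq> V" "F holomorphic_on V"
    and \<epsilon>: "0 < \<epsilon>" "\<epsilon> < \<mu> / 2"
  shows "norm (LINT s:I|lebesgue. exp (\<i> * of_real R * of_real s) * F (of_real s) /
        (symbol A lam n t \<gamma> (of_real s) - \<i> * of_real \<epsilon>)) \<le>
    2 / \<mu> * ((LINT \<tau>:{0..\<rho>}|lebesgue. norm (cont_on_rect I \<rho> F (Complex (Inf I) \<tau>)))
      + (LINT s:I|lebesgue. norm (cont_on_rect I \<rho> F (Complex s \<rho>)))
      + (LINT \<tau>:{0..\<rho>}|lebesgue. norm (cont_on_rect I \<rho> F (Complex (Sup I) \<tau>))))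
    + pi * norm (cont_on_rect I \<rho> F (s_plus_eps A lam n t \<gamma> \<epsilon>) / sqrt_discr_eps A lam n t \<gamma> \<epsilon>)"
proof -
  let ?H = "cont_on_rect I \<rho> F" and ?C = "deformed_contour I \<rho>"
  let ?\<alpha> = "lower_end i \<gamma>" and ?\<beta> = "upper_end i \<gamma>"
  let ?G = "\<lambda>z. exp (\<i> * of_real R * z) * ?H z / (symbol A lam n t \<gamma> z - \<i> * of_real \<epsilon>)"
  have Dg: "D \<gamma> > - (a * \<eta>)" using D(1) a\<eta>_pos by linarith
  have lu: "?\<alpha> < ?\<beta>" using lower_less_upper_iff[OF i] Dg by simp
  have K: "closure (rectangle I \<rho>) = cbox (Complex ?\<alpha> 0) (Complex ?\<beta> \<rho>)"
    unfolding I_def by (rule closure_rectangle[OF lu \<open>\<rho> > 0\<close>])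
  have PI: "path_image ?C = {z \<in> cbox (Complex ?\<alpha> 0) (Complex ?\<beta> \<rho>). Re z = ?\<alpha> \<or> Re z = ?\<beta> \<or> Im z = \<rho>}"
    unfolding I_def by (rule path_image_deformed_contour[OF lu \<open>\<rho> > 0\<close>])
  have IS: "Inf I = ?\<alpha>" "Sup I = ?\<beta>" using lu by (simp_all add: I_def)
  have "\<mu> > 0" using a_pos \<eta>_pos \<open>\<rho> > 0\<close> by (simp add: \<mu>_def)
  have low: "norm (symbol A lam n t \<gamma> z - \<i> * of_real \<epsilon>) \<ge> \<mu> / 2" if "z \<in> path_image ?C" for z
    using symbol_lower_bound_on_contour[OF i \<open>\<rho> > 0\<close> D, of z] that \<epsilon>
      norm_triangle_ineq2[of "symbol A lam n t \<gamma> z" "\<i> * of_real \<epsilon>"]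
    by (simp add: I_def[symmetric] \<mu>_def[symmetric] norm_mult)
  have nz: "symbol A lam n t \<gamma> z - \<i> * of_real \<epsilon> \<noteq> 0" if "z \<in> path_image ?C" for z
    using low[OF that] \<open>\<mu> > 0\<close> by auto
  have "continuous_on (path_image ?C) F"
    using V PI K by (intro holomorphic_on_imp_continuous_on[OF holomorphic_on_subset[OF V(3)]]) auto
  then have Hc: "continuous_on (path_image ?C) ?H"
    by (rule continuous_on_eq) (auto simp: cont_on_rect_def K PI)
  have Gc: "continuous_on (path_image ?C) ?G"
    using nz unfolding symbol_def by (intro continuous_intros Hc) (auto simp: symbol_def)
  have Gb: "norm (?G z) \<le> 2 / \<mu> * norm (?H z)" if "z \<in> path_image ?C" for z
  proof -
    have "Im z \<ge> 0" using that by (auto simp: PI in_cbox_complex_iff)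
    then have "norm (?G z) \<le> 1 * norm (?H z) / (\<mu> / 2)"
      unfolding norm_mult norm_divide using low[OF that] norm_exp_upper_half_plane[OF \<open>R > 0\<close>, of z] \<open>\<mu> > 0\<close>
      by (intro frac_le mult_right_mono) auto
    then show ?thesis by (simp add: mult.commute)
  qed
  note Gs = deformed_contour_sides[OF lu \<open>\<rho> > 0\<close> Gc[unfolded I_def], folded I_def]
  note Hs = deformed_contour_sides(3-5)[OF lu \<open>\<rho> > 0\<close> Hc[unfolded I_def], folded I_def]
  have side: "norm (LINT \<tau>:S|lebesgue. ?G (w \<tau>)) \<le> 2 / \<mu> * (LINT \<tau>:S|lebesgue. norm (?H (w \<tau>)))"
    if "set_integrable lebesgue S (\<lambda>\<tau>. ?G (w \<tau>))" "set_integrable lebesgue S (\<lambda>\<tau>. ?H (w \<tau>))"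
      "\<And>\<tau>. \<tau> \<in> S \<Longrightarrow> w \<tau> \<in> path_image ?C" for S and w :: "real \<Rightarrow> complex"
  proof -
    have "norm (LINT \<tau>:S|lebesgue. ?G (w \<tau>)) \<le> (LINT \<tau>:S|lebesgue. norm (?G (w \<tau>)))"
      by (rule set_integral_norm_bound[OF that(1)])
    also have "\<dots> \<le> (LINT \<tau>:S|lebesgue. 2 / \<mu> * norm (?H (w \<tau>)))"
      using that Gb by (intro set_integral_mono set_integrable_norm set_integrable_mult_right) auto
    also have "\<dots> = 2 / \<mu> * (LINT \<tau>:S|lebesgue. norm (?H (w \<tau>)))" by simp
    finally show ?thesis .
  qed
  have s1: "norm (LINT \<tau>:{0..\<rho>}|lebesgue. ?G (Complex ?\<alpha> \<tau>)) \<le> 2 / \<mu> * (LINT \<tau>:{0..\<rho>}|lebesgue. norm (?H (Complex ?\<alpha> \<tau>)))"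
    using lu by (intro side Gs Hs) (auto simp: PI in_cbox_complex_iff)
  have s2: "norm (LINT s:I|lebesgue. ?G (Complex s \<rho>)) \<le> 2 / \<mu> * (LINT s:I|lebesgue. norm (?H (Complex s \<rho>)))"
    using \<open>\<rho> > 0\<close> by (intro side Gs Hs) (auto simp: PI[unfolded I_def] in_cbox_complex_iff I_def)
  have s3: "norm (LINT \<tau>:{0..\<rho>}|lebesgue. ?G (Complex ?\<beta> \<tau>)) \<le> 2 / \<mu> * (LINT \<tau>:{0..\<rho>}|lebesgue. norm (?H (Complex ?\<beta> \<tau>)))"
    using lu by (intro side Gs Hs) (auto simp: PI in_cbox_complex_iff)
  have tri: "norm (\<i> * x + y - \<i> * z) \<le> norm x + norm y + norm z" for x y z :: complex
    using norm_triangle_ineq[of "\<i> * x" y] norm_triangle_ineq4[of "\<i> * x + y" "\<i> * z"]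
    by (simp add: norm_mult)
  have C: "norm (contour_integral ?C ?G) \<le> 2 / \<mu> * ((LINT \<tau>:{0..\<rho>}|lebesgue. norm (?H (Complex (Inf I) \<tau>)))
      + (LINT s:I|lebesgue. norm (?H (Complex s \<rho>)))
      + (LINT \<tau>:{0..\<rho>}|lebesgue. norm (?H (Complex (Sup I) \<tau>))))"
    unfolding Gs(2) IS distrib_left
    by (rule order_trans[OF tri]) (intro add_mono s1 s2 s3)
  have "Im (s_plus_eps A lam n t \<gamma> \<epsilon>) \<ge> 0"
    using Im_sqrt_discr_eps_pos[OF \<epsilon>(1), of \<gamma>] a_pos by (simp add: s_plus_eps_def)
  then have e: "norm (exp (\<i> * of_real R * s_plus_eps A lam n t \<gamma> \<epsilon>)) \<le> 1"
    by (rule norm_exp_upper_half_plane[OF \<open>R > 0\<close>])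
  have r: "norm (pi * \<i> * (exp (\<i> * of_real R * s_plus_eps A lam n t \<gamma> \<epsilon>) *
        ?H (s_plus_eps A lam n t \<gamma> \<epsilon>) / sqrt_discr_eps A lam n t \<gamma> \<epsilon>))
      \<le> pi * norm (?H (s_plus_eps A lam n t \<gamma> \<epsilon>) / sqrt_discr_eps A lam n t \<gamma> \<epsilon>)"
    using mult_right_mono[OF e, of "pi * norm (?H (s_plus_eps A lam n t \<gamma> \<epsilon>) / sqrt_discr_eps A lam n t \<gamma> \<epsilon>)"]
    by (simp add: norm_mult norm_divide mult_ac)
  have "(LINT s:I|lebesgue. exp (\<i> * of_real R * of_real s) * F (of_real s) /
        (symbol A lam n t \<gamma> (of_real s) - \<i> * of_real \<epsilon>)) = contour_integral ?C ?G
      + pi * \<i> * (exp (\<i> * of_real R * s_plus_eps A lam n t \<gamma> \<epsilon>) *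
        ?H (s_plus_eps A lam n t \<gamma> \<epsilon>) / sqrt_discr_eps A lam n t \<gamma> \<epsilon>)"
    unfolding I_def
    by (rule line_integral_cauchy[OF i Dg \<open>\<rho> > 0\<close> \<epsilon>(1) V[unfolded I_def]])
      (use nz in \<open>auto simp: I_def\<close>)
  then show ?thesis
    using order_trans[OF norm_triangle_ineq add_mono[OF C r]] by simp
qed

end

section \<open>The source and its pieces\<close>

locale fermi_source = fermi_geometry A lam n t \<delta> \<eta>
  for A :: "real ^ 'd ^ 'd" and lam :: real and n :: "real ^ 'd"
    and t :: "'m::finite \<Rightarrow> real ^ 'd" and \<delta> \<eta> :: real +
  fixes fhat :: "real ^ 'd \<Rightarrow> complex" and J :: nat and P :: "nat \<Rightarrow> (real ^ 'm) set"
    and idx :: "nat \<Rightarrow> seg_index" and \<rho> :: "nat \<Rightarrow> real"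
    and fc :: "nat \<Rightarrow> real ^ 'm \<Rightarrow> complex \<Rightarrow> complex" and R :: real
  assumes fhat_integrable: "integrable lebesgue fhat"
    and asm_A: "assumption_A A lam n t \<delta> \<eta> fhat J P idx \<rho> fc"
    and asm_B: "assumption_B A lam n t \<delta> \<eta> fhat J P idx \<rho> fc"
    and R_pos: "R > 0"
begin

abbreviation U :: "(real ^ 'd) set" where "U \<equiv> fermi_nbhd A lam n t \<delta> \<eta>"
abbreviation seg :: "nat \<Rightarrow> real ^ 'm \<Rightarrow> real set" where
  "seg j \<gamma> \<equiv> segment A lam n t \<delta> \<eta> (idx j) \<gamma>"
abbreviation h :: "nat \<Rightarrow> real ^ 'm \<Rightarrow> complex \<Rightarrow> complex" where
  "h \<equiv> fhat_cont A lam n t \<delta> \<eta> idx \<rho> fc"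
abbreviation piece :: "nat \<Rightarrow> (real ^ 'd) set" where
  "piece j \<equiv> U_piece A lam n t \<delta> \<eta> (P j) (idx j)"
abbreviation residue_term :: "nat \<Rightarrow> real ^ 'm \<Rightarrow> complex" where
  "residue_term \<equiv> residue_integrand A lam n t \<delta> \<eta> idx \<rho> fc R"
abbreviation contour_fun :: "nat \<Rightarrow> real ^ 'm \<Rightarrow> complex \<Rightarrow> complex" where
  "contour_fun \<equiv> contour_integrand A lam n t \<delta> \<eta> idx \<rho> fc R"
abbreviation contour_path :: "nat \<Rightarrow> real ^ 'm \<Rightarrow> real \<Rightarrow> complex" where
  "contour_path \<equiv> contour A lam n t \<delta> \<eta> idx \<rho>"

definition damped :: "real \<Rightarrow> real ^ 'd \<Rightarrow> complex" where
  "damped \<epsilon> \<xi> = exp (\<i> * of_real ((R *\<^sub>R n) \<bullet> \<xi>)) * fhat \<xi> /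
     (of_real (\<xi> \<bullet> (A *v \<xi>)) - of_real lam - \<i> * of_real \<epsilon>)"

definition line_integral :: "nat \<Rightarrow> real \<Rightarrow> real ^ 'm \<Rightarrow> complex" where
  "line_integral j \<epsilon> \<gamma> = (LINT s:seg j \<gamma>|lebesgue. damped \<epsilon> (line_point (\<gamma>, s)))"

definition parameter_set :: "nat \<Rightarrow> ((real ^ 'm) \<times> real) set" where
  "parameter_set j = {(\<gamma>, s). \<gamma> \<in> P j \<and> s \<in> seg j \<gamma>}"

lemmas pieces_parameters = asm_A[unfolded assumption_A_def, THEN conjunct1]
lemmas pieces_geometry = asm_A[unfolded assumption_A_def, THEN conjunct2]
lemmas pieces_continuation = pieces_geometry[THEN conjunct2, THEN conjunct2, THEN conjunct2]

lemma P_open: "j \<in> {1..J} \<Longrightarrow> open (P j)"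
  by (rule bspec[OF pieces_parameters, THEN conjunct1])

lemma idx_in_ind: "j \<in> {1..J} \<Longrightarrow> \<gamma> \<in> P j \<Longrightarrow> idx j \<in> ind A lam n t \<delta> \<eta> \<gamma>"
  by (rule bspec[OF bspec[OF pieces_parameters, THEN conjunct2, THEN conjunct2, THEN conjunct2, THEN conjunct2]])

lemma \<rho>_pos: "j \<in> {1..J} \<Longrightarrow> \<rho> j > 0"
  by (rule bspec[OF pieces_continuation, THEN conjunct1])

lemma pieces_disjoint: "j \<in> {1..J} \<Longrightarrow> k \<in> {1..J} \<Longrightarrow> j \<noteq> k \<Longrightarrow> piece j \<inter> piece k = {}"
  using pieces_geometry[THEN conjunct1] by simp

lemma pieces_cover: "negligible (U - (\<Union>j\<in>{1..J}. piece j))"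
  by (rule pieces_geometry[THEN conjunct2, THEN conjunct2, THEN conjunct1])

lemma continuation:
  assumes "j \<in> {1..J}" "\<gamma> \<in> P j"
  shows "\<exists>V. open V \<and> closure (rectangle (seg j \<gamma>) (\<rho> j)) \<subseteq> V \<and> fc j \<gamma> holomorphic_on V \<and>
    (\<forall>s\<in>seg j \<gamma>. fc j \<gamma> (of_real s) = fhat (line_point (\<gamma>, s)))"
  using bspec[OF pieces_continuation assms(1)] assms(2) by (simp add: line_point_def)

lemma seg_eq: "j \<in> {1..J} \<Longrightarrow> \<gamma> \<in> P j \<Longrightarrow> seg j \<gamma> = {lower_end (idx j) \<gamma><..<upper_end (idx j) \<gamma>}"
  by (rule segment_eq[OF idx_in_ind])

lemma seg_empty_iff: "j \<in> {1..J} \<Longrightarrow> \<gamma> \<in> P j \<Longrightarrow> seg j \<gamma> = {} \<longleftrightarrow> D \<gamma> \<le> - (a * \<eta>)"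
  using lower_less_upper_iff[OF idx_in_ind, of j \<gamma>] by (simp add: seg_eq not_less[symmetric])

lemma seg_lebesgue: "j \<in> {1..J} \<Longrightarrow> \<gamma> \<in> P j \<Longrightarrow> seg j \<gamma> \<in> sets lebesgue"
  by (simp add: seg_eq)

lemma h_eq: "h j \<gamma> = cont_on_rect (seg j \<gamma>) (\<rho> j) (fc j \<gamma>)"
  by (simp add: fhat_cont_def)

lemma h_empty: "seg j \<gamma> = {} \<Longrightarrow> h j \<gamma> z = 0"
  by (simp add: h_eq cont_on_rect_def rectangle_def)

lemma open_parameter_set:
  assumes "j \<in> {1..J}"
  shows "open (parameter_set j)"
proof -
  have "parameter_set j = {z. fst z \<in> P j} \<inter> {z. lower_end (idx j) (fst z) < snd z}
      \<inter> {z. snd z < upper_end (idx j) (fst z)}"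
    using assms by (auto simp: parameter_set_def seg_eq)
  moreover have "open {z :: (real ^ 'm) \<times> real. fst z \<in> P j}"
    using open_vimage_fst[OF P_open[OF assms]] by (simp add: vimage_def)
  moreover have "open {z :: (real ^ 'm) \<times> real. lower_end (idx j) (fst z) < snd z}"
    by (intro open_Collect_less continuous_intros continuous_on_compose2[OF continuous_ends(1)]) auto
  moreover have "open {z :: (real ^ 'm) \<times> real. snd z < upper_end (idx j) (fst z)}"
    by (intro open_Collect_less continuous_intros continuous_on_compose2[OF continuous_ends(2)]) auto
  ultimately show ?thesis by auto
qed

lemma piece_eq: "piece j = line_point ` parameter_set j"
  by (force simp: U_piece_def parameter_set_def line_point_def image_iff)

lemma open_piece: "j \<in> {1..J} \<Longrightarrow> open (piece j)"
  unfolding piece_eq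
  by (rule open_surjective_linear_image[OF open_parameter_set line_point_linear surj_line_point])

lemma U_eq: "U = {\<xi>. \<bar>\<xi> \<bullet> (A *v \<xi>) - lam\<bar> < \<eta>}"
  using symbol_off_nbhd by (force simp: fermi_nbhd_def)

lemma continuous_quadratic_form: "continuous_on S (\<lambda>\<xi>. \<xi> \<bullet> (A *v \<xi>))"
  by (intro continuous_intros matrix_vector_mult_linear_continuous_on)

lemma open_U: "open U"
  unfolding U_eq by (intro open_Collect_less continuous_intros continuous_quadratic_form)

lemma piece_subset_U:
  assumes "j \<in> {1..J}"
  shows "piece j \<subseteq> U"
proof
  fix \<xi> assume "\<xi> \<in> piece j"
  then obtain \<gamma> s where z: "\<gamma> \<in> P j" "s \<in> seg j \<gamma>" "\<xi> = line_point (\<gamma>, s)"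
    by (auto simp: piece_eq parameter_set_def)
  have "seg j \<gamma> \<subseteq> line_params A lam n t \<delta> \<eta> \<gamma>"
    using idx_in_ind[OF assms z(1)] seg_eq[OF assms z(1)]
    by (elim in_ind_cases) (simp_all add: line_params_low line_params_high)
  then show "\<xi> \<in> U" using z by (auto simp: line_params_def line_point_def)
qed

text \<open>The coordinates \<open>(\<gamma>, s)\<close> turn the piece into a set fibred over \<open>P j\<close>, to which Fubini applies.\<close>

lemma piece_integral:
  fixes f :: "real ^ 'd \<Rightarrow> complex"
  assumes j: "j \<in> {1..J}" and f: "integrable lebesgue f"
  shows "integrable lebesgue (\<lambda>z. indicator (parameter_set j) z *\<^sub>R f (line_point z))"
    and "set_integrable lebesgue (P j) (\<lambda>\<gamma>. LINT s:seg j \<gamma>|lebesgue. f (line_point (\<gamma>, s)))"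
    and "(LINT \<xi>:piece j|lebesgue. f \<xi>) = (LINT \<gamma>:P j|lebesgue. LINT s:seg j \<gamma>|lebesgue. f (line_point (\<gamma>, s)))"
proof -
  have "piece j \<in> sets lebesgue" using open_piece[OF j] by auto
  then have F: "integrable lebesgue (\<lambda>\<xi>. indicator (piece j) \<xi> *\<^sub>R f \<xi>)"
    using f by (rule integrable_mult_indicator)
  have ind: "indicator (piece j) (line_point z) = (indicator (parameter_set j) z :: real)" for z
    by (simp add: piece_eq indicator_def inj_image_mem_iff[OF inj_line_point])
  note iso = lebesgue_integral_isometry[OF dist_line_point surj_line_point dim_line_point F, unfolded ind]
  show i: "integrable lebesgue (\<lambda>z. indicator (parameter_set j) z *\<^sub>R f (line_point z))"
    by (rule iso(1))
  have sec: "(LINT s|lebesgue. indicator (parameter_set j) (\<gamma>, s) *\<^sub>R f (line_point (\<gamma>, s)))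
      = indicator (P j) \<gamma> *\<^sub>R (LINT s:seg j \<gamma>|lebesgue. f (line_point (\<gamma>, s)))" for \<gamma>
    by (cases "\<gamma> \<in> P j") (simp_all add: parameter_set_def set_lebesgue_integral_def indicator_def)
  note Fub = lebesgue_Fubini[OF i, unfolded sec]
  show "set_integrable lebesgue (P j) (\<lambda>\<gamma>. LINT s:seg j \<gamma>|lebesgue. f (line_point (\<gamma>, s)))"
    unfolding set_integrable_def by (rule Fub(2))
  show "(LINT \<xi>:piece j|lebesgue. f \<xi>) = (LINT \<gamma>:P j|lebesgue. LINT s:seg j \<gamma>|lebesgue. f (line_point (\<gamma>, s)))"
    unfolding set_lebesgue_integral_def[of lebesgue "piece j"] set_lebesgue_integral_def[of lebesgue "P j"]
      Fub(3) by (rule iso(2)[symmetric])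
qed

lemma integral_over_U:
  fixes f :: "real ^ 'd \<Rightarrow> complex"
  assumes f: "integrable lebesgue f"
  shows "(LINT \<xi>:U|lebesgue. f \<xi>) = (\<Sum>j=1..J. LINT \<xi>:piece j|lebesgue. f \<xi>)"
proof -
  let ?N = "U - (\<Union>j\<in>{1..J}. piece j)"
  have N: "AE \<xi> in lebesgue. \<xi> \<notin> ?N"
    using pieces_cover by (intro AE_not_in) (simp add: negligible_iff_null_sets)
  have sum: "(\<Sum>j=1..J. indicator (piece j) \<xi> *\<^sub>R f \<xi>) = indicator U \<xi> *\<^sub>R f \<xi>" if "\<xi> \<notin> ?N" for \<xi>
  proof (cases "\<exists>k\<in>{1..J}. \<xi> \<in> piece k")
    case True
    then obtain k where k: "k \<in> {1..J}" "\<xi> \<in> piece k" by blast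
    have "(\<Sum>j=1..J. indicator (piece j) \<xi> *\<^sub>R f \<xi>) = (\<Sum>j\<in>{1..J}. if j = k then f \<xi> else 0)"
      using pieces_disjoint[OF k(1)] k by (intro sum.cong) (auto simp: indicator_def)
    then show ?thesis using k piece_subset_U by (auto simp: indicator_def)
  next
    case False
    then have "\<xi> \<notin> U" using that by blast
    with False show ?thesis by (simp add: indicator_def)
  qed
  have m: "integrable lebesgue (\<lambda>\<xi>. indicator (piece j) \<xi> *\<^sub>R f \<xi>)" if "j \<in> {1..J}" for j
    using open_piece[OF that] by (intro integrable_mult_indicator f) auto
  have "(\<Sum>j=1..J. LINT \<xi>:piece j|lebesgue. f \<xi>) = (LINT \<xi>|lebesgue. (\<Sum>j=1..J. indicator (piece j) \<xi> *\<^sub>R f \<xi>))"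
    unfolding set_lebesgue_integral_def using m by (intro Bochner_Integration.integral_sum[symmetric]) auto
  also have "\<dots> = (LINT \<xi>:U|lebesgue. f \<xi>)"
    unfolding set_lebesgue_integral_def
  proof (rule integral_cong_AE)
    show "(\<lambda>\<xi>. \<Sum>j=1..J. indicator (piece j) \<xi> *\<^sub>R f \<xi>) \<in> borel_measurable lebesgue"
      using m by (intro borel_measurable_sum borel_measurable_integrable) auto
    show "(\<lambda>\<xi>. indicator U \<xi> *\<^sub>R f \<xi>) \<in> borel_measurable lebesgue"
      using open_U by (intro borel_measurable_integrable integrable_mult_indicator f) auto
    show "AE \<xi> in lebesgue. (\<Sum>j=1..J. indicator (piece j) \<xi> *\<^sub>R f \<xi>) = indicator U \<xi> *\<^sub>R f \<xi>"
      using N by eventually_elim (rule sum)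
  qed
  finally show ?thesis ..
qed

section \<open>The limit on the complement of the neighbourhood\<close>

lemma phase_measurable: "(\<lambda>\<xi>. exp (\<i> * of_real ((R *\<^sub>R n) \<bullet> \<xi>))) \<in> borel_measurable lebesgue"
proof -
  have "continuous_on UNIV (\<lambda>\<xi>. exp (\<i> * complex_of_real ((R *\<^sub>R n) \<bullet> \<xi>)))"
    by (intro continuous_intros)
  then show ?thesis by (intro measurable_completion) (simp add: borel_measurable_continuous_onI)
qed

lemma quadratic_form_measurable: "(\<lambda>\<xi>. \<xi> \<bullet> (A *v \<xi>)) \<in> borel_measurable lebesgue"
  using continuous_quadratic_form
  by (intro measurable_completion) (simp add: borel_measurable_continuous_onI)

lemma damped_measurable [measurable]: "damped \<epsilon> \<in> borel_measurable lebesgue"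
proof -
  note [measurable] = phase_measurable quadratic_form_measurable borel_measurable_integrable[OF fhat_integrable]
  show ?thesis unfolding damped_def by measurable
qed

lemma norm_damped:
  "norm (damped \<epsilon> \<xi>) = norm (fhat \<xi>) / norm (of_real (\<xi> \<bullet> (A *v \<xi>)) - of_real lam - \<i> * of_real \<epsilon>)"
  by (simp add: damped_def norm_mult norm_divide norm_exp_eq_Re)

lemma damped_integrable:
  assumes "\<epsilon> > 0"
  shows "integrable lebesgue (damped \<epsilon>)"
proof (rule Bochner_Integration.integrable_bound)
  show "integrable lebesgue (\<lambda>\<xi>. fhat \<xi> / of_real \<epsilon>)" using fhat_integrable by simp
  have "norm (damped \<epsilon> \<xi>) \<le> norm (fhat \<xi> / of_real \<epsilon>)" for \<xi>
  proof -
    have "\<epsilon> \<le> norm (of_real (\<xi> \<bullet> (A *v \<xi>)) - of_real lam - \<i> * of_real \<epsilon>)"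
      using abs_Im_le_cmod[of "of_real (\<xi> \<bullet> (A *v \<xi>)) - of_real lam - \<i> * of_real \<epsilon>"] assms by simp
    then show ?thesis
      unfolding norm_damped norm_divide using assms by (intro frac_le) auto
  qed
  then show "AE \<xi> in lebesgue. norm (damped \<epsilon> \<xi>) \<le> norm (fhat \<xi> / of_real \<epsilon>)" by simp
qed measurable

text \<open>Outside the neighbourhood \<open>|\<xi> \<bullet> A \<xi> - lam| \<ge> \<eta>\<close>, so \<open>|fhat| / \<eta>\<close> is a majorant.\<close>

lemma exterior_limit:
  defines "g \<equiv> volume_integrand A lam fhat (R *\<^sub>R n)"
  shows "set_integrable lebesgue (- U) g"
    and "((\<lambda>\<epsilon>. LINT \<xi>:- U|lebesgue. damped \<epsilon> \<xi>) \<longlongrightarrow> (LINT \<xi>:- U|lebesgue. g \<xi>)) (at_right 0)"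
proof -
  have cU: "- U \<in> sets lebesgue" using open_U by auto
  have "norm (indicator (- U) \<xi> *\<^sub>R damped \<epsilon> \<xi>) \<le> norm (fhat \<xi>) / \<eta>" if "\<epsilon> > 0" for \<epsilon> \<xi>
  proof (cases "\<xi> \<in> U")
    case False
    have "\<eta> \<le> \<bar>Re (of_real (\<xi> \<bullet> (A *v \<xi>)) - of_real lam - \<i> * of_real \<epsilon>)\<bar>"
      using symbol_off_nbhd[OF False] by simp
    also have "\<dots> \<le> norm (of_real (\<xi> \<bullet> (A *v \<xi>)) - of_real lam - \<i> * of_real \<epsilon>)"
      by (rule abs_Re_le_cmod)
    finally show ?thesis
      using False \<eta>_pos by (auto simp: norm_damped intro!: frac_le)
  qed (use \<eta>_pos in simp)
  then have bound: "AE \<xi> in lebesgue. \<forall>\<epsilon>. 0 < \<epsilon> \<and> \<epsilon> < 1 \<longrightarrow>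
      norm (indicator (- U) \<xi> *\<^sub>R damped \<epsilon> \<xi>) \<le> norm (fhat \<xi>) / \<eta>" by simp
  have "((\<lambda>\<epsilon>. indicator (- U) \<xi> *\<^sub>R damped \<epsilon> \<xi>) \<longlongrightarrow> indicator (- U) \<xi> *\<^sub>R g \<xi>) (at_right 0)" for \<xi>
  proof (cases "\<xi> \<in> U")
    case False
    have "of_real (\<xi> \<bullet> (A *v \<xi>)) - of_real lam - \<i> * of_real 0 \<noteq> (0::complex)"
      using symbol_off_nbhd[OF False] \<eta>_pos by (auto simp del: of_real_diff simp: of_real_diff[symmetric])
    then have "((\<lambda>\<epsilon>. damped \<epsilon> \<xi>) \<longlongrightarrow> damped 0 \<xi>) (at_right 0)"
      unfolding damped_def by (intro tendsto_intros)
    moreover have "damped 0 \<xi> = g \<xi>" by (simp add: damped_def g_def volume_integrand_def)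
    ultimately show ?thesis by (simp add: tendsto_scaleR)
  qed simp
  then have lim: "AE \<xi> in lebesgue. ((\<lambda>\<epsilon>. indicator (- U) \<xi> *\<^sub>R damped \<epsilon> \<xi>) \<longlongrightarrow>
      indicator (- U) \<xi> *\<^sub>R g \<xi>) (at_right 0)" by simp
  have meas: "(\<lambda>\<xi>. indicator (- U) \<xi> *\<^sub>R damped \<epsilon> \<xi>) \<in> borel_measurable lebesgue" for \<epsilon>
    using cU by measurable
  have G: "integrable lebesgue (\<lambda>\<xi>. norm (fhat \<xi>) / \<eta>)" using fhat_integrable by simp
  note dct = dominated_convergence_at_right_0[OF zero_less_one G meas bound lim]
  show "set_integrable lebesgue (- U) g" unfolding set_integrable_def by (rule dct(1))
  show "((\<lambda>\<epsilon>. LINT \<xi>:- U|lebesgue. damped \<epsilon> \<xi>) \<longlongrightarrow> (LINT \<xi>:- U|lebesgue. g \<xi>)) (at_right 0)"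
    unfolding set_lebesgue_integral_def by (rule dct(2))
qed

section \<open>The limit on a piece\<close>

lemma damped_on_line:
  assumes "j \<in> {1..J}" "\<gamma> \<in> P j" "s \<in> seg j \<gamma>"
  shows "damped \<epsilon> (line_point (\<gamma>, s)) = exp (\<i> * of_real R * of_real s) * fc j \<gamma> (of_real s) /
    (symbol A lam n t \<gamma> (of_real s) - \<i> * of_real \<epsilon>)"
proof -
  have "fc j \<gamma> (of_real s) = fhat (line_point (\<gamma>, s))"
    using continuation[OF assms(1,2)] assms(3) by blast
  moreover have "(R *\<^sub>R n) \<bullet> line_point (\<gamma>, s) = R * s"
    using norm_n tangential_perp[of \<gamma>]
    by (simp add: line_point_def inner_add_right inner_commute[of n "tangential t \<gamma>"] norm_eq_1)
  then have "exp (\<i> * of_real ((R *\<^sub>R n) \<bullet> line_point (\<gamma>, s))) = exp (\<i> * of_real R * of_real s)"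
    by (simp only: of_real_mult mult.assoc)
  ultimately show ?thesis
    unfolding damped_def symbol_of_real symbol_line_point[symmetric] by (simp only: of_real_diff)
qed

lemma line_integral_continued:
  assumes "j \<in> {1..J}" "\<gamma> \<in> P j"
  shows "line_integral j \<epsilon> \<gamma> = (LINT s:seg j \<gamma>|lebesgue. exp (\<i> * of_real R * of_real s) *
    fc j \<gamma> (of_real s) / (symbol A lam n t \<gamma> (of_real s) - \<i> * of_real \<epsilon>))"
  unfolding line_integral_def
  by (rule set_lebesgue_integral_cong[OF seg_lebesgue[OF assms]]) (use damped_on_line[OF assms] in blast)

lemma contour_fun_empty: "seg j \<gamma> = {} \<Longrightarrow> contour_fun j \<gamma> = (\<lambda>z. 0)"
  by (simp add: contour_integrand_def h_empty fun_eq_iff)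

lemma line_integral_tendsto:
  assumes j: "j \<in> {1..J}" and \<gamma>: "\<gamma> \<in> P j" and D: "D \<gamma> \<noteq> 0" "D \<gamma> \<noteq> - (a * \<rho> j)\<^sup>2"
  shows "((\<lambda>\<epsilon>. line_integral j \<epsilon> \<gamma>) \<longlongrightarrow>
    contour_integral (contour_path j \<gamma>) (contour_fun j \<gamma>) + pi * \<i> * residue_term j \<gamma>) (at_right 0)"
proof (cases "seg j \<gamma> = {}")
  case True
  then show ?thesis
    by (simp add: line_integral_def set_lebesgue_integral_def contour_fun_empty residue_integrand_def h_empty)
next
  case False
  then have low: "D \<gamma> > - (a * \<eta>)" using seg_empty_iff[OF j \<gamma>] by simp
  obtain V where V: "open V" "closure (rectangle (seg j \<gamma>) (\<rho> j)) \<subseteq> V" "fc j \<gamma> holomorphic_on V"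
    using continuation[OF j \<gamma>] by blast
  show ?thesis
    unfolding line_integral_continued[OF j \<gamma>] contour_def contour_integrand_def residue_integrand_def h_eq
    using line_integral_damping_limit[OF idx_in_ind[OF j \<gamma>] low \<rho>_pos[OF j] D, folded seg_eq[OF j \<gamma>], OF V]
    by simp
qed

text \<open>These two masses, both integrable over \<open>P j\<close>, make up the majorant of the line integrals together
  with the function from the integrability assumption.\<close>

definition side_mass :: "nat \<Rightarrow> real ^ 'm \<Rightarrow> real" where
  "side_mass j \<gamma> = (LINT \<tau>:{0..\<rho> j}|lebesgue. norm (h j \<gamma> (Complex (Inf (seg j \<gamma>)) \<tau>)))
    + (LINT s:seg j \<gamma>|lebesgue. norm (h j \<gamma> (Complex s (\<rho> j))))
    + (LINT \<tau>:{0..\<rho> j}|lebesgue. norm (h j \<gamma> (Complex (Sup (seg j \<gamma>)) \<tau>)))"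

definition real_mass :: "nat \<Rightarrow> real ^ 'm \<Rightarrow> real" where
  "real_mass j \<gamma> = (LINT s:seg j \<gamma>|lebesgue. norm (fhat (line_point (\<gamma>, s))))"

lemma h_sides_integrable:
  assumes "j \<in> {1..J}"
  shows "set_integrable lebesgue {(\<gamma>, \<tau>). \<gamma> \<in> P j \<and> \<tau> \<in> {0..\<rho> j}}
          (\<lambda>(\<gamma>, \<tau>). h j \<gamma> (Complex (Inf (seg j \<gamma>)) \<tau>))"
    and "set_integrable lebesgue {(\<gamma>, s). \<gamma> \<in> P j \<and> s \<in> seg j \<gamma>} (\<lambda>(\<gamma>, s). h j \<gamma> (Complex s (\<rho> j)))"
    and "set_integrable lebesgue {(\<gamma>, \<tau>). \<gamma> \<in> P j \<and> \<tau> \<in> {0..\<rho> j}}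
          (\<lambda>(\<gamma>, \<tau>). h j \<gamma> (Complex (Sup (seg j \<gamma>)) \<tau>))"
proof -
  have "L1_deformed A lam n t \<delta> \<eta> J P idx \<rho> fhat h"
    using asm_B unfolding assumption_B_def by (rule conjunct2)
  note L = bspec[OF conjunct2[OF this[unfolded L1_deformed_def]] assms]
  have S: "P j \<times> {0..\<rho> j} = {(\<gamma>, \<tau>). \<gamma> \<in> P j \<and> \<tau> \<in> {0..\<rho> j}}" by auto
  show "set_integrable lebesgue {(\<gamma>, \<tau>). \<gamma> \<in> P j \<and> \<tau> \<in> {0..\<rho> j}}
          (\<lambda>(\<gamma>, \<tau>). h j \<gamma> (Complex (Inf (seg j \<gamma>)) \<tau>))"
    by (rule L[THEN conjunct1, unfolded S])
  show "set_integrable lebesgue {(\<gamma>, s). \<gamma> \<in> P j \<and> s \<in> seg j \<gamma>} (\<lambda>(\<gamma>, s). h j \<gamma> (Complex s (\<rho> j)))"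
    by (rule L[THEN conjunct2, THEN conjunct1])
  show "set_integrable lebesgue {(\<gamma>, \<tau>). \<gamma> \<in> P j \<and> \<tau> \<in> {0..\<rho> j}}
          (\<lambda>(\<gamma>, \<tau>). h j \<gamma> (Complex (Sup (seg j \<gamma>)) \<tau>))"
    by (rule L[THEN conjunct2, THEN conjunct2, unfolded S])
qed

lemma side_mass_integrable:
  assumes "j \<in> {1..J}"
  shows "set_integrable lebesgue (P j) (side_mass j)"
  unfolding side_mass_def
  using h_sides_integrable[OF assms, THEN section_norm_integrable(1)]
  by (intro set_integral_add) simp_all

lemma fhat_parameter_integrable:
  assumes "j \<in> {1..J}"
  shows "set_integrable lebesgue {(\<gamma>, s). \<gamma> \<in> P j \<and> s \<in> seg j \<gamma>} (\<lambda>z. fhat (line_point z))"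
  using piece_integral(1)[OF assms fhat_integrable]
  unfolding set_integrable_def parameter_set_def .

lemma real_mass_integrable: "j \<in> {1..J} \<Longrightarrow> set_integrable lebesgue (P j) (real_mass j)"
  unfolding real_mass_def by (rule section_norm_integrable(1)[OF fhat_parameter_integrable])

lemma contour_sides:
  assumes j: "j \<in> {1..J}" and \<gamma>: "\<gamma> \<in> P j" and D: "D \<gamma> \<noteq> - (a * \<rho> j)\<^sup>2"
  shows "contour_fun j \<gamma> contour_integrable_on contour_path j \<gamma>"
    and "contour_integral (contour_path j \<gamma>) (contour_fun j \<gamma>) =
      \<i> * (LINT \<tau>:{0..\<rho> j}|lebesgue. contour_fun j \<gamma> (Complex (Inf (seg j \<gamma>)) \<tau>))
      + (LINT s:seg j \<gamma>|lebesgue. contour_fun j \<gamma> (Complex s (\<rho> j)))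
      - \<i> * (LINT \<tau>:{0..\<rho> j}|lebesgue. contour_fun j \<gamma> (Complex (Sup (seg j \<gamma>)) \<tau>))"
proof -
  let ?\<alpha> = "lower_end (idx j) \<gamma>" and ?\<beta> = "upper_end (idx j) \<gamma>"
  have "contour_fun j \<gamma> contour_integrable_on contour_path j \<gamma> \<and>
    contour_integral (contour_path j \<gamma>) (contour_fun j \<gamma>) =
      \<i> * (LINT \<tau>:{0..\<rho> j}|lebesgue. contour_fun j \<gamma> (Complex (Inf (seg j \<gamma>)) \<tau>))
      + (LINT s:seg j \<gamma>|lebesgue. contour_fun j \<gamma> (Complex s (\<rho> j)))
      - \<i> * (LINT \<tau>:{0..\<rho> j}|lebesgue. contour_fun j \<gamma> (Complex (Sup (seg j \<gamma>)) \<tau>))"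
  proof (cases "seg j \<gamma> = {}")
    case True
    have "(\<lambda>z. 0) contour_integrable_on contour_path j \<gamma>"
      using has_contour_integral_0 contour_integrable_on_def by blast
    then show ?thesis unfolding contour_fun_empty[OF True] by simp
  next
    case False
    then have low: "D \<gamma> > - (a * \<eta>)" using seg_empty_iff[OF j \<gamma>] by simp
    have lu: "?\<alpha> < ?\<beta>" using lower_less_upper_iff[OF idx_in_ind[OF j \<gamma>]] low by simp
    obtain V where V: "open V" "closure (rectangle (seg j \<gamma>) (\<rho> j)) \<subseteq> V" "fc j \<gamma> holomorphic_on V"
      using continuation[OF j \<gamma>] by blast
    let ?C = "path_image (deformed_contour {?\<alpha><..<?\<beta>} (\<rho> j))"
    have K: "closure (rectangle (seg j \<gamma>) (\<rho> j)) = cbox (Complex ?\<alpha> 0) (Complex ?\<beta> (\<rho> j))"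
      unfolding seg_eq[OF j \<gamma>] by (rule closure_rectangle[OF lu \<rho>_pos[OF j]])
    have C: "?C \<subseteq> cbox (Complex ?\<alpha> 0) (Complex ?\<beta> (\<rho> j))"
      unfolding path_image_deformed_contour[OF lu \<rho>_pos[OF j]] by blast
    have "continuous_on ?C (fc j \<gamma>)"
      using V(2) C unfolding K
      by (intro holomorphic_on_imp_continuous_on[OF holomorphic_on_subset[OF V(3)]]) blast
    then have "continuous_on ?C (h j \<gamma>)"
      by (rule continuous_on_eq) (use C in \<open>auto simp: h_eq cont_on_rect_def K\<close>)
    moreover have "symbol A lam n t \<gamma> z \<noteq> 0" if "z \<in> ?C" for z
      by (rule symbol_nonzero_on_contour[OF idx_in_ind[OF j \<gamma>] \<rho>_pos[OF j] low D that])
    ultimately have cont: "continuous_on ?C (contour_fun j \<gamma>)"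
      unfolding contour_integrand_def symbol_def by (intro continuous_intros) auto
    have IS: "Inf (seg j \<gamma>) = ?\<alpha>" "Sup (seg j \<gamma>) = ?\<beta>" using lu by (simp_all add: seg_eq[OF j \<gamma>])
    show ?thesis
      using deformed_contour_sides(1,2)[OF lu \<rho>_pos[OF j] cont] unfolding contour_def IS
      unfolding seg_eq[OF j \<gamma>] by blast
  qed
  then show "contour_fun j \<gamma> contour_integrable_on contour_path j \<gamma>"
    and "contour_integral (contour_path j \<gamma>) (contour_fun j \<gamma>) =
      \<i> * (LINT \<tau>:{0..\<rho> j}|lebesgue. contour_fun j \<gamma> (Complex (Inf (seg j \<gamma>)) \<tau>))
      + (LINT s:seg j \<gamma>|lebesgue. contour_fun j \<gamma> (Complex s (\<rho> j)))
      - \<i> * (LINT \<tau>:{0..\<rho> j}|lebesgue. contour_fun j \<gamma> (Complex (Sup (seg j \<gamma>)) \<tau>))"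
    by blast+
qed

lemma contour_kernel_measurable:
  assumes z: "continuous_on UNIV z"
  shows "(\<lambda>p :: (real ^ 'm) \<times> real. exp (\<i> * of_real R * z p) / symbol A lam n t (fst p) (z p)) \<in> borel_measurable lebesgue"
proof -
  have "continuous_on UNIV (\<lambda>p. exp (\<i> * of_real R * z p))" by (intro continuous_intros z)
  moreover have "continuous_on UNIV (\<lambda>p. symbol A lam n t (fst p) (z p))"
    unfolding symbol_def
    by (intro continuous_intros z continuous_on_compose2[OF continuous_coefs(1)]
        continuous_on_compose2[OF continuous_coefs(2)]) auto
  ultimately show ?thesis
    by (intro measurable_completion) (simp add: borel_measurable_continuous_onI borel_measurable_divide)
qed

text \<open>The integrand on each side is the continued source, jointly measurable because it is integrable over the
  contours, times a Borel function of \<open>\<gamma>\<close> and the arc length.\<close>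

lemma contour_integral_measurable:
  assumes j: "j \<in> {1..J}"
  shows "set_borel_measurable lebesgue (P j) (\<lambda>\<gamma>. contour_integral (contour_path j \<gamma>) (contour_fun j \<gamma>))"
proof -
  have side: "set_borel_measurable lebesgue (P j) (\<lambda>\<gamma>. LINT \<tau>:T \<gamma>|lebesgue. contour_fun j \<gamma> (w \<gamma> \<tau>))"
    if i: "set_integrable lebesgue {(\<gamma>, \<tau>). \<gamma> \<in> P j \<and> \<tau> \<in> T \<gamma>} (\<lambda>(\<gamma>, \<tau>). h j \<gamma> (w \<gamma> \<tau>))"
      and z: "continuous_on UNIV z"
      and wz: "\<And>\<gamma> \<tau>. \<gamma> \<in> P j \<Longrightarrow> seg j \<gamma> \<noteq> {} \<Longrightarrow> w \<gamma> \<tau> = z (\<gamma>, \<tau>)"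
    for T w and z :: "(real ^ 'm) \<times> real \<Rightarrow> complex"
  proof -
    let ?S = "{(\<gamma>, \<tau>). \<gamma> \<in> P j \<and> \<tau> \<in> T \<gamma>}"
    have "(\<lambda>p. indicator ?S p *\<^sub>R (case p of (\<gamma>, \<tau>) \<Rightarrow> h j \<gamma> (w \<gamma> \<tau>)) *
        (exp (\<i> * of_real R * z p) / symbol A lam n t (fst p) (z p))) \<in> borel_measurable lebesgue"
      using contour_kernel_measurable[OF z] i unfolding set_integrable_def
      by (intro borel_measurable_times) auto
    also have "(\<lambda>p. indicator ?S p *\<^sub>R (case p of (\<gamma>, \<tau>) \<Rightarrow> h j \<gamma> (w \<gamma> \<tau>)) *
        (exp (\<i> * of_real R * z p) / symbol A lam n t (fst p) (z p)))
      = (\<lambda>p. indicator ?S p *\<^sub>R (case p of (\<gamma>, \<tau>) \<Rightarrow> contour_fun j \<gamma> (w \<gamma> \<tau>)))"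
    proof
      fix p :: "(real ^ 'm) \<times> real"
      obtain \<gamma> \<tau> where p: "p = (\<gamma>, \<tau>)" by (cases p)
      show "indicator ?S p *\<^sub>R (case p of (\<gamma>, \<tau>) \<Rightarrow> h j \<gamma> (w \<gamma> \<tau>)) *
          (exp (\<i> * of_real R * z p) / symbol A lam n t (fst p) (z p))
        = indicator ?S p *\<^sub>R (case p of (\<gamma>, \<tau>) \<Rightarrow> contour_fun j \<gamma> (w \<gamma> \<tau>))"
      proof (cases "p \<in> ?S \<and> seg j \<gamma> \<noteq> {}")
        case True
        then show ?thesis using wz[of \<gamma> \<tau>] by (simp add: p contour_integrand_def)
      next
        case False
        then have "p \<notin> ?S \<or> seg j \<gamma> = {}" by blast
        then show ?thesis
          by (elim disjE) (simp_all add: p h_empty contour_fun_empty)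
      qed
    qed
    finally have "set_borel_measurable lebesgue ?S (\<lambda>(\<gamma>, \<tau>). contour_fun j \<gamma> (w \<gamma> \<tau>))"
      unfolding set_borel_measurable_def .
    from section_integral_measurable[OF this] show ?thesis by simp
  qed
  have IS: "Inf (seg j \<gamma>) = lower_end (idx j) \<gamma>" "Sup (seg j \<gamma>) = upper_end (idx j) \<gamma>"
    if "\<gamma> \<in> P j" "seg j \<gamma> \<noteq> {}" for \<gamma>
    using that by (simp_all add: seg_eq[OF j])
  have ends: "continuous_on UNIV (\<lambda>p :: (real ^ 'm) \<times> real. Complex (lower_end (idx j) (fst p)) (snd p))"
    "continuous_on UNIV (\<lambda>p :: (real ^ 'm) \<times> real. Complex (upper_end (idx j) (fst p)) (snd p))"
    "continuous_on UNIV (\<lambda>p :: (real ^ 'm) \<times> real. Complex (snd p) (\<rho> j))"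
    by (auto intro!: continuous_intros continuous_on_compose2[OF continuous_ends(1)[of UNIV]]
        continuous_on_compose2[OF continuous_ends(2)[of UNIV]])
  have s1: "set_borel_measurable lebesgue (P j)
      (\<lambda>\<gamma>. LINT \<tau>:{0..\<rho> j}|lebesgue. contour_fun j \<gamma> (Complex (Inf (seg j \<gamma>)) \<tau>))"
    by (rule side[OF h_sides_integrable(1)[OF j] ends(1)]) (simp add: IS)
  have s2: "set_borel_measurable lebesgue (P j)
      (\<lambda>\<gamma>. LINT s:seg j \<gamma>|lebesgue. contour_fun j \<gamma> (Complex s (\<rho> j)))"
    by (rule side[OF h_sides_integrable(2)[OF j] ends(3)]) simp
  have s3: "set_borel_measurable lebesgue (P j)
      (\<lambda>\<gamma>. LINT \<tau>:{0..\<rho> j}|lebesgue. contour_fun j \<gamma> (Complex (Sup (seg j \<gamma>)) \<tau>))"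
    by (rule side[OF h_sides_integrable(3)[OF j] ends(2)]) (simp add: IS)
  let ?sum = "\<lambda>\<gamma>. \<i> * (indicator (P j) \<gamma> *\<^sub>R (LINT \<tau>:{0..\<rho> j}|lebesgue. contour_fun j \<gamma> (Complex (Inf (seg j \<gamma>)) \<tau>)))
      + indicator (P j) \<gamma> *\<^sub>R (LINT s:seg j \<gamma>|lebesgue. contour_fun j \<gamma> (Complex s (\<rho> j)))
      - \<i> * (indicator (P j) \<gamma> *\<^sub>R (LINT \<tau>:{0..\<rho> j}|lebesgue. contour_fun j \<gamma> (Complex (Sup (seg j \<gamma>)) \<tau>)))"
  have "?sum \<in> borel_measurable lebesgue"
    using s1 s2 s3 unfolding set_borel_measurable_def
    by (intro borel_measurable_diff borel_measurable_add borel_measurable_times borel_measurable_const)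
  moreover have "AE \<gamma> in lebesgue. ?sum \<gamma> =
      indicator (P j) \<gamma> *\<^sub>R contour_integral (contour_path j \<gamma>) (contour_fun j \<gamma>)"
  proof -
    have "- (a * \<rho> j)\<^sup>2 \<noteq> a * lam"
      using a_pos lam_pos zero_le_power2[of "a * \<rho> j"] mult_pos_pos[OF a_pos lam_pos] by linarith
    from AE_discr_neq[OF this] show ?thesis
    proof eventually_elim
      case (elim \<gamma>)
      show ?case
        by (cases "\<gamma> \<in> P j") (simp_all add: contour_sides(2)[OF j _ elim])
    qed
  qed
  ultimately show ?thesis
    unfolding set_borel_measurable_def by (rule borel_measurable_AE)
qed

lemma residue_majorant:
  assumes "j \<in> {1..J}"
  shows "\<exists>\<epsilon>\<^sub>0>0. \<exists>g :: real ^ 'm \<Rightarrow> real. set_integrable lebesgue (P j) g \<and>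
      (\<forall>\<epsilon> \<gamma>. 0 < \<epsilon> \<and> \<epsilon> < \<epsilon>\<^sub>0 \<and> \<gamma> \<in> P j \<longrightarrow>
        norm (h j \<gamma> (s_plus_eps A lam n t \<gamma> \<epsilon>) / sqrt_discr_eps A lam n t \<gamma> \<epsilon>) \<le> g \<gamma>)"
  by (rule bspec[OF asm_B[unfolded assumption_B_def, THEN conjunct1] assms])

text \<open>Where \<open>D \<ge> - \<kappa>\<close> the contour stays away from both roots, and the shifted integral is bounded by
  the mass on the contour and the residue. Where \<open>D < - \<kappa>\<close> a root may come close to the contour (if the
  rectangle is low), but there the symbol is bounded below on the line itself, and the
  undeformed integral is bounded by the mass on the line.\<close>

lemma line_integral_dominated:
  assumes j: "j \<in> {1..J}"
  obtains \<epsilon>\<^sub>0 G where "\<epsilon>\<^sub>0 > 0" "set_integrable lebesgue (P j) G"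
    "AE \<gamma> in lebesgue. \<gamma> \<in> P j \<longrightarrow> (\<forall>\<epsilon>. 0 < \<epsilon> \<and> \<epsilon> < \<epsilon>\<^sub>0 \<longrightarrow> norm (line_integral j \<epsilon> \<gamma>) \<le> (G \<gamma> :: real))"
proof -
  obtain \<epsilon>\<^sub>1 g where g: "\<epsilon>\<^sub>1 > 0" "set_integrable lebesgue (P j) g"
    "\<And>\<epsilon> \<gamma>. 0 < \<epsilon> \<Longrightarrow> \<epsilon> < \<epsilon>\<^sub>1 \<Longrightarrow> \<gamma> \<in> P j \<Longrightarrow>
      norm (h j \<gamma> (s_plus_eps A lam n t \<gamma> \<epsilon>) / sqrt_discr_eps A lam n t \<gamma> \<epsilon>) \<le> g \<gamma>"
    using residue_majorant[OF j] by metis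
  \<comment> \<open>\<open>\<mu>\<close> is the lower bound of the symbol on the contour, and \<open>\<kappa>\<close> the threshold up to which it holds.
    Damping with \<open>\<epsilon> < \<mu> / 2\<close> costs at most half of the bound.\<close>
  define \<mu> where "\<mu> = min (a * \<eta> / 2) ((a * \<rho> j)\<^sup>2 / 4) / a"
  define \<kappa> where "\<kappa> = min (a * \<eta> / 2) ((a * \<rho> j)\<^sup>2 / 2)"
  define G where "G \<gamma> = 2 / \<mu> * side_mass j \<gamma> + pi * g \<gamma> + a / \<kappa> * real_mass j \<gamma>" for \<gamma>
  have "\<mu> > 0" "\<kappa> > 0" using a_pos \<eta>_pos \<rho>_pos[OF j] by (simp_all add: \<mu>_def \<kappa>_def)
  have Gint: "set_integrable lebesgue (P j) G"
    unfolding G_def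
    by (intro set_integral_add set_integrable_mult_right side_mass_integrable[OF j] real_mass_integrable[OF j] g(2))
  have nonneg: "side_mass j \<gamma> \<ge> 0" "real_mass j \<gamma> \<ge> 0" for \<gamma>
    unfolding side_mass_def real_mass_def
    by (auto simp: set_lebesgue_integral_def intro!: add_nonneg_nonneg integral_nonneg_AE)
  have gpos: "g \<gamma> \<ge> 0" if "\<gamma> \<in> P j" for \<gamma>
    using order_trans[OF norm_ge_zero g(3)[of "\<epsilon>\<^sub>1 / 2" \<gamma>]] g(1) that by simp
  have bound: "norm (line_integral j \<epsilon> \<gamma>) \<le> G \<gamma>"
    if \<gamma>: "\<gamma> \<in> P j" and fi: "set_integrable lebesgue (seg j \<gamma>) (\<lambda>s. fhat (line_point (\<gamma>, s)))"
      and \<epsilon>: "0 < \<epsilon>" "\<epsilon> < min \<epsilon>\<^sub>1 (\<mu> / 2)" for \<epsilon> \<gamma>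
  proof (cases "D \<gamma> \<ge> - \<kappa>")
    case True
    then have D: "D \<gamma> \<ge> - (a * \<eta>) / 2" "D \<gamma> \<ge> - (a * \<rho> j)\<^sup>2 / 2"
      by (simp_all add: \<kappa>_def min_def split: if_splits)
    obtain V where V: "open V" "closure (rectangle (seg j \<gamma>) (\<rho> j)) \<subseteq> V" "fc j \<gamma> holomorphic_on V"
      using continuation[OF j \<gamma>] by blast
    have "norm (line_integral j \<epsilon> \<gamma>) \<le> 2 / \<mu> * side_mass j \<gamma>
        + pi * norm (h j \<gamma> (s_plus_eps A lam n t \<gamma> \<epsilon>) / sqrt_discr_eps A lam n t \<gamma> \<epsilon>)"
      unfolding line_integral_continued[OF j \<gamma>] side_mass_def h_eq
      using line_integral_bound_by_contour[OF idx_in_ind[OF j \<gamma>] \<rho>_pos[OF j] R_pos D,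
          folded seg_eq[OF j \<gamma>] \<mu>_def, OF V, of \<epsilon>] \<epsilon> by simp
    also have "\<dots> \<le> 2 / \<mu> * side_mass j \<gamma> + pi * g \<gamma>"
      using g(3)[of \<epsilon> \<gamma>] \<epsilon> \<gamma> by (intro add_left_mono mult_left_mono) auto
    also have "\<dots> \<le> G \<gamma>"
      using a_pos \<open>\<kappa> > 0\<close> nonneg(2)[of \<gamma>] by (simp add: G_def)
    finally show ?thesis .
  next
    case False
    have pt: "norm (damped \<epsilon> (line_point (\<gamma>, s))) \<le> a / \<kappa> * norm (fhat (line_point (\<gamma>, s)))" for s
    proof -
      have "\<kappa> / a \<le> norm (symbol A lam n t \<gamma> (of_real s) - \<i> * of_real \<epsilon>)"
        using False \<open>\<kappa> > 0\<close> by (intro symbol_real_lower_bound) auto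
      then have "norm (damped \<epsilon> (line_point (\<gamma>, s))) \<le> norm (fhat (line_point (\<gamma>, s))) / (\<kappa> / a)"
        unfolding norm_damped symbol_of_real symbol_line_point[symmetric] of_real_diff
        using a_pos \<open>\<kappa> > 0\<close> by (intro frac_le) auto
      then show ?thesis by (simp add: field_simps)
    qed
    have "norm (line_integral j \<epsilon> \<gamma>) \<le> (LINT s:seg j \<gamma>|lebesgue. a / \<kappa> * norm (fhat (line_point (\<gamma>, s))))"
      unfolding line_integral_def set_lebesgue_integral_def
    proof (rule order_trans[OF integral_norm_bound], rule integral_mono')
      show "integrable lebesgue (\<lambda>s. indicator (seg j \<gamma>) s *\<^sub>R (a / \<kappa> * norm (fhat (line_point (\<gamma>, s)))))"
        using set_integrable_mult_right[OF set_integrable_norm[OF fi], of "a / \<kappa>"]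
        by (simp add: set_integrable_def)
      show "norm (indicator (seg j \<gamma>) s *\<^sub>R damped \<epsilon> (line_point (\<gamma>, s)))
          \<le> indicator (seg j \<gamma>) s *\<^sub>R (a / \<kappa> * norm (fhat (line_point (\<gamma>, s))))" for s
        using pt[of s] by (simp add: indicator_def)
      show "0 \<le> indicator (seg j \<gamma>) s *\<^sub>R (a / \<kappa> * norm (fhat (line_point (\<gamma>, s))))" for s
        using a_pos \<open>\<kappa> > 0\<close> by (simp add: indicator_def)
    qed
    also have "\<dots> = a / \<kappa> * real_mass j \<gamma>" by (simp add: real_mass_def)
    also have "\<dots> \<le> G \<gamma>"
      using nonneg(1)[of \<gamma>] gpos[OF \<gamma>] \<open>\<mu> > 0\<close> by (simp add: G_def)
    finally show ?thesis .
  qed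
  show thesis
  proof (rule that[OF _ Gint, of "min \<epsilon>\<^sub>1 (\<mu> / 2)"])
    show "min \<epsilon>\<^sub>1 (\<mu> / 2) > 0" using g(1) \<open>\<mu> > 0\<close> by simp
    show "AE \<gamma> in lebesgue. \<gamma> \<in> P j \<longrightarrow>
        (\<forall>\<epsilon>. 0 < \<epsilon> \<and> \<epsilon> < min \<epsilon>\<^sub>1 (\<mu> / 2) \<longrightarrow> norm (line_integral j \<epsilon> \<gamma>) \<le> G \<gamma>)"
      using section_norm_integrable(2)[OF fhat_parameter_integrable[OF j]]
      by eventually_elim (use bound in blast)
  qed
qed

text \<open>The majorant of the integrability assumption, which is given for \<open>\<epsilon> > 0\<close>, passes to the limit.\<close>

lemma residue_term_bound:
  assumes j: "j \<in> {1..J}" and \<gamma>: "\<gamma> \<in> P j" and D: "D \<gamma> \<noteq> 0" "D \<gamma> \<noteq> - (a * \<rho> j)\<^sup>2"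
    and "\<epsilon>\<^sub>0 > 0" and g: "\<And>\<epsilon>. 0 < \<epsilon> \<Longrightarrow> \<epsilon> < \<epsilon>\<^sub>0 \<Longrightarrow>
      norm (h j \<gamma> (s_plus_eps A lam n t \<gamma> \<epsilon>) / sqrt_discr_eps A lam n t \<gamma> \<epsilon>) \<le> g"
  shows "norm (residue_term j \<gamma>) \<le> g"
proof (cases "seg j \<gamma> = {}")
  case True
  have "g \<ge> 0" using g[of "\<epsilon>\<^sub>0 / 2"] \<open>\<epsilon>\<^sub>0 > 0\<close> by (simp add: h_empty[OF True])
  then show ?thesis by (simp add: residue_integrand_def h_empty[OF True])
next
  case False
  then have low: "D \<gamma> > - (a * \<eta>)" using seg_empty_iff[OF j \<gamma>] by simp
  let ?\<alpha> = "lower_end (idx j) \<gamma>" and ?\<beta> = "upper_end (idx j) \<gamma>"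
  have lu: "?\<alpha> < ?\<beta>" using lower_less_upper_iff[OF idx_in_ind[OF j \<gamma>]] low by simp
  obtain V where V: "open V" "closure (rectangle (seg j \<gamma>) (\<rho> j)) \<subseteq> V" "fc j \<gamma> holomorphic_on V"
    using continuation[OF j \<gamma>] by blast
  have K: "closure (rectangle (seg j \<gamma>) (\<rho> j)) = cbox (Complex ?\<alpha> 0) (Complex ?\<beta> (\<rho> j))"
    unfolding seg_eq[OF j \<gamma>] by (rule closure_rectangle[OF lu \<rho>_pos[OF j]])
  let ?q = "sqrt_discr A lam n t \<gamma>" and ?s = "s_plus A lam n t \<gamma>"
  have q: "(sqrt_discr_eps A lam n t \<gamma> \<longlongrightarrow> ?q) (at_right 0)"
    unfolding sqrt_discr_eq by (rule sqrt_discr_eps_tendsto)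
  have "?q \<noteq> 0" using D(1) by (simp add: sqrt_discr_eq)
  have s: "(s_plus_eps A lam n t \<gamma> \<longlongrightarrow> ?s) (at_right 0)"
    unfolding s_plus_eq s_plus_eps_def using a_pos by (intro tendsto_intros q) auto
  have pos: "\<forall>\<^sub>F \<epsilon> in at_right 0. 0 < \<epsilon> \<and> \<epsilon> < \<epsilon>\<^sub>0"
    using eventually_at_right_real[OF \<open>\<epsilon>\<^sub>0 > 0\<close>] by simp
  have ims: "Im (s_plus_eps A lam n t \<gamma> \<epsilon>) > 0" if "\<epsilon> > 0" for \<epsilon>
    using Im_sqrt_discr_eps_pos[OF that, of \<gamma>] a_pos by (simp add: s_plus_eps_def)
  have "of_real a * symbol A lam n t \<gamma> ?s = ?q\<^sup>2 - of_real (D \<gamma>)"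
    unfolding a_symbol using a_pos by (simp add: s_plus_eq field_simps)
  then have "symbol A lam n t \<gamma> ?s = 0" using a_pos by (simp add: sqrt_discr_eq)
  then have off: "?s \<notin> path_image (deformed_contour {?\<alpha><..<?\<beta>} (\<rho> j))"
    using symbol_nonzero_on_contour[OF idx_in_ind[OF j \<gamma>] \<rho>_pos[OF j] low D(2)] by blast
  have "((\<lambda>\<epsilon>. h j \<gamma> (s_plus_eps A lam n t \<gamma> \<epsilon>)) \<longlongrightarrow> h j \<gamma> ?s) (at_right 0)"
    unfolding h_eq seg_eq[OF j \<gamma>]
    by (rule cont_on_rect_tendsto[OF lu \<rho>_pos[OF j] V(1) V(2)[unfolded K] V(3) s _ off])
      (use pos in eventually_elim, use ims in blast)
  then have "((\<lambda>\<epsilon>. norm (h j \<gamma> (s_plus_eps A lam n t \<gamma> \<epsilon>) / sqrt_discr_eps A lam n t \<gamma> \<epsilon>)) \<longlongrightarrow>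
      norm (h j \<gamma> ?s / ?q)) (at_right 0)"
    by (intro tendsto_intros q \<open>?q \<noteq> 0\<close>)
  then have lim: "norm (h j \<gamma> ?s / ?q) \<le> g"
    by (rule tendsto_upperbound) (use pos in eventually_elim, use g in blast, simp)
  have "Im ?s \<ge> 0"
    by (rule tendsto_lowerbound[OF tendsto_Im[OF s]])
      (use pos in eventually_elim, use ims in \<open>auto intro: less_imp_le\<close>)
  then have "norm (exp (\<i> * of_real R * ?s)) * norm (h j \<gamma> ?s / ?q) \<le> 1 * norm (h j \<gamma> ?s / ?q)"
    by (intro mult_right_mono norm_exp_upper_half_plane R_pos) auto
  then show ?thesis using lim by (simp add: residue_integrand_def norm_mult norm_divide)
qed

text \<open>Dominated convergence yields the integrability of the sum of the contour integral and the residue only.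
  The contour integral is measurable by itself, so the residue is measurable as a difference; it has
  an integrable majorant, and then the contour integral is integrable as a difference. A direct
  bound for the contour integral is not available, because it may be unbounded near the lines whose root lies on
  the contour.\<close>

lemma piece_limit:
  assumes j: "j \<in> {1..J}"
  shows "set_integrable lebesgue (P j) (residue_term j)"
    and "AE \<gamma> in lebesgue. \<gamma> \<in> P j \<longrightarrow> contour_fun j \<gamma> contour_integrable_on contour_path j \<gamma>"
    and "set_integrable lebesgue (P j) (\<lambda>\<gamma>. contour_integral (contour_path j \<gamma>) (contour_fun j \<gamma>))"
    and "((\<lambda>\<epsilon>. LINT \<gamma>:P j|lebesgue. line_integral j \<epsilon> \<gamma>) \<longlongrightarrow>
      (LINT \<gamma>:P j|lebesgue. contour_integral (contour_path j \<gamma>) (contour_fun j \<gamma>))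
      + pi * \<i> * (LINT \<gamma>:P j|lebesgue. residue_term j \<gamma>)) (at_right 0)"
proof -
  let ?C = "\<lambda>\<gamma>. contour_integral (contour_path j \<gamma>) (contour_fun j \<gamma>)"
  let ?L = "\<lambda>\<gamma>. ?C \<gamma> + pi * \<i> * residue_term j \<gamma>"
  have Pm: "P j \<in> sets lebesgue" using P_open[OF j] by auto
  have "a * lam > 0" using a_pos lam_pos by simp
  then have "0 \<noteq> a * lam" "- (a * \<rho> j)\<^sup>2 \<noteq> a * lam"
    using zero_le_power2[of "a * \<rho> j"] by linarith+
  from this[THEN AE_discr_neq]
  have D: "AE \<gamma> in lebesgue. D \<gamma> \<noteq> 0" "AE \<gamma> in lebesgue. D \<gamma> \<noteq> - (a * \<rho> j)\<^sup>2" .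
  show "AE \<gamma> in lebesgue. \<gamma> \<in> P j \<longrightarrow> contour_fun j \<gamma> contour_integrable_on contour_path j \<gamma>"
    using D(2) by eventually_elim (use contour_sides(1)[OF j] in blast)
  obtain \<epsilon>\<^sub>0 G where G: "\<epsilon>\<^sub>0 > 0" "set_integrable lebesgue (P j) G"
    "AE \<gamma> in lebesgue. \<gamma> \<in> P j \<longrightarrow> (\<forall>\<epsilon>. 0 < \<epsilon> \<and> \<epsilon> < \<epsilon>\<^sub>0 \<longrightarrow> norm (line_integral j \<epsilon> \<gamma>) \<le> G \<gamma>)"
    by (rule line_integral_dominated[OF j])
  have meas: "(\<lambda>\<gamma>. indicator (P j) \<gamma> *\<^sub>R line_integral j \<epsilon> \<gamma>) \<in> borel_measurable lebesgue" if "\<epsilon> > 0" for \<epsilon>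
    using piece_integral(2)[OF j damped_integrable[OF that]]
    unfolding line_integral_def set_integrable_def by (rule borel_measurable_integrable)
  have bound: "AE \<gamma> in lebesgue. \<forall>\<epsilon>. 0 < \<epsilon> \<and> \<epsilon> < \<epsilon>\<^sub>0 \<longrightarrow>
      norm (indicator (P j) \<gamma> *\<^sub>R line_integral j \<epsilon> \<gamma>) \<le> indicator (P j) \<gamma> *\<^sub>R G \<gamma>"
    using G(3) by eventually_elim (simp add: indicator_def)
  have lim: "AE \<gamma> in lebesgue. ((\<lambda>\<epsilon>. indicator (P j) \<gamma> *\<^sub>R line_integral j \<epsilon> \<gamma>) \<longlongrightarrow>
      indicator (P j) \<gamma> *\<^sub>R ?L \<gamma>) (at_right 0)"
    using D
  proof eventually_elim
    case (elim \<gamma>)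
    show ?case
    proof (cases "\<gamma> \<in> P j")
      case True
      show ?thesis using line_integral_tendsto[OF j True elim] True by simp
    qed simp
  qed
  note dct = dominated_convergence_at_right_0[OF G(1) G(2)[unfolded set_integrable_def] meas bound lim]
  have Cm: "(\<lambda>\<gamma>. indicator (P j) \<gamma> *\<^sub>R ?C \<gamma>) \<in> borel_measurable lebesgue"
    using contour_integral_measurable[OF j] unfolding set_borel_measurable_def .
  have res_eq: "indicator (P j) \<gamma> *\<^sub>R residue_term j \<gamma> =
      (indicator (P j) \<gamma> *\<^sub>R ?L \<gamma> - indicator (P j) \<gamma> *\<^sub>R ?C \<gamma>) / (pi * \<i>)" for \<gamma>
    by (simp add: indicator_def)
  have Rm: "(\<lambda>\<gamma>. indicator (P j) \<gamma> *\<^sub>R residue_term j \<gamma>) \<in> borel_measurable lebesgue"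
    unfolding res_eq using borel_measurable_integrable[OF dct(1)] Cm
    by (intro borel_measurable_divide borel_measurable_diff borel_measurable_const)
  obtain \<epsilon>\<^sub>1 g where g: "\<epsilon>\<^sub>1 > 0" "set_integrable lebesgue (P j) g"
    "\<And>\<epsilon> \<gamma>. 0 < \<epsilon> \<Longrightarrow> \<epsilon> < \<epsilon>\<^sub>1 \<Longrightarrow> \<gamma> \<in> P j \<Longrightarrow>
      norm (h j \<gamma> (s_plus_eps A lam n t \<gamma> \<epsilon>) / sqrt_discr_eps A lam n t \<gamma> \<epsilon>) \<le> g \<gamma>"
    using residue_majorant[OF j] by metis
  have "AE \<gamma> in lebesgue. norm (indicator (P j) \<gamma> *\<^sub>R residue_term j \<gamma>) \<le> norm (indicator (P j) \<gamma> *\<^sub>R g \<gamma>)"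
    using D
  proof eventually_elim
    case (elim \<gamma>)
    show ?case
    proof (cases "\<gamma> \<in> P j")
      case True
      have "norm (residue_term j \<gamma>) \<le> g \<gamma>"
        by (rule residue_term_bound[OF j True elim g(1)]) (rule g(3)[OF _ _ True])
      then show ?thesis using True by simp
    qed simp
  qed
  then have Ri: "integrable lebesgue (\<lambda>\<gamma>. indicator (P j) \<gamma> *\<^sub>R residue_term j \<gamma>)"
    by (rule Bochner_Integration.integrable_bound[OF g(2)[unfolded set_integrable_def] Rm])
  then show Rs: "set_integrable lebesgue (P j) (residue_term j)" by (simp only: set_integrable_def)
  have C_eq: "indicator (P j) \<gamma> *\<^sub>R ?C \<gamma> = indicator (P j) \<gamma> *\<^sub>R ?L \<gamma>
      - pi * \<i> * (indicator (P j) \<gamma> *\<^sub>R residue_term j \<gamma>)" for \<gamma>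
    by (simp add: indicator_def)
  show Cs: "set_integrable lebesgue (P j) ?C"
    unfolding set_integrable_def C_eq
    by (intro Bochner_Integration.integrable_diff dct(1) integrable_mult_right Ri)
  have "(LINT \<gamma>:P j|lebesgue. ?L \<gamma>) = (LINT \<gamma>:P j|lebesgue. ?C \<gamma>) + (LINT \<gamma>:P j|lebesgue. pi * \<i> * residue_term j \<gamma>)"
    by (intro set_integral_add(2) Cs set_integrable_mult_right Rs)
  also have "(LINT \<gamma>:P j|lebesgue. pi * \<i> * residue_term j \<gamma>) = pi * \<i> * (LINT \<gamma>:P j|lebesgue. residue_term j \<gamma>)"
    by simp
  finally show "((\<lambda>\<epsilon>. LINT \<gamma>:P j|lebesgue. line_integral j \<epsilon> \<gamma>) \<longlongrightarrow>
      (LINT \<gamma>:P j|lebesgue. ?C \<gamma>) + pi * \<i> * (LINT \<gamma>:P j|lebesgue. residue_term j \<gamma>)) (at_right 0)"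
    using dct(2) unfolding set_lebesgue_integral_def by simp
qed

section \<open>The limit of the damped solutions\<close>

lemma damped_integral_split:
  assumes "\<epsilon> > 0"
  shows "integral\<^sup>L lebesgue (damped \<epsilon>) =
    (LINT \<xi>:- U|lebesgue. damped \<epsilon> \<xi>) + (\<Sum>j=1..J. LINT \<gamma>:P j|lebesgue. line_integral j \<epsilon> \<gamma>)"
proof -
  have i: "set_integrable lebesgue X (damped \<epsilon>)" if "X \<in> sets lebesgue" for X
    unfolding set_integrable_def by (rule integrable_mult_indicator[OF that damped_integrable[OF assms]])
  have "integral\<^sup>L lebesgue (damped \<epsilon>) = (LINT \<xi>:- U \<union> U|lebesgue. damped \<epsilon> \<xi>)"
    by (simp add: set_lebesgue_integral_def)
  also have "\<dots> = (LINT \<xi>:- U|lebesgue. damped \<epsilon> \<xi>) + (LINT \<xi>:U|lebesgue. damped \<epsilon> \<xi>)"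
    using open_U by (intro set_integral_Un i) auto
  also have "(LINT \<xi>:U|lebesgue. damped \<epsilon> \<xi>) = (\<Sum>j=1..J. LINT \<gamma>:P j|lebesgue. line_integral j \<epsilon> \<gamma>)"
    unfolding integral_over_U[OF damped_integrable[OF assms]] line_integral_def
    by (intro sum.cong refl piece_integral(3) damped_integrable[OF assms]) 
  finally show ?thesis .
qed

lemma damped_integral_limit:
  "((\<lambda>\<epsilon>. integral\<^sup>L lebesgue (damped \<epsilon>)) \<longlongrightarrow>
    pi * \<i> * (\<Sum>j=1..J. LINT \<gamma>:P j|lebesgue. residue_term j \<gamma>)
    + integral_deformed A lam n t \<delta> \<eta> J P idx \<rho> (volume_integrand A lam fhat (R *\<^sub>R n)) contour_fun)
   (at_right 0)"
proof -
  have "((\<lambda>\<epsilon>. (LINT \<xi>:- U|lebesgue. damped \<epsilon> \<xi>) + (\<Sum>j=1..J. LINT \<gamma>:P j|lebesgue. line_integral j \<epsilon> \<gamma>)) \<longlongrightarrow>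
     (LINT \<xi>:- U|lebesgue. volume_integrand A lam fhat (R *\<^sub>R n) \<xi>)
     + (\<Sum>j=1..J. (LINT \<gamma>:P j|lebesgue. contour_integral (contour_path j \<gamma>) (contour_fun j \<gamma>))
      + pi * \<i> * (LINT \<gamma>:P j|lebesgue. residue_term j \<gamma>))) (at_right 0)"
    by (intro tendsto_add tendsto_sum exterior_limit(2) piece_limit(4))
  also have "(LINT \<xi>:- U|lebesgue. volume_integrand A lam fhat (R *\<^sub>R n) \<xi>)
     + (\<Sum>j=1..J. (LINT \<gamma>:P j|lebesgue. contour_integral (contour_path j \<gamma>) (contour_fun j \<gamma>))
      + pi * \<i> * (LINT \<gamma>:P j|lebesgue. residue_term j \<gamma>))
    = pi * \<i> * (\<Sum>j=1..J. LINT \<gamma>:P j|lebesgue. residue_term j \<gamma>)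
    + integral_deformed A lam n t \<delta> \<eta> J P idx \<rho> (volume_integrand A lam fhat (R *\<^sub>R n)) contour_fun"
    by (simp add: integral_deformed_def sum.distrib sum_distrib_left)
  finally show ?thesis
    by (rule Lim_transform_eventually) (simp add: eventually_at_filter damped_integral_split)
qed

end

theorem theorem2p8:
  fixes A :: "real ^ 'd ^ 'd"
    and lam \<delta> \<eta> :: real
    and n :: "real ^ 'd"
    and t :: "'m::finite \<Rightarrow> real ^ 'd"
    and fhat :: "real ^ 'd \<Rightarrow> complex"
    and J :: nat
    and P :: "nat \<Rightarrow> (real ^ 'm) set"
    and idx :: "nat \<Rightarrow> seg_index"
    and \<rho> :: "nat \<Rightarrow> real"
    and fc :: "nat \<Rightarrow> real ^ 'm \<Rightarrow> complex \<Rightarrow> complex"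
    and R :: real
  assumes "CARD('d) \<ge> 2"
    and "lam > 0"
    and "positive_definite A"
    and "norm n = 1"
    and "orthonormal_basis_perp n t"
    and "\<delta> > 0"
    and "0 < \<eta>" and "\<eta> < \<delta> / (2 * coef_a A n)"
    and "integrable lebesgue fhat"
    and "assumption_A A lam n t \<delta> \<eta> fhat J P idx \<rho> fc"
    and "assumption_B A lam n t \<delta> \<eta> fhat J P idx \<rho> fc"
    and "R > 0"
  shows "((\<lambda>\<epsilon>. u_damped A lam fhat \<epsilon> (R *\<^sub>R n)) \<longlongrightarrow>
           pi * \<i> / (2 * pi) ^ CARD('d) *
             (\<Sum>j=1..J. LINT \<gamma>:P j|lebesgue.
                residue_integrand A lam n t \<delta> \<eta> idx \<rho> fc R j \<gamma>)
           + 1 / (2 * pi) ^ CARD('d) *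
             integral_deformed A lam n t \<delta> \<eta> J P idx \<rho>
               (volume_integrand A lam fhat (R *\<^sub>R n))
               (contour_integrand A lam n t \<delta> \<eta> idx \<rho> fc R))
         (at_right 0)
       \<and> (\<forall>j\<in>{1..J}. set_integrable lebesgue (P j)
             (residue_integrand A lam n t \<delta> \<eta> idx \<rho> fc R j))
       \<and> integrable_deformed A lam n t \<delta> \<eta> J P idx \<rho>
           (volume_integrand A lam fhat (R *\<^sub>R n))
           (contour_integrand A lam n t \<delta> \<eta> idx \<rho> fc R)"
proof -
  interpret fermi_source A lam n t \<delta> \<eta> fhat J P idx \<rho> fc R
    by unfold_locales fact+
  have u: "u_damped A lam fhat \<epsilon> (R *\<^sub>R n) = 1 / (2 * pi) ^ CARD('d) * integral\<^sup>L lebesgue (damped \<epsilon>)" for \<epsilon>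
    by (simp only: u_damped_def damped_def[abs_def])
  have "((\<lambda>\<epsilon>. u_damped A lam fhat \<epsilon> (R *\<^sub>R n)) \<longlongrightarrow>
      1 / (2 * pi) ^ CARD('d) * (pi * \<i> * (\<Sum>j=1..J. LINT \<gamma>:P j|lebesgue. residue_term j \<gamma>)
      + integral_deformed A lam n t \<delta> \<eta> J P idx \<rho> (volume_integrand A lam fhat (R *\<^sub>R n)) contour_fun))
     (at_right 0)"
    unfolding u by (intro tendsto_mult_left damped_integral_limit)
  then show ?thesis
    using exterior_limit(1) piece_limit(1-3)
    by (simp add: integrable_deformed_def distrib_left)
qed

end
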